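(* Let $\mathbb{K}$ be a field, let $I\subset R=\mathbb{K}[x_1,\ldots,x_n]$ be a non-squarefree monomial ideal generated in degree two, and assume that the non simple graph $G$ associated to $I$ is bipartite. Then $I$ has regularity $3$ if and only if (1) $G$ either has two totally disjoint edges or $C_l<G^{c}$ for some $l\geq 5$, (2) $G$ does not have three edges that are pairwise totally disjoint, and (3) $G^{bc}$ has no induced cycle of length $\geq 8$.
   Context: The graded Betti number $\beta_{i,j}(I)$ is the number of copies of $R(-j)$ in homological degree $i$ in the minimal graded free resolution of $I$ (of the ideal $I$, not of $R/I$), and $\mathrm{reg}(I)=\max\{j-i:\beta_{i,j}(I)\neq 0\}$. The (non simple) graph $G$ associated to $I$ has vertex set $V(G)=\{x_1,\ldots,x_n\}$; its edges are the pairs $\{x_i,x_j\}$ with $x_ix_j\in I$, where $i=j$ is allowed: each minimal generator $x_i^2$ of $I$ gives a loop at $x_i$, which is an edge of $G$ (written $\{x_i,x_i\}$). Let $G_{sqf}$ be the simple graph on $\{x_1,\ldots,x_n\}$ obtained from $G$ by removing all loops. One says that $G$ is bipartite if the simple graph $G_{sqf}$ is connected and bipartite. In this case $G^{bc}:=(G_{sqf})^{bc}$ and $G^{c}:=(G_{sqf})^{c}$, where for a simple graph $H$: $H^{c}$ is the complement graph on the same vertices (two distinct vertices are adjacent in $H^c$ iff they are not adjacent in $H$); and, for $H$ connected bipartite with bipartition $X\sqcup Y$, $H^{bc}$ is the bipartite graph on $X\sqcup Y$ with edges $\{x,y\}$, $x\in X$, $y\in Y$, $\{x,y\}\notin E(H)$.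 Two edges $e_1,e_2\in E(G)$ (possibly loops) are totally disjoint if $\{u,v\}\notin E(G)$ whenever $u\in e_1$ and $v\in e_2$. $C_l$ denotes the cycle of length $l$ (connected graph on $l\geq 4$ vertices all of degree two), $H'<H$ means that $H'$ is isomorphic to an induced subgraph of $H$, and an induced cycle of a graph is an induced subgraph that is a cycle. *)

theory Defs
  imports Complex_Main "HOL-Library.Poly_Mapping"
begin

section \<open>Monomial ideals\<close>

text \<open>
  The polynomial ring over the field \<open>'k\<close> has one variable for each element of the finite
  type \<open>'v\<close>, so \<open>n\<close> is the cardinality of \<open>'v\<close>.
\<close>

type_synonym 'v mon = "'v \<Rightarrow>\<^sub>0 nat"
type_synonym ('v, 'k) mpol = "'v mon \<Rightarrow>\<^sub>0 'k"

definition mon :: "'v mon \<Rightarrow> ('v, 'k::comm_ring_1) mpol" where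
  "mon m = Poly_Mapping.single m 1"

definition Var :: "'v \<Rightarrow> ('v, 'k::comm_ring_1) mpol" where
  "Var v = mon (Poly_Mapping.single v 1)"

definition tdeg :: "('v::finite) mon \<Rightarrow> nat" where
  "tdeg m = (\<Sum>v\<in>UNIV. Poly_Mapping.lookup m v)"

lemma module_times: "module ((*) :: 'a::comm_ring_1 \<Rightarrow> 'a \<Rightarrow> 'a)"
  by unfold_locales (simp_all add: algebra_simps)

text \<open>Ideals of a commutative ring are its submodules over itself.\<close>

definition ideal_generated :: "'a::comm_ring_1 set \<Rightarrow> 'a set" where
  "ideal_generated S = module.span (*) S"

definition monomial_ideal_generated_in_degree ::
    "nat \<Rightarrow> ('v::finite, 'k::field) mpol set \<Rightarrow> bool" where
  "monomial_ideal_generated_in_degree d I \<longleftrightarrow>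
     (\<exists>M. (\<forall>m\<in>M. tdeg m = d) \<and> I = ideal_generated (mon ` M))"

definition squarefree_monomial_ideal :: "('v::finite, 'k::field) mpol set \<Rightarrow> bool" where
  "squarefree_monomial_ideal I \<longleftrightarrow>
     (\<exists>M. (\<forall>m\<in>M. \<forall>v. Poly_Mapping.lookup m v \<le> 1) \<and> I = ideal_generated (mon ` M))"


section \<open>Minimal graded free resolutions\<close>

text \<open>
  Degrees are integers; a polynomial that is homogeneous of negative degree is zero.
\<close>

definition homogeneous :: "int \<Rightarrow> ('v::finite, 'k::field) mpol \<Rightarrow> bool" where
  "homogeneous d p \<longleftrightarrow> (\<forall>m\<in>Poly_Mapping.keys p. int (tdeg m) = d)"

definition irrelevant_ideal :: "('v::finite, 'k::field) mpol set" where
  "irrelevant_ideal = ideal_generated (range Var)"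

definition free_module :: "nat \<Rightarrow> (nat \<Rightarrow> 'a::comm_ring_1) set" where
  "free_module r = {f. \<forall>k\<ge>r. f k = 0}"

definition mat_map ::
    "nat \<Rightarrow> nat \<Rightarrow> (nat \<Rightarrow> nat \<Rightarrow> 'a::comm_ring_1) \<Rightarrow> (nat \<Rightarrow> 'a) \<Rightarrow> nat \<Rightarrow> 'a" where
  "mat_map r s A f = (\<lambda>k. if k < r then \<Sum>l<s. A k l * f l else 0)"

text \<open>
  A complex of graded free modules \<open>\<dots> \<rightarrow> F\<^sub>2 \<rightarrow> F\<^sub>1 \<rightarrow> F\<^sub>0\<close> augmented to \<open>R\<close>, in coordinates.
  The module \<open>F\<^sub>i\<close> is the direct sum of the modules \<open>R(- shift F i l)\<close> over \<open>l < rk F i\<close>,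
  that is, its \<open>l\<close>-th basis vector has degree \<open>shift F i l\<close>. The matrix of the map
  \<open>F\<^sub>i\<^sub>+\<^sub>1 \<rightarrow> F\<^sub>i\<close> is \<open>dmat F i\<close> (row, then column), and \<open>aug F l\<close> is the image in \<open>R\<close> of the
  \<open>l\<close>-th basis vector of \<open>F\<^sub>0\<close>.
\<close>

record 'r graded_free_complex =
  rk :: "nat \<Rightarrow> nat"
  shift :: "nat \<Rightarrow> nat \<Rightarrow> int"
  aug :: "nat \<Rightarrow> 'r"
  dmat :: "nat \<Rightarrow> nat \<Rightarrow> nat \<Rightarrow> 'r"

definition aug_map ::
    "('v::finite, 'k::field) mpol graded_free_complex \<Rightarrow> (nat \<Rightarrow> ('v, 'k) mpol) \<Rightarrow> ('v, 'k) mpol" where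
  "aug_map F f = (\<Sum>l<rk F 0. aug F l * f l)"

definition diff_map ::
    "('v::finite, 'k::field) mpol graded_free_complex \<Rightarrow> nat \<Rightarrow>
     (nat \<Rightarrow> ('v, 'k) mpol) \<Rightarrow> nat \<Rightarrow> ('v, 'k) mpol" where
  "diff_map F i = mat_map (rk F i) (rk F (Suc i)) (dmat F i)"

definition graded_free_resolution ::
    "('v::finite, 'k::field) mpol set \<Rightarrow> ('v, 'k) mpol graded_free_complex \<Rightarrow> bool" where
  "graded_free_resolution I F \<longleftrightarrow>
     (\<forall>l<rk F 0. homogeneous (shift F 0 l) (aug F l)) \<and>
     (\<forall>i. \<forall>k<rk F i. \<forall>l<rk F (Suc i).
        homogeneous (shift F (Suc i) l - shift F i k) (dmat F i k l)) \<and>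
     aug_map F ` free_module (rk F 0) = I \<and>
     {f \<in> free_module (rk F 0). aug_map F f = 0} = diff_map F 0 ` free_module (rk F 1) \<and>
     (\<forall>i. {f \<in> free_module (rk F (Suc i)). diff_map F i f = (\<lambda>_. 0)} =
        diff_map F (Suc i) ` free_module (rk F (Suc (Suc i))))"

definition minimal_graded_free_resolution ::
    "('v::finite, 'k::field) mpol set \<Rightarrow> ('v, 'k) mpol graded_free_complex \<Rightarrow> bool" where
  "minimal_graded_free_resolution I F \<longleftrightarrow>
     graded_free_resolution I F \<and>
     (\<forall>i. \<forall>k<rk F i. \<forall>l<rk F (Suc i). dmat F i k l \<in> irrelevant_ideal)"

text \<open>
  Minimal graded free resolutions of a homogeneous ideal exist and are unique up to isomorphism,
  so the choice below does not affect the graded Betti numbers. Only finitely many of them are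
  nonzero, and \<open>Max\<close> is an honest maximum for \<open>I \<noteq> 0\<close>.
\<close>

definition graded_betti :: "('v::finite, 'k::field) mpol set \<Rightarrow> nat \<Rightarrow> int \<Rightarrow> nat" where
  "graded_betti I i j =
     (let F = (SOME F. minimal_graded_free_resolution I F)
      in card {l. l < rk F i \<and> shift F i l = j})"

definition regularity :: "('v::finite, 'k::field) mpol set \<Rightarrow> int" where
  "regularity I = Max {j - int i | i j. graded_betti I i j \<noteq> 0}"


section \<open>Graphs\<close>

text \<open>
  An edge is the set of its endpoints, so that a loop is a singleton.
\<close>

type_synonym 'v graph = "'v set \<times> 'v set set"

abbreviation verts :: "'v graph \<Rightarrow> 'v set" where "verts \<equiv> fst"
abbreviation edges :: "'v graph \<Rightarrow> 'v set set" where "edges \<equiv> snd"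

definition simple_graph :: "'v graph \<Rightarrow> bool" where
  "simple_graph G \<longleftrightarrow> (\<forall>e\<in>edges G. e \<subseteq> verts G \<and> card e = 2)"

definition connected_graph :: "'v graph \<Rightarrow> bool" where
  "connected_graph G \<longleftrightarrow>
     (\<forall>u\<in>verts G. \<forall>v\<in>verts G. (u, v) \<in> {(a, b). {a, b} \<in> edges G}\<^sup>*)"

definition bipartition :: "'v graph \<Rightarrow> 'v set \<Rightarrow> 'v set \<Rightarrow> bool" where
  "bipartition G X Y \<longleftrightarrow>
     X \<union> Y = verts G \<and> X \<inter> Y = {} \<and> (\<forall>e\<in>edges G. \<exists>x\<in>X. \<exists>y\<in>Y. e = {x, y})"

definition complement_graph :: "'v graph \<Rightarrow> 'v graph" where
  "complement_graph G =
     (verts G, {{u, v} | u v. u \<in> verts G \<and> v \<in> verts G \<and> u \<noteq> v \<and> {u, v} \<notin> edges G})"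

text \<open>
  For a connected bipartite graph the bipartition is unique up to exchanging the two parts, which
  does not affect the following graph.
\<close>

definition bipartite_complement :: "'v graph \<Rightarrow> 'v graph" where
  "bipartite_complement G =
     (let (X, Y) = (SOME (X, Y). bipartition G X Y)
      in (verts G, {{x, y} | x y. x \<in> X \<and> y \<in> Y \<and> {x, y} \<notin> edges G}))"

definition induced :: "'v graph \<Rightarrow> 'v set \<Rightarrow> 'v graph" where
  "induced G W = (W, {e \<in> edges G. e \<subseteq> W})"

definition is_cycle :: "nat \<Rightarrow> 'v graph \<Rightarrow> bool" where
  "is_cycle l C \<longleftrightarrow>
     l \<ge> 4 \<and> card (verts C) = l \<and> simple_graph C \<and> connected_graph C \<and>
     (\<forall>u\<in>verts C. card {v \<in> verts C. {u, v} \<in> edges C} = 2)"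

text \<open>
  Since \<open>C\<^sub>l\<close> is determined up to isomorphism by \<open>is_cycle l\<close>, the following is \<open>C\<^sub>l < G\<close>.
\<close>

definition has_induced_cycle :: "'v graph \<Rightarrow> nat \<Rightarrow> bool" where
  "has_induced_cycle G l \<longleftrightarrow> (\<exists>W \<subseteq> verts G. is_cycle l (induced G W))"

definition totally_disjoint :: "'v graph \<Rightarrow> 'v set \<Rightarrow> 'v set \<Rightarrow> bool" where
  "totally_disjoint G e f \<longleftrightarrow> (\<forall>u\<in>e. \<forall>v\<in>f. {u, v} \<notin> edges G)"


section \<open>The graph of an ideal generated in degree two\<close>

definition graph_of :: "('v::finite, 'k::field) mpol set \<Rightarrow> 'v graph" where
  "graph_of I = (UNIV, {{u, v} | u v. Var u * Var v \<in> I})"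

definition sqf :: "'v graph \<Rightarrow> 'v graph" where
  "sqf G = (verts G, {e \<in> edges G. \<not> (\<exists>v. e = {v})})"

definition bipartite :: "'v graph \<Rightarrow> bool" where
  "bipartite G \<longleftrightarrow> connected_graph (sqf G) \<and> (\<exists>X Y. bipartition (sqf G) X Y)"

end

theory Submission
  imports Defs "HOL-Library.Function_Algebras" "HOL-Library.FuncSet"
begin

text \<open>
  The graded Betti numbers of \<open>I\<close> are dimensions of Koszul homology groups of \<open>I\<close>: the Koszul
  complex of a free module is exact in positive degrees, so every step \<open>0 \<rightarrow> Z\<^sub>i\<^sub>+\<^sub>1 \<rightarrow> F\<^sub>i \<rightarrow> Z\<^sub>i \<rightarrow> 0\<close> of a
  minimal resolution shifts Koszul homology by one degree (\<open>exact_cover\<close>), down to degree \<open>0\<close>,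
  where it counts minimal generators (\<open>exact_cover_zero\<close>). For a monomial ideal the Koszul complex
  splits over the multidegrees \<open>m\<close> into the chain complexes of the simplicial complexes
  \<open>K\<^sup>m = {T. x\<^sup>m\<^sup>-\<^sup>T \<in> I}\<close> (\<open>exact_monomial_part\<close>). Grading chains by the cardinality of the face, the
  result is that \<open>\<beta>\<^sub>p\<^sub>,\<^sub>j(I) \<noteq> 0\<close> iff some \<open>K\<^sup>m\<close> with \<open>|m| = j\<close> has homology in degree \<open>p\<close>
  (\<open>betti_edge_ideal\<close>), and the regularity is the maximum of \<open>|m| - p\<close> over these pairs. Since the
  Betti numbers are defined through a choice of a resolution, this needs that minimal resolutions
  exist. The same dimension shift gives it: Koszul homology of \<open>I\<close> vanishes in large degrees, hence so
  does that of every syzygy module, which is therefore finitely generated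
  (\<open>minimal_resolution_exists\<close>).

  Upper bounds come from the exact sequence of deletion and link at a vertex \<open>v\<close> of \<open>K\<^sup>m\<close>. It reads
  \<open>reg I \<le> max (reg I') (reg (I : x\<^sub>v) + 1)\<close>, where \<open>I'\<close> is the ideal of \<open>G - v\<close>; and \<open>I : x\<^sub>v\<close> is
  generated by the neighbours of \<open>v\<close>, which do not affect the bound, and the edges that avoid them. An
  exponent \<open>m\<^sub>v \<ge> 2\<close> contributes only if it is \<open>2\<close> and \<open>v\<close> carries a loop, and then only through \<open>I : x\<^sub>v\<close>.
  If no two edges are totally disjoint, a vertex with a largest neighbourhood among those of its side
  lies on or is adjacent to every edge between distinct vertices, so that \<open>reg I \<le> 2\<close>
  (\<open>reg_bound_two\<close>). For \<open>reg I \<le> 3\<close> one needs a vertex \<open>x\<close> such that no two edges outside the closed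
  neighbourhood of \<open>x\<close> are totally disjoint. In terms of the bipartite complement this says that the
  neighbourhoods of the neighbours of \<open>x\<close> form a chain, i.e. that \<open>x\<close> is a simple vertex, and a bipartite
  graph without induced cycles of length at least \<open>6\<close> has a simple vertex (\<open>simple_vertex_exists\<close>).
  The length \<open>6\<close> is exactly the case of three totally disjoint edges, because the bipartite complement
  of a hexagon consists of three disjoint edges. A vertex with a loop is
  such an \<open>x\<close> as soon as no three edges are pairwise totally disjoint.

  Lower bounds are explicit classes. Two (three) totally disjoint edges give a \<open>K\<^sup>m\<close> that is a
  disjoint union of two simplices (a thickened boundary of a triangle), with \<open>|m| - p = 3\<close>
  (respectively \<open>4\<close>). An induced cycle of length at least \<open>8\<close> in the bipartite complement gives
  \<open>|m| - p = 4\<close> (\<open>induced_cycle_not_acyclic\<close>). Finally, the complement of a bipartite graph consists of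
  two cliques and edges between them, so it has no induced cycle of length at least \<open>5\<close>
  (\<open>complement_no_long_induced_cycle\<close>), and the first condition amounts to a pair of totally disjoint
  edges.
\<close>

abbreviation lookup :: "('a \<Rightarrow>\<^sub>0 'b::zero) \<Rightarrow> 'a \<Rightarrow> 'b" where "lookup \<equiv> Poly_Mapping.lookup"
abbreviation keys :: "('a \<Rightarrow>\<^sub>0 'b::zero) \<Rightarrow> 'a set" where "keys \<equiv> Poly_Mapping.keys"
abbreviation single :: "'a \<Rightarrow> 'b \<Rightarrow> 'a \<Rightarrow>\<^sub>0 'b::zero" where "single \<equiv> Poly_Mapping.single"

section \<open>Koszul complexes\<close>

text \<open>
  An enumeration of the variables fixes the signs of the Koszul differential. It stays a parameter
  because the lower bounds below are easiest for an order adapted to the graph.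
\<close>

locale vertex_order =
  fixes ord :: "'v::finite \<Rightarrow> nat"
  assumes inj_ord: "inj ord"
begin

definition signed :: "'v \<Rightarrow> 'v set \<Rightarrow> 'b::ab_group_add \<Rightarrow> 'b" where
  "signed v T b = (if even (card {u\<in>T. ord u < ord v}) then b else - b)"

text \<open>
  The Koszul differential in coordinates: the coefficient at \<open>T\<close> collects the terms that arise by
  removing \<open>v\<close> from \<open>T \<union> {v}\<close>. Keeping the operators \<open>X v\<close> abstract
  covers the Koszul complex of a module (multiplication by \<open>x\<^sub>v\<close>) and the simplicial chain
  complex (all \<open>X v\<close> the identity) at once.
\<close>

definition kdiff :: "('v \<Rightarrow> 'b \<Rightarrow> 'b::ab_group_add) \<Rightarrow> ('v set \<Rightarrow> 'b) \<Rightarrow> 'v set \<Rightarrow> 'b" where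
  "kdiff X c T = (\<Sum>v\<in>-T. signed v T (X v (c (insert v T))))"

text \<open>
  The set \<open>C T\<close> contains the coefficients that are admitted at \<open>T\<close>: elements of a submodule of the right
  degree, or everything or nothing according to whether \<open>T\<close> is a face. The degree of a chain is the
  cardinality of its faces, so that the empty face sits in degree \<open>0\<close>.
\<close>

definition chains :: "('v set \<Rightarrow> 'b::zero set) \<Rightarrow> nat \<Rightarrow> ('v set \<Rightarrow> 'b) set" where
  "chains C p = {c. \<forall>T. c T \<in> C T \<and> (card T \<noteq> p \<longrightarrow> c T = 0)}"

definition exact_at ::
    "('v \<Rightarrow> 'b::ab_group_add \<Rightarrow> 'b) \<Rightarrow> ('v set \<Rightarrow> 'b set) \<Rightarrow> nat \<Rightarrow> bool" where
  "exact_at X C p \<longleftrightarrow> (\<forall>c\<in>chains C p. (\<forall>T. kdiff X c T = 0) \<longrightarrow>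
     (\<exists>b\<in>chains C (Suc p). \<forall>T. kdiff X b T = c T))"

lemma chainsI:
  assumes "\<And>T. card T = p \<Longrightarrow> c T \<in> C T" "\<And>T. card T \<noteq> p \<Longrightarrow> c T = 0" "\<And>T. 0 \<in> C T"
  shows "c \<in> chains C p"
  using assms by (force simp: chains_def)

lemma chains_mem: "c \<in> chains C p \<Longrightarrow> c T \<in> C T"
  and chains_card: "c \<in> chains C p \<Longrightarrow> card T \<noteq> p \<Longrightarrow> c T = 0"
  by (auto simp: chains_def)

lemma exact_atD:
  assumes "exact_at X C p" "c \<in> chains C p" "\<And>T. kdiff X c T = 0"
  obtains b where "b \<in> chains C (Suc p)" "\<And>T. kdiff X b T = c T"
  using assms unfolding exact_at_def by blast

lemma signed_zero [simp]: "signed v T 0 = 0"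
  and signed_minus: "signed v T (- b) = - signed v T b"
  and signed_add: "signed v T (a + b) = signed v T a + signed v T b"
  and signed_diff: "signed v T (a - b) = signed v T a - signed v T b"
  and signed_signed [simp]: "signed v T (signed v T b) = b"
  by (auto simp: signed_def)

lemma signed_sum: "signed v T (sum g A) = (\<Sum>x\<in>A. signed v T (g x))"
  by (auto simp: signed_def sum_negf)

lemma signed_commute: "signed v T (signed w S b) = signed w S (signed v T b)"
  by (auto simp: signed_def)

lemma signed_additive: "additive f \<Longrightarrow> f (signed v T b) = signed v T (f b)"
  by (auto simp: signed_def additive.minus)

lemma signed_insert:
  assumes "v \<noteq> w" "v \<notin> T"
  shows "signed w (insert v T) b = (if ord v < ord w then - signed w T b else signed w T b)"
proof -
  have "{u\<in>insert v T. ord u < ord w} =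
      (if ord v < ord w then insert v {u\<in>T. ord u < ord w} else {u\<in>T. ord u < ord w})"
    by auto
  with assms show ?thesis by (auto simp: signed_def)
qed

text \<open>
  The two ways to remove two elements of a face carry opposite signs. This is the sign rule behind
  \<open>\<partial>\<partial> = 0\<close>, the cone and the sequence of deletion and link.
\<close>

lemma signed_swap:
  assumes "v \<noteq> w" "v \<notin> T" "w \<notin> T"
  shows "signed v T (signed w (insert v T) b) = - signed w T (signed v (insert w T) b)"
proof -
  have "ord v \<noteq> ord w" using assms(1) inj_ord by (auto dest: injD)
  then show ?thesis
    using assms by (auto simp: signed_insert signed_minus signed_commute[of v T w T])
qed

lemma kdiff_add: "(\<And>v. additive (X v)) \<Longrightarrow> kdiff X (\<lambda>T. a T + b T) T = kdiff X a T + kdiff X b T"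
  by (simp add: kdiff_def additive.add signed_add sum.distrib)

lemma kdiff_diff: "(\<And>v. additive (X v)) \<Longrightarrow> kdiff X (\<lambda>T. a T - b T) T = kdiff X a T - kdiff X b T"
  by (simp add: kdiff_def additive.diff signed_diff sum_subtractf)

lemma kdiff_hom:
  assumes "additive f" "\<And>v b. f (X v b) = Y v (f b)"
  shows "f (kdiff X c T) = kdiff Y (\<lambda>T. f (c T)) T"
  by (simp add: kdiff_def additive.sum[OF assms(1)] signed_additive[OF assms(1)] assms(2))

lemma kdiff_kdiff:
  assumes add: "\<And>v. additive (X v)" and comm: "\<And>v w b. X v (X w b) = X w (X v b)"
  shows "kdiff X (kdiff X c) T = 0"
proof -
  define h where "h v w = signed v T (signed w (insert v T) (X v (X w (c (insert w (insert v T))))))"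
    for v w
  have h_anti: "h v w = - h w v" if "v \<noteq> w" "v \<notin> T" "w \<notin> T" for v w
    unfolding h_def by (subst signed_swap[OF that]) (simp add: comm insert_commute)
  (* The pairs with v before w cancel against the reversed pairs. Splitting the sum, instead of showing
     that it equals its negative, keeps the argument valid in characteristic two. *)
  define P where "P = {(v, w). v \<notin> T \<and> w \<notin> T \<and> v \<noteq> w}"
  define Q where "Q = {(v, w). v \<notin> T \<and> w \<notin> T \<and> ord v < ord w}"
  define Q' where "Q' = {(v, w). v \<notin> T \<and> w \<notin> T \<and> ord w < ord v}"
  have "kdiff X (kdiff X c) T = (\<Sum>v\<in>-T. \<Sum>w\<in>-(insert v T). h v w)"
    by (simp add: kdiff_def h_def signed_sum signed_additive[OF add] additive.sum[OF add])
  also have "\<dots> = (\<Sum>(v, w)\<in>P. h v w)"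
    by (subst sum.Sigma) (auto simp: P_def intro!: sum.cong)
  also have "\<dots> = (\<Sum>(v, w)\<in>Q. h v w) + (\<Sum>(v, w)\<in>Q'. h v w)"
  proof (subst sum.union_disjoint[symmetric])
    have "ord v \<noteq> ord w" if "v \<noteq> w" for v w using that inj_ord by (auto dest: injD)
    then have "P = Q \<union> Q'" by (force simp: P_def Q_def Q'_def)
    then show "(\<Sum>(v, w)\<in>P. h v w) = (\<Sum>(v, w)\<in>Q \<union> Q'. h v w)" by simp
  qed (auto simp: Q_def Q'_def)
  also have "(\<Sum>(v, w)\<in>Q'. h v w) = (\<Sum>(v, w)\<in>Q. h w v)"
    by (rule sum.reindex_bij_witness[of _ prod.swap prod.swap]) (auto simp: Q_def Q'_def)
  also have "\<dots> = (\<Sum>(v, w)\<in>Q. - h v w)"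
  proof (rule sum.cong[OF refl], clarify)
    fix v w assume "(v, w) \<in> Q"
    then show "h w v = - h v w" using h_anti[of w v] by (auto simp: Q_def)
  qed
  finally show ?thesis by (simp add: sum_negf case_prod_beta')
qed

lemma kdiff_eq_0:
  assumes "\<And>v. X v 0 = 0" "c \<in> chains C p" "card T + 1 \<noteq> p"
  shows "kdiff X c T = 0"
proof -
  have "c (insert v T) = 0" if "v \<in> - T" for v
    using that assms(2,3) by (intro chains_card[OF assms(2)]) auto
  then show ?thesis by (simp add: kdiff_def assms(1))
qed

end

text \<open>
  An exact sequence \<open>0 \<rightarrow> K \<rightarrow> F \<rightarrow> Z \<rightarrow> 0\<close> of coefficient systems. When the complex of \<open>F\<close> is exact, the long
  exact sequence becomes a dimension shift between \<open>Z\<close> and \<open>K\<close>; the following two lemmas are its two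
  directions.
\<close>

locale koszul_sequence = vertex_order ord for ord :: "'v::finite \<Rightarrow> nat" +
  fixes X :: "'v \<Rightarrow> 'b::ab_group_add \<Rightarrow> 'b" and Y :: "'v \<Rightarrow> 'c::ab_group_add \<Rightarrow> 'c"
    and f :: "'b \<Rightarrow> 'c"
    and K F :: "'v set \<Rightarrow> 'b set" and Z :: "'v set \<Rightarrow> 'c set"
  assumes addX: "additive (X v)" and commX: "X v (X w b) = X w (X v b)"
    and addf: "additive f" and f_X: "f (X v b) = Y v (f b)"
    and K_eq: "K T = {b \<in> F T. f b = 0}" and f_surj: "f ` F T = Z T"
    and F_0: "0 \<in> F T" and F_diff: "a \<in> F T \<Longrightarrow> b \<in> F T \<Longrightarrow> a - b \<in> F T"
    and F_X: "v \<notin> T \<Longrightarrow> b \<in> F (insert v T) \<Longrightarrow> X v b \<in> F T"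
begin

lemma f_0: "f 0 = 0" by (rule additive.zero[OF addf])

lemma Z_0: "0 \<in> Z T" using f_surj[of T] F_0[of T] f_0 by force

lemma F_kdiff: "(\<And>T. c T \<in> F T) \<Longrightarrow> kdiff X c T \<in> F T"
proof -
  assume c: "\<And>T. c T \<in> F T"
  have neg: "- a \<in> F T" if "a \<in> F T" for a using F_diff[OF F_0 that] by simp
  have plus: "a + b \<in> F T" if "a \<in> F T" "b \<in> F T" for a b
    using F_diff[OF that(1) neg[OF that(2)]] by simp
  have "sum g A \<in> F T" if "\<And>v. v \<in> A \<Longrightarrow> g v \<in> F T" for A :: "'v set" and g
    using finite[of A] that by (induction A rule: finite_induct) (auto intro: plus F_0)
  then show ?thesis
    unfolding kdiff_def using F_X c neg by (force simp: signed_def)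
qed

lemma chains_kdiff:
  assumes "c \<in> chains F (Suc p)" shows "kdiff X c \<in> chains F p"
proof (rule chainsI)
  fix T :: "'v set" assume "card T \<noteq> p"
  then show "kdiff X c T = 0"
    by (intro kdiff_eq_0[OF _ assms]) (auto simp: additive.zero[OF addX])
qed (use F_kdiff chains_mem[OF assms] F_0 in auto)

lemma lift_chain:
  assumes "c \<in> chains Z p"
  obtains b where "b \<in> chains F p" "\<And>T. f (b T) = c T"
proof -
  have "\<exists>b. b \<in> F T \<and> f b = c T \<and> (card T \<noteq> p \<longrightarrow> b = 0)" for T
  proof (cases "card T = p")
    case True
    then show ?thesis using f_surj[of T] chains_mem[OF assms, of T] by (metis imageE)
  next
    case False
    then show ?thesis using F_0 f_0 chains_card[OF assms] by auto
  qed
  then obtain b where "\<And>T. b T \<in> F T \<and> f (b T) = c T \<and> (card T \<noteq> p \<longrightarrow> b T = 0)" by metis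
  then show ?thesis by (intro that[of b]) (auto simp: chains_def)
qed

lemma chains_image: "b \<in> chains F p \<Longrightarrow> (\<lambda>T. f (b T)) \<in> chains Z p"
  using f_surj f_0 by (auto simp: chains_def)

lemma chains_sub: "a \<in> chains F p \<Longrightarrow> b \<in> chains F p \<Longrightarrow> (\<lambda>T. a T - b T) \<in> chains F p"
  by (auto simp: chains_def F_diff)

lemma chains_K: "c \<in> chains K p \<longleftrightarrow> c \<in> chains F p \<and> (\<forall>T. f (c T) = 0)"
  by (auto simp: chains_def K_eq)

lemma f_kdiff: "f (kdiff X b T) = kdiff Y (\<lambda>T. f (b T)) T"
  by (rule kdiff_hom[where f = f and X = X and Y = Y]) (rule addf, rule f_X)

lemma exact_image:
  assumes F: "exact_at X F (Suc p)" and K: "exact_at X K p"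
  shows "exact_at Y Z (Suc p)"
  unfolding exact_at_def
proof (intro ballI impI)
  fix c assume c: "c \<in> chains Z (Suc p)" and cyc: "\<forall>T. kdiff Y c T = 0"
  obtain a where a: "a \<in> chains F (Suc p)" "\<And>T. f (a T) = c T" using lift_chain[OF c] by blast
  have "kdiff X a \<in> chains K p"
    using chains_kdiff[OF a(1)] cyc by (simp add: chains_K f_kdiff a(2))
  then obtain b where b: "b \<in> chains K (Suc p)" "\<And>T. kdiff X b T = kdiff X a T"
    by (rule exact_atD[OF K]) (auto intro: kdiff_kdiff addX commX)
  have "(\<lambda>T. a T - b T) \<in> chains F (Suc p)" using a(1) b(1) by (simp add: chains_K chains_sub)
  moreover have "kdiff X (\<lambda>T. a T - b T) T = 0" for T by (simp add: kdiff_diff[OF addX] b(2))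
  ultimately obtain g where g: "g \<in> chains F (Suc (Suc p))" "\<And>T. kdiff X g T = a T - b T"
    by (rule exact_atD[OF F]) auto
  have "kdiff Y (\<lambda>T. f (g T)) T = c T" for T
    using b(1) by (simp add: f_kdiff[symmetric] g(2) additive.diff[OF addf] a(2) chains_K)
  then show "\<exists>b\<in>chains Z (Suc (Suc p)). \<forall>T. kdiff Y b T = c T"
    using chains_image[OF g(1)] by (intro bexI[of _ "\<lambda>T. f (g T)"]) auto
qed

text \<open>
  The assumption on \<open>F\<close> is weaker than exactness of its complex in degree \<open>p\<close>: only cycles in \<open>K\<close> have to
  bound. For \<open>p = 0\<close> this is what minimality of a resolution provides, while the complex of a free
  module is not exact there.
\<close>

lemma exact_kernel:
  assumes F: "\<And>c. c \<in> chains K p \<Longrightarrow> (\<And>T. kdiff X c T = 0) \<Longrightarrow>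
      \<exists>b\<in>chains F (Suc p). \<forall>T. kdiff X b T = c T"
    and Z: "exact_at Y Z (Suc p)"
  shows "exact_at X K p"
  unfolding exact_at_def
proof (intro ballI impI)
  fix c assume c: "c \<in> chains K p" and cyc: "\<forall>T. kdiff X c T = 0"
  then obtain b where b: "b \<in> chains F (Suc p)" "\<And>T. kdiff X b T = c T" using F by blast
  have "kdiff Y (\<lambda>T. f (b T)) T = 0" for T
    using c by (simp add: f_kdiff[symmetric] b(2) chains_K)
  then obtain a where a: "a \<in> chains Z (Suc (Suc p))" "\<And>T. kdiff Y a T = f (b T)"
    using exact_atD[OF Z chains_image[OF b(1)]] by auto
  obtain g where g: "g \<in> chains F (Suc (Suc p))" "\<And>T. f (g T) = a T" using lift_chain[OF a(1)] by blast
  have "(\<lambda>T. b T - kdiff X g T) \<in> chains K (Suc p)"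
    using chains_sub[OF b(1) chains_kdiff[OF g(1)]]
    by (simp add: chains_K additive.diff[OF addf] f_kdiff g(2) a(2))
  moreover have "kdiff X (\<lambda>T. b T - kdiff X g T) T = c T" for T
    by (simp add: kdiff_diff[OF addX] kdiff_kdiff[OF addX commX] b(2))
  ultimately show "\<exists>b\<in>chains K (Suc p). \<forall>T. kdiff X b T = c T" by metis
qed

end

section \<open>Multidegrees\<close>

definition monomial_of :: "('v::finite \<Rightarrow> nat) \<Rightarrow> 'v mon" where
  "monomial_of m = Abs_poly_mapping m"

definition lower :: "('v \<Rightarrow> nat) \<Rightarrow> 'v set \<Rightarrow> 'v \<Rightarrow> nat" where
  "lower m T = (\<lambda>v. m v - of_bool (v \<in> T))"

definition raise :: "('v \<Rightarrow> nat) \<Rightarrow> 'v set \<Rightarrow> 'v \<Rightarrow> nat" where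
  "raise m T = (\<lambda>v. m v + of_bool (v \<in> T))"

definition supp :: "('v \<Rightarrow> nat) \<Rightarrow> 'v set" where
  "supp m = {v. m v \<noteq> 0}"

text \<open>
  Exponent vectors are plain functions, and a monomial ideal is given by the predicate \<open>A\<close> on
  exponents. The upper Koszul complex of \<open>A\<close> in degree \<open>m\<close> consists of the squarefree \<open>T\<close>
  with \<open>x\<^sup>m / x\<^sup>T\<close> in the ideal.
\<close>

definition upper_koszul :: "(('v \<Rightarrow> nat) \<Rightarrow> bool) \<Rightarrow> ('v \<Rightarrow> nat) \<Rightarrow> 'v set set" where
  "upper_koszul A m = {T. T \<subseteq> supp m \<and> A (lower m T)}"

lemma lookup_monomial_of [simp]: "lookup (monomial_of m) = m"
  by (simp add: monomial_of_def)

lemma monomial_of_lookup [simp]: "monomial_of (lookup n) = n"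
  by (simp add: poly_mapping_eq_iff)

lemma tdeg_monomial_of: "tdeg (monomial_of m) = sum m UNIV"
  by (simp add: tdeg_def)

lemma lower_raise [simp]: "lower (raise m T) T = m"
  by (simp add: lower_def raise_def)

lemma raise_lower: "T \<subseteq> supp m \<Longrightarrow> raise (lower m T) T = m"
  by (force simp: lower_def raise_def supp_def fun_eq_iff)

lemma supp_raise: "T \<subseteq> supp (raise m T)"
  by (auto simp: supp_def raise_def)

lemma sum_raise: "sum (raise m T) UNIV = sum m UNIV + card (T :: 'v::finite set)"
  by (simp add: raise_def sum.distrib flip: sum.inter_filter)

lemma sum_lower: "T \<subseteq> supp m \<Longrightarrow> sum (lower m T) UNIV + card (T :: 'v::finite set) = sum m UNIV"
  by (metis raise_lower sum_raise)

lemma finite_bounded_degree: "finite {n :: 'v::finite \<Rightarrow> nat. sum n UNIV \<le> d}"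
proof (rule finite_subset)
  show "{n :: 'v \<Rightarrow> nat. sum n UNIV \<le> d} \<subseteq> (\<Pi>\<^sub>E v\<in>UNIV. {..d})"
  proof
    fix n :: "'v \<Rightarrow> nat" assume "n \<in> {n. sum n UNIV \<le> d}"
    moreover have "n v \<le> sum n UNIV" for v by (rule member_le_sum) auto
    ultimately have "n v \<le> d" for v using order_trans by blast
    then show "n \<in> (\<Pi>\<^sub>E v\<in>UNIV. {..d})" by (simp add: PiE_iff)
  qed
qed (auto intro: finite_PiE)

lemma lookup_Var_times:
  fixes f :: "('v::finite, 'k::field) mpol"
  shows "lookup (Var v * f) (monomial_of m) =
    (if m v = 0 then 0 else lookup f (monomial_of (lower m {v})))"
proof -
  let ?e = "single v (1::nat)"
  have "lookup (Var v * f) (monomial_of m) =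
      (\<Sum>q. lookup f q when monomial_of m = ?e + q)"
    by (simp add: Var_def mon_def lookup_mult lookup_single when_mult)
  also have "\<dots> = (if m v = 0 then 0 else lookup f (monomial_of (lower m {v})))"
  proof (cases "m v = 0")
    case True
    then have "monomial_of m \<noteq> ?e + q" for q
      by (auto simp: poly_mapping_eq_iff fun_eq_iff lookup_add intro!: exI[of _ v])
    with True show ?thesis by simp
  next
    case False
    then have "monomial_of m = ?e + q \<longleftrightarrow> q = monomial_of (lower m {v})" for q
      by (auto simp: poly_mapping_eq_iff fun_eq_iff lookup_add lookup_single lower_def when_def)
    with False show ?thesis by simp
  qed
  finally show ?thesis .
qed

text \<open>
  Subtracting \<open>card T\<close> makes \<open>d\<close> the total degree of a Koszul chain with coefficients in
  the monomial ideal: \<open>e\<^sub>T\<close> has degree \<open>card T\<close>.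
\<close>

definition monomial_part ::
    "(('v \<Rightarrow> nat) \<Rightarrow> bool) \<Rightarrow> int \<Rightarrow> 'v set \<Rightarrow> ('v::finite, 'k::field) mpol set" where
  "monomial_part A d T =
     {f. \<forall>n\<in>keys f. A (lookup n) \<and> int (tdeg n) = d - int (card T)}"

context vertex_order
begin

abbreviation boundary :: "('v set \<Rightarrow> 'b::ab_group_add) \<Rightarrow> 'v set \<Rightarrow> 'b" where
  "boundary \<equiv> kdiff (\<lambda>_ x. x)"

text \<open>
  The type argument names the field of coefficients, on which the vanishing of homology may depend.
\<close>

definition acyclic_at :: "'k::field itself \<Rightarrow> 'v set set \<Rightarrow> nat \<Rightarrow> bool" where
  "acyclic_at k K p = exact_at (\<lambda>_ x. x) (\<lambda>T. if T \<in> K then (UNIV :: 'k set) else {0}) p"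

text \<open>
  The component of a Koszul chain in multidegree \<open>m\<close>: since \<open>e\<^sub>T\<close> has multidegree \<open>T\<close>, the coefficient at
  \<open>T\<close> contributes its monomial \<open>m - T\<close>.
\<close>

definition slice :: "('v \<Rightarrow> nat) \<Rightarrow> ('v set \<Rightarrow> ('v, 'k::field) mpol) \<Rightarrow> 'v set \<Rightarrow> 'k" where
  "slice m c T = (if T \<subseteq> supp m then lookup (c T) (monomial_of (lower m T)) else 0)"

lemma lookup_signed:
  "lookup (signed v T f) n = signed v T (lookup f n)"
  by (simp add: signed_def)

text \<open>
  Multiplication by \<open>x\<^sub>v\<close> takes the monomial \<open>m - (T \<union> {v})\<close> to \<open>m - T\<close>, so on components the Koszul
  differential is the simplicial boundary.
\<close>

lemma kdiff_slice:
  fixes c :: "'v set \<Rightarrow> ('v, 'k::field) mpol"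
  shows "boundary (slice m c) T = slice m (kdiff (\<lambda>v f. Var v * f) c) T"
proof (cases "T \<subseteq> supp m")
  case False
  then show ?thesis by (simp add: slice_def kdiff_def)
next
  case True
  have "lookup (Var v * c (insert v T)) (monomial_of (lower m T)) =
      slice m c (insert v T)" if "v \<notin> T" for v
  proof -
    have "lower (lower m T) {v} = lower m (insert v T)"
      using that by (auto simp: lower_def fun_eq_iff)
    moreover have "lower m T v = m v" using that by (simp add: lower_def)
    ultimately show ?thesis using True by (simp add: lookup_Var_times slice_def supp_def)
  qed
  with True show ?thesis
    by (simp add: slice_def[of m "kdiff _ c"] kdiff_def lookup_sum lookup_signed)
qed

lemma lookup_slice: "lookup (c T) n = slice (raise (lookup n) T) c T"
  by (simp add: slice_def supp_raise)

lemma slice_chains: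
  assumes "c \<in> chains (monomial_part A d) p"
  shows "slice m c \<in> chains (\<lambda>T. if T \<in> upper_koszul A m then UNIV else {0}) p"
proof -
  have "A (lower m T)" if "lookup (c T) (monomial_of (lower m T)) \<noteq> 0" for T
    using chains_mem[OF assms, of T] that by (force simp: monomial_part_def in_keys_iff)
  then show ?thesis
    using chains_card[OF assms] by (auto simp: chains_def slice_def upper_koszul_def)
qed

lemma slice_degree:
  assumes "c \<in> chains (monomial_part A d) p" "int (sum m UNIV) \<noteq> d"
  shows "slice m c T = 0"
proof (cases "T \<subseteq> supp m")
  case True
  have "lookup (c T) (monomial_of (lower m T)) = 0"
  proof (rule ccontr)
    assume "lookup (c T) (monomial_of (lower m T)) \<noteq> 0"
    then have "int (sum (lower m T) UNIV) = d - int (card T)"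
      using chains_mem[OF assms(1), of T] by (force simp: monomial_part_def in_keys_iff tdeg_monomial_of)
    then show False using sum_lower[OF True] assms(2) by linarith
  qed
  then show ?thesis by (simp add: slice_def)
qed (simp add: slice_def)

lemma assemble_slices:
  fixes g :: "('v \<Rightarrow> nat) \<Rightarrow> 'v set \<Rightarrow> 'k::field"
  assumes g: "\<And>m. int (sum m UNIV) = d \<Longrightarrow>
    g m \<in> chains (\<lambda>T. if T \<in> upper_koszul A m then UNIV else {0}) p"
  obtains b where "b \<in> chains (monomial_part A d) p"
    "\<And>m T. slice m b T = (if int (sum m UNIV) = d then g m T else 0)"
proof -
  define h where "h T n = (if int (sum (raise (lookup n) T) UNIV) = d
      then g (raise (lookup n) T) T else 0)" for T :: "'v set" and n
  define b where "b T = Abs_poly_mapping (h T)" for T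
  have lookup_b: "lookup (b T) = h T" for T
  proof -
    have "{n. h T n \<noteq> 0} \<subseteq> monomial_of ` {m. sum m UNIV \<le> nat d}"
    proof
      fix n assume "n \<in> {n. h T n \<noteq> 0}"
      then have "int (sum (lookup n) UNIV + card T) = d"
        unfolding mem_Collect_eq h_def sum_raise by metis
      then have "sum (lookup n) UNIV \<le> nat d" by (metis le_add1 nat_int)
      then show "n \<in> monomial_of ` {m. sum m UNIV \<le> nat d}"
        by (metis (mono_tags, lifting) image_eqI mem_Collect_eq monomial_of_lookup)
    qed
    then have "finite {n. h T n \<noteq> 0}" using finite_bounded_degree finite_surj by blast
    then show ?thesis by (simp add: b_def)
  qed
  have supp_g: "T \<in> upper_koszul A m \<and> card T = p" if "int (sum m UNIV) = d" "g m T \<noteq> 0" for m T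
    using chains_mem[OF g[OF that(1)], of T] chains_card[OF g[OF that(1)], of T] that(2)
    by (auto split: if_splits)
  have slice_b: "slice m b T = (if int (sum m UNIV) = d then g m T else 0)" for m T
    using supp_g[of m T] by (auto simp: slice_def lookup_b h_def raise_lower upper_koszul_def)
  have "b \<in> chains (monomial_part A d) p"
  proof (rule chainsI)
    fix T
    have "A (lookup n) \<and> int (tdeg n) = d - int (card T)" if "h T n \<noteq> 0" for n
    proof -
      let ?m = "raise (lookup n) T"
      have m: "int (sum ?m UNIV) = d" "g ?m T \<noteq> 0" using that by (auto simp only: h_def split: if_splits)
      show ?thesis using supp_g[OF m] m(1) by (simp add: upper_koszul_def sum_raise tdeg_def)
    qed
    then show "b T \<in> monomial_part A d T" by (simp add: monomial_part_def in_keys_iff lookup_b)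
  next
    fix T :: "'v set" assume "card T \<noteq> p"
    then have "h T n = 0" for n using supp_g by (auto simp: h_def)
    then show "b T = 0" by (simp add: poly_mapping_eq_iff lookup_b fun_eq_iff)
  qed (simp add: monomial_part_def)
  then show ?thesis using that slice_b by blast
qed

text \<open>
  The Koszul complex in degree \<open>d\<close> is the direct sum of its components over the finitely many
  multidegrees of total degree \<open>d\<close>.
\<close>

theorem exact_monomial_part:
  "exact_at (\<lambda>v f. Var v * f) (monomial_part A d :: 'v set \<Rightarrow> ('v, 'k::field) mpol set) p \<longleftrightarrow>
    (\<forall>m. int (sum m UNIV) = d \<longrightarrow> acyclic_at TYPE('k) (upper_koszul A m) p)"
  (is "?L \<longleftrightarrow> ?R")
proof
  assume R: ?R
  show ?L unfolding exact_at_def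
  proof (intro ballI impI)
    fix c :: "'v set \<Rightarrow> ('v, 'k) mpol"
    assume c: "c \<in> chains (monomial_part A d) p" and cyc: "\<forall>T. kdiff (\<lambda>v f. Var v * f) c T = 0"
    have "\<exists>g\<in>chains (\<lambda>T. if T \<in> upper_koszul A m then UNIV else {0}) (Suc p).
        \<forall>T. boundary g T = slice m c T" if "int (sum m UNIV) = d" for m
    proof (rule exact_atD[OF R[unfolded acyclic_at_def, rule_format, OF that] slice_chains[OF c]])
      show "boundary (slice m c) T = 0" for T
        using cyc by (simp add: kdiff_slice) (simp add: slice_def)
    qed blast
    then obtain g where g: "\<And>m. int (sum m UNIV) = d \<Longrightarrow>
          g m \<in> chains (\<lambda>T. if T \<in> upper_koszul A m then UNIV else {0}) (Suc p)"
        "\<And>m T. int (sum m UNIV) = d \<Longrightarrow> boundary (g m) T = slice m c T"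
      by metis
    obtain b where b: "b \<in> chains (monomial_part A d) (Suc p)"
        "\<And>m T. slice m b T = (if int (sum m UNIV) = d then g m T else 0)"
      using assemble_slices[OF g(1)] by blast
    have "lookup (kdiff (\<lambda>v f. Var v * f) b T) n = lookup (c T) n" for T n
    proof -
      let ?m = "raise (lookup n) T"
      have "slice ?m b = (\<lambda>T. if int (sum ?m UNIV) = d then g ?m T else 0)" using b(2) by auto
      then have "boundary (slice ?m b) T = slice ?m c T"
        using g(2)[of ?m T] slice_degree[OF c, of ?m T]
        by (cases "int (sum ?m UNIV) = d") (auto simp: kdiff_def)
      then show ?thesis by (simp add: kdiff_slice lookup_slice)
    qed
    then show "\<exists>b\<in>chains (monomial_part A d) (Suc p). \<forall>T. kdiff (\<lambda>v f. Var v * f) b T = c T"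
      using b(1) by (intro bexI[of _ b]) (auto intro: poly_mapping_eqI)
  qed
next
  assume L: ?L
  show ?R unfolding acyclic_at_def exact_at_def
  proof (intro allI impI ballI)
    fix m and f :: "'v set \<Rightarrow> 'k"
    assume m: "int (sum m UNIV) = d"
      and f: "f \<in> chains (\<lambda>T. if T \<in> upper_koszul A m then UNIV else {0}) p"
      and cyc: "\<forall>T. boundary f T = 0"
    define g where "g m' T = (if m' = m then f T else 0)" for m' T
    obtain c where c: "c \<in> chains (monomial_part A d) p"
        "\<And>m T. slice m c T = (if int (sum m UNIV) = d then g m T else 0)"
    proof (rule assemble_slices)
      show "g m' \<in> chains (\<lambda>T. if T \<in> upper_koszul A m' then UNIV else {0}) p" for m'
        using f by (cases "m' = m") (auto simp: g_def chains_def)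
    qed blast
    have slice_c: "slice m' c = (if m' = m then f else (\<lambda>_. 0))" for m'
      using m by (auto simp: c(2) g_def fun_eq_iff)
    have "kdiff (\<lambda>v f. Var v * f) c T = 0" for T
    proof (rule poly_mapping_eqI)
      fix n
      have "boundary (slice (raise (lookup n) T) c) T = 0"
        using cyc by (simp add: slice_c kdiff_def)
      then show "lookup (kdiff (\<lambda>v f. Var v * f) c T) n = lookup 0 n"
        by (simp add: kdiff_slice lookup_slice)
    qed
    then obtain b where b: "b \<in> chains (monomial_part A d) (Suc p)"
        "\<And>T. kdiff (\<lambda>v f. Var v * f) b T = c T" using exact_atD[OF L c(1)] by auto
    have "boundary (slice m b) T = slice m c T" for T
      by (simp add: kdiff_slice b(2) slice_def)
    then have "boundary (slice m b) T = f T" for T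
      by (simp add: slice_c)
    then show "\<exists>b\<in>chains (\<lambda>T. if T \<in> upper_koszul A m then UNIV else {0}) (Suc p).
        \<forall>T. boundary b T = f T"
      using slice_chains[OF b(1)] by blast
  qed
qed

end

text \<open>
  Here \<open>Z\<close> lies in a free module whose \<open>k\<close>-th basis vector has degree \<open>s k\<close>.
\<close>

definition strand ::
    "(nat \<Rightarrow> ('v::finite, 'k::field) mpol) set \<Rightarrow> (nat \<Rightarrow> int) \<Rightarrow> int \<Rightarrow> 'v set \<Rightarrow>
     (nat \<Rightarrow> ('v, 'k) mpol) set" where
  "strand Z s j T = {f \<in> Z. \<forall>k. homogeneous (j - int (card T) - s k) (f k)}"

abbreviation var_scale :: "'v::finite \<Rightarrow> (nat \<Rightarrow> ('v, 'k::field) mpol) \<Rightarrow> nat \<Rightarrow> ('v, 'k) mpol" where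
  "var_scale v f \<equiv> (\<lambda>k. Var v * f k)"

text \<open>
  With \<open>r = 1\<close> this is the ideal itself, as a submodule of \<open>R\<close>; with \<open>A\<close> always true it is the free
  module of rank \<open>r\<close>.
\<close>

definition monomial_power ::
    "nat \<Rightarrow> (('v \<Rightarrow> nat) \<Rightarrow> bool) \<Rightarrow> (nat \<Rightarrow> ('v::finite, 'k::field) mpol) set" where
  "monomial_power r A =
     {f \<in> free_module r. \<forall>k<r. \<forall>n\<in>keys (f k). A (lookup n)}"

lemma strand_monomial_power:
  "f \<in> strand (monomial_power r A) s j T \<longleftrightarrow>
     (\<forall>k. f k \<in> (if k < r then monomial_part A (j - s k) T else {0}))"
proof -
  have eq: "j - s k - int (card T) = j - int (card T) - s k" for k by simp
  have "0 = f k" if "f \<in> free_module r" "\<not> k < r" for k using that by (simp add: free_module_def)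
  then show ?thesis
    unfolding strand_def monomial_power_def monomial_part_def homogeneous_def eq
    by (auto simp: free_module_def split: if_splits) (metis keys_zero empty_iff not_le)
qed

context vertex_order
begin

lemma kdiff_component: "kdiff var_scale c T k = kdiff (\<lambda>v f. Var v * f) (\<lambda>T. c T k) T"
  by (rule kdiff_hom[where f = "\<lambda>c. c k"]) (auto intro: additive.intro)

theorem exact_monomial_power:
  "exact_at var_scale
     (strand (monomial_power r A) s j :: 'v set \<Rightarrow> (nat \<Rightarrow> ('v, 'k::field) mpol) set) p \<longleftrightarrow>
    (\<forall>k<r. \<forall>m. int (sum m UNIV) = j - s k \<longrightarrow> acyclic_at TYPE('k) (upper_koszul A m) p)"
proof -
  have part_0: "0 \<in> (monomial_part A d T :: ('v, 'k) mpol set)" for d T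
    by (simp add: monomial_part_def)
  have chains_iff: "c \<in> chains (strand (monomial_power r A) s j) q \<longleftrightarrow>
      (\<forall>k. if k < r then (\<lambda>T. c T k) \<in> chains (monomial_part A (j - s k)) q else \<forall>T. c T k = 0)"
    for c :: "'v set \<Rightarrow> nat \<Rightarrow> ('v, 'k) mpol" and q
    by (simp add: chains_def strand_monomial_power fun_eq_iff split: if_splits)
      (metis (mono_tags, lifting) empty_iff insert_iff)
  have "exact_at var_scale
     (strand (monomial_power r A) s j :: 'v set \<Rightarrow> (nat \<Rightarrow> ('v, 'k) mpol) set) p \<longleftrightarrow>
     (\<forall>k<r. exact_at (\<lambda>v f. Var v * f)
        (monomial_part A (j - s k) :: 'v set \<Rightarrow> ('v, 'k) mpol set) p)" (is "?L \<longleftrightarrow> ?R")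
  proof
    assume R: ?R
    show ?L unfolding exact_at_def
    proof (intro ballI impI)
      fix c :: "'v set \<Rightarrow> nat \<Rightarrow> ('v, 'k) mpol"
      assume c: "c \<in> chains (strand (monomial_power r A) s j) p"
        and cyc: "\<forall>T. kdiff var_scale c T = 0"
      have "\<exists>b. (if k < r then b \<in> chains (monomial_part A (j - s k)) (Suc p) else b = (\<lambda>_. 0)) \<and>
          (\<forall>T. kdiff (\<lambda>v f. Var v * f) b T = c T k)" for k
      proof (cases "k < r")
        case True
        then have "(\<lambda>T. c T k) \<in> chains (monomial_part A (j - s k)) p" using c by (auto simp: chains_iff)
        moreover have "kdiff (\<lambda>v f. Var v * f) (\<lambda>T. c T k) T = 0" for T
          using cyc by (simp flip: kdiff_component)
        ultimately show ?thesis using exact_atD[OF R[rule_format, OF True]] True by metis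
      next
        case False
        then show ?thesis using c by (auto simp: chains_iff kdiff_def split: if_splits)
      qed
      then obtain b where b: "\<And>k. if k < r then b k \<in> chains (monomial_part A (j - s k)) (Suc p) else b k = (\<lambda>_. 0)"
          "\<And>k T. kdiff (\<lambda>v f. Var v * f) (b k) T = c T k" by metis
      define b' where "b' = (\<lambda>T k. b k T)"
      have "b' \<in> chains (strand (monomial_power r A) s j) (Suc p)"
        using b(1) by (auto simp: chains_iff b'_def split: if_splits)
      moreover have "kdiff var_scale b' T = c T" for T
        by (rule ext) (simp add: kdiff_component b'_def b(2))
      ultimately show "\<exists>b\<in>chains (strand (monomial_power r A) s j) (Suc p).
          \<forall>T. kdiff var_scale b T = c T" by blast
    qed
  next
    assume L: ?L
    show ?R unfolding exact_at_def
    proof (intro allI ballI impI)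
      fix k and c :: "'v set \<Rightarrow> ('v, 'k) mpol"
      assume k: "k < r" and c: "c \<in> chains (monomial_part A (j - s k)) p"
        and cyc: "\<forall>T. kdiff (\<lambda>v f. Var v * f) c T = 0"
      define c' where "c' = (\<lambda>T l. if l = k then c T else 0)"
      have "c' \<in> chains (strand (monomial_power r A) s j) p"
        using c k part_0 by (auto simp: chains_iff c'_def) (auto simp: chains_def part_0)
      moreover have "kdiff var_scale c' T = 0" for T
      proof
        fix l show "kdiff var_scale c' T l = 0 l"
          using cyc by (cases "l = k") (simp_all add: kdiff_component c'_def, simp add: kdiff_def)
      qed
      ultimately obtain b where b: "b \<in> chains (strand (monomial_power r A) s j) (Suc p)"
          "\<And>T. kdiff var_scale b T = c' T" using exact_atD[OF L] by metis
      have "kdiff (\<lambda>v f. Var v * f) (\<lambda>T. b T k) T = c T" for T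
        using b(2)[of T] by (simp add: c'_def flip: kdiff_component)
      then show "\<exists>b\<in>chains (monomial_part A (j - s k)) (Suc p).
          \<forall>T. kdiff (\<lambda>v f. Var v * f) b T = c T"
        using b(1) k by (intro bexI[of _ "\<lambda>T. b T k"]) (auto simp: chains_iff)
    qed
  qed
  then show ?thesis by (simp add: exact_monomial_part)
qed

end

section \<open>Acyclic complexes and regularity bounds\<close>

context vertex_order
begin

lemma acyclic_at_iff:
  "acyclic_at TYPE('k::field) K p \<longleftrightarrow>
    (\<forall>f :: 'v set \<Rightarrow> 'k. (\<forall>T. f T \<noteq> 0 \<longrightarrow> T \<in> K \<and> card T = p) \<and> (\<forall>T. boundary f T = 0) \<longrightarrow>
      (\<exists>g. (\<forall>T. g T \<noteq> 0 \<longrightarrow> T \<in> K \<and> card T = Suc p) \<and> (\<forall>T. boundary g T = f T)))"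
proof -
  have "f \<in> chains (\<lambda>T. if T \<in> K then UNIV else {0}) q \<longleftrightarrow> (\<forall>T. f T \<noteq> 0 \<longrightarrow> T \<in> K \<and> card T = q)"
    for f :: "'v set \<Rightarrow> 'k" and q
    by (auto simp: chains_def)
  then show ?thesis by (auto simp: acyclic_at_def exact_at_def Ball_def Bex_def)
qed

lemma acyclic_at_empty: "acyclic_at TYPE('k::field) {} p"
  unfolding acyclic_at_iff by (auto intro!: exI[of _ "\<lambda>_. 0"] simp: kdiff_def)

lemma additive_id: "additive (\<lambda>x. x)"
  by unfold_locales simp

lemma signed_eq_0 [simp]: "signed v T b = 0 \<longleftrightarrow> b = 0"
  by (simp add: signed_def)

lemma kdiff_avoiding:
  assumes "\<And>T. v \<notin> T \<Longrightarrow> g T = 0" "v \<notin> T"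
  shows "boundary g T = signed v T (g (insert v T))"
proof -
  have "boundary g T = (\<Sum>w\<in>{v}. signed w T (g (insert w T)))"
    unfolding kdiff_def
  proof (rule sum.mono_neutral_right)
    show "\<forall>w\<in>-T - {v}. signed w T (g (insert w T)) = 0"
    proof
      fix w assume "w \<in> -T - {v}"
      then have "v \<notin> insert w T" using assms(2) by auto
      then show "signed w T (g (insert w T)) = 0" using assms(1) by simp
    qed
  qed (use assms in auto)
  then show ?thesis by simp
qed

lemma kdiff_insert:
  assumes "v \<notin> T"
  shows "boundary (\<lambda>S. signed v (S - {v}) (g (S - {v}))) (insert v T) =
    - signed v T (\<Sum>w\<in>-insert v T. signed w T (g (insert w T)))"
proof -
  have "signed w (insert v T) (signed v (insert w T) b) = - signed v T (signed w T b)"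
    if "w \<noteq> v" "w \<notin> T" for w and b :: "'a::ab_group_add"
    using signed_swap[of v w T "signed v (insert w T) b"] that assms
    by (metis signed_minus signed_signed)
  moreover have "insert w (insert v T) - {v} = insert w T" if "w \<noteq> v" for w
    using that assms by auto
  ultimately show ?thesis
    by (simp add: kdiff_def signed_sum flip: sum_negf)
qed

lemma kdiff_split:
  assumes "v \<notin> T"
  shows "boundary f T =
    signed v T (f (insert v T)) + (\<Sum>w\<in>-insert v T. signed w T (f (insert w T)))"
proof -
  have "-T = insert v (-insert v T)" using assms by auto
  then show ?thesis unfolding kdiff_def by simp
qed

text \<open>
  Inserting \<open>v\<close> is a contracting homotopy.
\<close>

lemma acyclic_cone:
  assumes K: "\<And>T. T \<in> K \<Longrightarrow> insert v T \<in> K"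
  shows "acyclic_at TYPE('k::field) K p"
  unfolding acyclic_at_iff
proof (intro allI impI, elim conjE)
  fix f :: "'v set \<Rightarrow> 'k"
  assume f: "\<forall>T. f T \<noteq> 0 \<longrightarrow> T \<in> K \<and> card T = p" and cyc: "\<forall>T. boundary f T = 0"
  define g where "g T = (if v \<in> T then signed v (T - {v}) (f (T - {v})) else 0)" for T
  have "boundary g T = f T" for T
  proof (cases "v \<in> T")
    case False
    then show ?thesis using kdiff_avoiding[of v g T] by (simp add: g_def)
  next
    case True
    then obtain S where S: "T = insert v S" "v \<notin> S" by (meson mk_disjoint_insert)
    have "boundary g T = boundary (\<lambda>S. signed v (S - {v}) (f (S - {v}))) T"
      using True by (simp add: kdiff_def g_def)
    also have "\<dots> = - signed v S (\<Sum>w\<in>-T. signed w S (f (insert w S)))"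
      unfolding S(1) by (rule kdiff_insert[OF S(2)])
    also have "(\<Sum>w\<in>-T. signed w S (f (insert w S))) = - signed v S (f T)"
      using kdiff_split[OF S(2), of f] cyc by (simp add: S(1) eq_neg_iff_add_eq_0 add.commute)
    finally show ?thesis by (simp add: signed_minus)
  qed
  moreover have "T \<in> K \<and> card T = Suc p" if "g T \<noteq> 0" for T
  proof -
    have v: "v \<in> T" "f (T - {v}) \<noteq> 0" using that by (auto simp: g_def split: if_splits)
    then have "T - {v} \<in> K" "card (T - {v}) = p" using f by auto
    then show ?thesis using K[of "T - {v}"] v by (metis card_Suc_Diff1 finite insert_Diff)
  qed
  ultimately show "\<exists>g. (\<forall>T. g T \<noteq> 0 \<longrightarrow> T \<in> K \<and> card T = Suc p) \<and> (\<forall>T. boundary g T = f T)"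
    by blast
qed

text \<open>
  A cycle on \<open>K\<close> restricts to a cycle \<open>h\<close> on the link of \<open>v\<close>. If \<open>h\<close> bounds there, subtracting the boundary of
  the cone \<open>G\<close> over the bounding chain leaves a cycle on the deletion of \<open>v\<close>.
\<close>

lemma acyclic_deletion_link:
  assumes down: "\<And>T. insert v T \<in> K \<Longrightarrow> T \<in> K"
    and del: "acyclic_at TYPE('k::field) {T\<in>K. v \<notin> T} p"
    and link: "\<And>q. p = Suc q \<Longrightarrow> acyclic_at TYPE('k) {T. v \<notin> T \<and> insert v T \<in> K} q"
  shows "acyclic_at TYPE('k) K p"
  unfolding acyclic_at_iff
proof (intro allI impI, elim conjE)
  fix f :: "'v set \<Rightarrow> 'k"
  assume f: "\<forall>T. f T \<noteq> 0 \<longrightarrow> T \<in> K \<and> card T = p" and cyc: "\<forall>T. boundary f T = 0"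
  define h where "h T = (if v \<in> T then 0 else signed v T (f (insert v T)))" for T
  have "boundary h T = 0" for T
  proof (cases "v \<in> T")
    case True
    then show ?thesis by (simp add: kdiff_def h_def)
  next
    case False
    have swap: "signed w T (h (insert w T)) = - signed v T (signed w (insert v T) (f (insert w (insert v T))))"
      if "w \<in> -insert v T" for w
    proof -
      have "h (insert w T) = signed v (insert w T) (f (insert w (insert v T)))"
        using that False by (auto simp: h_def insert_commute)
      then show ?thesis using signed_swap[of w v T] that False by auto
    qed
    have "boundary h T = (\<Sum>w\<in>-insert v T. - signed v T (signed w (insert v T) (f (insert w (insert v T)))))"
    proof -
      have "h (insert v T) = 0" by (simp add: h_def)
      then show ?thesis unfolding kdiff_split[OF False] by (simp add: swap)
    qed
    also have "\<dots> = - signed v T (boundary f (insert v T))"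
      by (simp add: sum_negf signed_sum kdiff_def)
    finally show ?thesis using cyc by simp
  qed
  moreover have h_supp: "v \<notin> T \<and> insert v T \<in> K \<and> p = Suc (card T)" if "h T \<noteq> 0" for T
    using that f[rule_format, of "insert v T"] by (auto simp: h_def split: if_splits)
  ultimately obtain g where g: "\<And>T. g T \<noteq> 0 \<Longrightarrow> v \<notin> T \<and> insert v T \<in> K \<and> card T = p"
      "\<And>T. boundary g T = h T"
  proof (cases p)
    case 0
    then have "h T = 0" for T using h_supp[of T] by auto
    then show thesis by (intro that[of "\<lambda>_. 0"]) (auto simp: kdiff_def)
  next
    case (Suc q)
    have "\<exists>g. (\<forall>T. g T \<noteq> 0 \<longrightarrow> T \<in> {T. v \<notin> T \<and> insert v T \<in> K} \<and> card T = Suc q) \<and>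
        (\<forall>T. boundary g T = h T)"
      using link[OF Suc] h_supp Suc \<open>\<And>T. boundary h T = 0\<close> unfolding acyclic_at_iff by simp
    then show thesis using that Suc by auto
  qed
  (* The sign makes the boundary of G agree with f, and not with -f, on the faces that contain v. *)
  define G where "G T = (if v \<in> T then - signed v (T - {v}) (g (T - {v})) else 0)" for T
  have G_supp: "T \<in> K \<and> card T = Suc p" if "G T \<noteq> 0" for T
  proof -
    have v: "v \<in> T" "g (T - {v}) \<noteq> 0" using that by (auto simp: G_def split: if_splits)
    then show ?thesis using g(1)[of "T - {v}"] by (metis card_Suc_Diff1 finite insert_Diff)
  qed
  have bd_G: "boundary G T = (if v \<in> T then f T else - g T)" for T
  proof (cases "v \<in> T")
    case False
    then show ?thesis using kdiff_avoiding[of v G T] by (simp add: G_def signed_minus)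
  next
    case True
    then obtain S where S: "T = insert v S" "v \<notin> S" by (meson mk_disjoint_insert)
    have "boundary G T = - boundary (\<lambda>S. signed v (S - {v}) (g (S - {v}))) T"
      using True by (simp add: kdiff_def G_def signed_minus sum_negf)
    also have "\<dots> = signed v S (\<Sum>w\<in>-T. signed w S (g (insert w S)))"
      unfolding S(1) by (simp add: kdiff_insert[OF S(2)])
    also have "(\<Sum>w\<in>-T. signed w S (g (insert w S))) = h S"
    proof -
      have "g T = 0" using g(1)[of T] True by auto
      then show ?thesis using kdiff_split[OF S(2), of g] unfolding g(2) S(1)[symmetric] by simp
    qed
    finally show ?thesis using S True by (simp add: h_def)
  qed
  define f' where "f' T = f T - boundary G T" for T
  have "T \<in> {T\<in>K. v \<notin> T} \<and> card T = p" if "f' T \<noteq> 0" for T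
  proof -
    have "v \<notin> T" "f T \<noteq> 0 \<or> g T \<noteq> 0" using that by (auto simp: f'_def bd_G split: if_splits)
    then show ?thesis using f g(1)[of T] down[of T] by auto
  qed
  moreover have "boundary f' T = 0" for T
    unfolding f'_def using cyc by (simp add: kdiff_diff additive_id kdiff_kdiff)
  ultimately obtain g' where g': "\<And>T. g' T \<noteq> 0 \<Longrightarrow> T \<in> {T\<in>K. v \<notin> T} \<and> card T = Suc p"
      "\<And>T. boundary g' T = f' T"
    using del[unfolded acyclic_at_iff, rule_format, of f'] by blast
  show "\<exists>g. (\<forall>T. g T \<noteq> 0 \<longrightarrow> T \<in> K \<and> card T = Suc p) \<and> (\<forall>T. boundary g T = f T)"
  proof (intro exI[of _ "\<lambda>T. G T + g' T"] conjI allI impI)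
    fix T assume "G T + g' T \<noteq> 0"
    then have "G T \<noteq> 0 \<or> g' T \<noteq> 0" by auto
    then show "T \<in> K" "card T = Suc p" using G_supp g'(1) by auto
  next
    fix T show "boundary (\<lambda>T. G T + g' T) T = f T"
      by (simp add: kdiff_add additive_id g'(2) f'_def)
  qed
qed

end

subsection \<open>Bounds for upper Koszul complexes\<close>

lemma lower_zero [simp]: "m v = 0 \<Longrightarrow> lower m T v = 0"
  by (simp add: lower_def)

definition up_closed :: "(('v \<Rightarrow> nat) \<Rightarrow> bool) \<Rightarrow> bool" where
  "up_closed A \<longleftrightarrow> (\<forall>m n. A m \<and> m \<le> n \<longrightarrow> A n)"

definition colon :: "(('v \<Rightarrow> nat) \<Rightarrow> bool) \<Rightarrow> 'v \<Rightarrow> ('v \<Rightarrow> nat) \<Rightarrow> bool" where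
  "colon A v m \<longleftrightarrow> A (m(v := Suc (m v)))"

lemma up_closedD: "up_closed A \<Longrightarrow> A m \<Longrightarrow> (\<And>v. m v \<le> n v) \<Longrightarrow> A n"
  by (auto simp: up_closed_def le_fun_def)

lemma sum_zero_at: "sum (m(v := 0)) UNIV + m v = sum m (UNIV :: 'v::finite set)"
proof -
  have "sum (m(v := 0)) (UNIV - {v}) = sum m (UNIV - {v})" by (intro sum.cong) auto
  then show ?thesis by (simp add: sum.remove[of UNIV v] add.commute)
qed

lemma up_closed_colon: "up_closed A \<Longrightarrow> up_closed (colon A v)"
  unfolding up_closed_def colon_def le_fun_def by (metis Suc_le_mono fun_upd_def)

context vertex_order
begin

text \<open>
  If this holds in every multidegree \<open>m\<close>, the ideal has regularity at most \<open>c\<close>. Working with one \<open>m\<close> at a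
  time lets the inductions below run over the multidegree instead of over ideals.
\<close>

definition reg_bound :: "'k::field itself \<Rightarrow> (('v \<Rightarrow> nat) \<Rightarrow> bool) \<Rightarrow> ('v \<Rightarrow> nat) \<Rightarrow> nat \<Rightarrow> bool" where
  "reg_bound k A m c \<longleftrightarrow> (\<forall>p. p + c < sum m UNIV \<longrightarrow> acyclic_at k (upper_koszul A m) p)"

lemma upper_koszul_down:
  assumes "up_closed A" "insert v T \<in> upper_koszul A m"
  shows "T \<in> upper_koszul A m"
  using assms up_closedD[OF assms(1), of "lower m (insert v T)" "lower m T"]
  by (auto simp: upper_koszul_def lower_def)

lemma reg_bound_trivial:
  assumes "up_closed A" "\<not> A m"
  shows "reg_bound TYPE('k::field) A m c"
proof -
  have "upper_koszul A m = {}"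
    using assms up_closedD[OF assms(1), of "lower m _" m] by (auto simp: upper_koszul_def lower_def)
  then show ?thesis by (simp add: reg_bound_def acyclic_at_empty)
qed

lemma reg_bound_cone:
  assumes "\<And>T. v \<notin> T \<Longrightarrow> T \<subseteq> supp m \<Longrightarrow> A (lower m T) \<Longrightarrow> A (lower m (insert v T))" "m v \<noteq> 0"
  shows "reg_bound TYPE('k::field) A m c"
proof -
  have "insert v T \<in> upper_koszul A m" if "T \<in> upper_koszul A m" for T
    using that assms by (cases "v \<in> T") (auto simp: upper_koszul_def supp_def insert_absorb)
  then show ?thesis unfolding reg_bound_def by (blast intro: acyclic_cone)
qed

text \<open>
  All faces avoiding \<open>v\<close> are present, so the deletion is a simplex. It fails to be acyclic only if it has
  no vertices; then \<open>m\<close> is concentrated at \<open>v\<close>, and \<open>p + c < |m| = m v\<close> is impossible.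
\<close>

lemma deletion_full:
  assumes "\<And>n. n v \<ge> m v \<Longrightarrow> A n" "c \<ge> m v" "p + c < sum m UNIV"
  shows "acyclic_at TYPE('k::field) {T \<in> upper_koszul A m. v \<notin> T} p"
proof -
  have "\<exists>u. u \<noteq> v \<and> m u \<noteq> 0"
  proof (rule ccontr)
    assume "\<not> ?thesis"
    then have "sum (m(v := 0)) UNIV = 0" by (intro sum.neutral) auto
    then show False using assms(2,3) sum_zero_at[of m v] by simp
  qed
  then obtain u where u: "u \<noteq> v" "m u \<noteq> 0" by blast
  have "{T \<in> upper_koszul A m. v \<notin> T} = {T. T \<subseteq> supp m \<and> v \<notin> T}"
    using assms(1) by (auto simp: upper_koszul_def lower_def)
  then show ?thesis using u by (intro acyclic_cone[of _ u]) (auto simp: supp_def)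
qed

text \<open>
  For \<open>m v = 1\<close> the link of \<open>v\<close> is the complex of the same ideal without \<open>v\<close>, and the deletion is the complex
  of the colon ideal.
\<close>

lemma reg_bound_step:
  assumes A: "up_closed A" and v: "m v = 1"
    and link: "reg_bound TYPE('k::field) A (m(v := 0)) (Suc c)"
    and del: "reg_bound TYPE('k) (colon A v) (m(v := 0)) c"
  shows "reg_bound TYPE('k) A m (Suc c)"
  unfolding reg_bound_def
proof (intro allI impI)
  fix p assume p: "p + Suc c < sum m UNIV"
  have m: "sum m UNIV = Suc (sum (m(v := 0)) UNIV)" using sum_zero_at[of m v] v by simp
  have "(lower (m(v := 0)) T)(v := Suc 0) = lower m T" if "T \<subseteq> supp (m(v := 0))" for T
    using that v by (auto simp: lower_def fun_eq_iff supp_def)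
  then have del_eq: "{T \<in> upper_koszul A m. v \<notin> T} = upper_koszul (colon A v) (m(v := 0))"
  proof -
    have "T \<subseteq> supp m \<and> v \<notin> T \<longleftrightarrow> T \<subseteq> supp (m(v := 0))" for T by (auto simp: supp_def)
    then show ?thesis
      using \<open>\<And>T. T \<subseteq> supp (m(v := 0)) \<Longrightarrow> (lower (m(v := 0)) T)(v := Suc 0) = lower m T\<close>
      unfolding upper_koszul_def colon_def by (simp cong: conj_cong) blast
  qed
  have "lower (m(v := 0)) T = lower m (insert v T)" for T
    using v by (auto simp: lower_def fun_eq_iff)
  then have link_eq: "{T. v \<notin> T \<and> insert v T \<in> upper_koszul A m} = upper_koszul A (m(v := 0))"
    using v by (auto simp: upper_koszul_def supp_def)
  show "acyclic_at TYPE('k) (upper_koszul A m) p"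
    by (rule acyclic_deletion_link[where v = v, OF upper_koszul_down[OF A]])
      (use link del p m in \<open>auto simp: del_eq link_eq reg_bound_def\<close>)
qed

text \<open>
  For \<open>m v = 2\<close> the link is the complex of the colon ideal, and the deletion is a simplex because
  \<open>x\<^sub>v\<^sup>2\<close> lies in the ideal. The total degree drops by \<open>2\<close> and the homological degree by \<open>1\<close>.
\<close>

lemma reg_bound_square:
  assumes A: "up_closed A" and v: "m v = 2" "\<And>n. n v \<ge> 2 \<Longrightarrow> A n" and c: "c \<ge> 1"
    and link: "reg_bound TYPE('k::field) (colon A v) (m(v := 0)) c"
  shows "reg_bound TYPE('k) A m (Suc c)"
  unfolding reg_bound_def
proof (intro allI impI)
  fix p assume p: "p + Suc c < sum m UNIV"
  have m: "sum m UNIV = sum (m(v := 0)) UNIV + 2" using sum_zero_at[of m v] v by simp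
  have "(lower (m(v := 0)) T)(v := Suc 0) = lower m (insert v T)" for T
    using v by (auto simp: lower_def fun_eq_iff)
  then have link_eq: "{T. v \<notin> T \<and> insert v T \<in> upper_koszul A m} = upper_koszul (colon A v) (m(v := 0))"
    using v by (auto simp: upper_koszul_def supp_def colon_def lower_zero)
  show "acyclic_at TYPE('k) (upper_koszul A m) p"
  proof (rule acyclic_deletion_link[where v = v, OF upper_koszul_down[OF A]])
    show "acyclic_at TYPE('k) {T \<in> upper_koszul A m. v \<notin> T} p"
      using v c p by (intro deletion_full[where c = "Suc c"]) auto
  qed (use link p m in \<open>auto simp: link_eq reg_bound_def\<close>)
qed

text \<open>
  If the variable \<open>x\<^sub>v\<close> itself lies in the ideal, removing \<open>v\<close> lowers total and homological degree
  by one each, so it does not change the bound.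
\<close>

lemma reg_bound_variable:
  assumes A: "up_closed A" and v: "\<And>n. n v \<ge> 1 \<Longrightarrow> A n" and c: "c \<ge> 1"
    and link: "reg_bound TYPE('k::field) A (m(v := 0)) c"
  shows "reg_bound TYPE('k) A m c"
proof -
  consider "m v = 0" | "m v = 1" | "m v \<ge> 2" by linarith
  then show ?thesis
  proof cases
    case 1
    then show ?thesis using link by (metis fun_upd_triv)
  next
    case 3
    then show ?thesis by (intro reg_bound_cone[of v]) (auto intro!: v simp: lower_def)
  next
    case 2
    have m: "sum m UNIV = Suc (sum (m(v := 0)) UNIV)" using sum_zero_at[of m v] 2 by simp
    have "lower (m(v := 0)) T = lower m (insert v T)" for T
      using 2 by (auto simp: lower_def fun_eq_iff)
    then have link_eq: "{T. v \<notin> T \<and> insert v T \<in> upper_koszul A m} = upper_koszul A (m(v := 0))"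
      using 2 by (auto simp: upper_koszul_def supp_def)
    show ?thesis unfolding reg_bound_def
    proof (intro allI impI)
      fix p assume p: "p + c < sum m UNIV"
      show "acyclic_at TYPE('k) (upper_koszul A m) p"
      proof (rule acyclic_deletion_link[where v = v, OF upper_koszul_down[OF A]])
        show "acyclic_at TYPE('k) {T \<in> upper_koszul A m. v \<notin> T} p"
          using v c p 2 by (intro deletion_full[where c = c]) auto
      qed (use link p m in \<open>auto simp: link_eq reg_bound_def\<close>)
    qed
  qed
qed

lemma reg_bound_variables:
  assumes A: "up_closed A" and v: "\<And>v n. v \<in> L \<Longrightarrow> n v \<ge> 1 \<Longrightarrow> A n" and c: "c \<ge> 1"
    and link: "reg_bound TYPE('k::field) A (\<lambda>v. if v \<in> L then 0 else m v) c"
  shows "reg_bound TYPE('k) A m c"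
  using finite[of L] v link
proof (induction L arbitrary: m rule: finite_induct)
  case (insert w L)
  have "(\<lambda>v. if v \<in> L then 0 else (m(w := 0)) v) = (\<lambda>v. if v \<in> insert w L then 0 else m v)"
    (is "?l = ?r") by auto
  have "reg_bound TYPE('k) A (m(w := 0)) c"
  proof (rule insert.IH[rotated])
    show "A n" if "v \<in> L" "1 \<le> n v" for v n using insert.prems(1)[of v n] that by simp
    show "reg_bound TYPE('k) A (\<lambda>v. if v \<in> L then 0 else (m(w := 0)) v) c"
      using insert.prems(2) by (simp only: \<open>?l = ?r\<close>)
  qed
  moreover have "A n" if "n w \<ge> 1" for n using insert.prems(1)[of w n] that by simp
  ultimately show ?case using c by (rule reg_bound_variable[where v = w, OF A, rotated 2])
qed simp

end

section \<open>Simple vertices of chordal bipartite graphs\<close>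

text \<open>
  Two interleaved paths \<open>x\<^sub>0, y\<^sub>1, x\<^sub>2, \<dots>\<close> and \<open>y\<^sub>0, x\<^sub>1, y\<^sub>2, \<dots>\<close> that are joined by \<open>R\<close> at both ends; this is an
  induced cycle of length \<open>2 * k\<close>. With this indexing the adjacency is almost symmetric in \<open>xs\<close> and \<open>ys\<close>,
  as it arises from the growing zigzags below.
\<close>

definition closed_zigzag :: "('a \<Rightarrow> 'b \<Rightarrow> bool) \<Rightarrow> nat \<Rightarrow> (nat \<Rightarrow> 'a) \<Rightarrow> (nat \<Rightarrow> 'b) \<Rightarrow> bool" where
  "closed_zigzag R k xs ys \<longleftrightarrow> k \<ge> 3 \<and> inj_on xs {..<k} \<and> inj_on ys {..<k} \<and>
     (\<forall>i<k. \<forall>j<k. R (xs i) (ys j) \<longleftrightarrow>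
        i = Suc j \<or> j = Suc i \<or> i = j \<and> (i = 0 \<or> Suc i = k))"

definition long_cycle :: "('a \<Rightarrow> 'b \<Rightarrow> bool) \<Rightarrow> 'a set \<Rightarrow> 'b set \<Rightarrow> bool" where
  "long_cycle R X Y \<longleftrightarrow>
     (\<exists>k xs ys. closed_zigzag R k xs ys \<and> xs ` {..<k} \<subseteq> X \<and> ys ` {..<k} \<subseteq> Y)"

lemma long_cycle_mono: "long_cycle R X Y \<Longrightarrow> X \<subseteq> X' \<Longrightarrow> Y \<subseteq> Y' \<Longrightarrow> long_cycle R X' Y'"
proof -
  assume "long_cycle R X Y" "X \<subseteq> X'" "Y \<subseteq> Y'"
  then obtain k xs ys where "closed_zigzag R k xs ys" "xs ` {..<k} \<subseteq> X'" "ys ` {..<k} \<subseteq> Y'"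
    unfolding long_cycle_def by (elim exE conjE) (blast intro: that)
  then show ?thesis unfolding long_cycle_def by (intro exI conjI)
qed

lemma sum_power_less:
  fixes c :: "'a \<Rightarrow> nat"
  assumes "finite S" "inj_on c S" "\<And>y. y \<in> S \<Longrightarrow> c y < n"
  shows "(\<Sum>y\<in>S. 2 ^ c y) < (2 :: nat) ^ n"
proof -
  have "(\<Sum>y\<in>S. 2 ^ c y) = (\<Sum>i\<in>c ` S. 2 ^ i)" by (simp add: sum.reindex[OF assms(2)])
  also have "\<dots> \<le> (\<Sum>i<n. (2 :: nat) ^ i)" using assms(3) by (intro sum_mono2) auto
  also have "\<dots> < 2 ^ n" by (induction n) auto
  finally show ?thesis .
qed

text \<open>
  Comparing binary numbers is comparing digit sets lexicographically, the largest position first.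
\<close>

lemma larger_element_of_larger_value:
  fixes c :: "'a \<Rightarrow> nat"
  assumes "finite S" "finite S'" "inj_on c (S \<union> S')"
    and le: "(\<Sum>y\<in>S. 2 ^ c y) \<le> (\<Sum>y\<in>S'. (2 :: nat) ^ c y)" and y: "y \<in> S - S'"
  shows "\<exists>y'\<in>S' - S. c y < c y'"
proof (rule ccontr)
  assume none: "\<not> ?thesis"
  have "c y' < c y" if "y' \<in> S' - S" for y'
    using none that y assms(3) by (metis Diff_iff UnI1 UnI2 inj_onD linorder_neqE_nat)
  then have "(\<Sum>y\<in>S' - S. 2 ^ c y) < (2 :: nat) ^ c y"
    using assms(2,3) by (intro sum_power_less) (auto simp: inj_on_def)
  also have "\<dots> \<le> (\<Sum>y\<in>S - S'. 2 ^ c y)" using y assms(1) by (intro member_le_sum) auto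
  finally have "(\<Sum>y\<in>S' - S. 2 ^ c y) < (\<Sum>y\<in>S - S'. (2 :: nat) ^ c y)" .
  moreover have "(\<Sum>y\<in>S. (2 :: nat) ^ c y) = (\<Sum>y\<in>S - S'. 2 ^ c y) + (\<Sum>y\<in>S \<inter> S'. 2 ^ c y)"
    "(\<Sum>y\<in>S'. (2 :: nat) ^ c y) = (\<Sum>y\<in>S' - S. 2 ^ c y) + (\<Sum>y\<in>S \<inter> S'. 2 ^ c y)"
    using assms(1,2) by (metis (no_types) add.commute sum.Int_Diff inf_commute)+
  ultimately show False using le by linarith
qed

text \<open>
  Otherwise exchanging the ranks of \<open>x\<close> and \<open>x'\<close> would increase the weighted sum.
\<close>

lemma optimal_ranking_sorted:
  fixes r :: "'a \<Rightarrow> nat" and w :: "'a \<Rightarrow> nat"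
  assumes "finite X" "inj_on r X" "x \<in> X" "x' \<in> X" "r x < r x'"
    and opt: "\<And>r'. inj_on r' X \<Longrightarrow> r' ` X = r ` X \<Longrightarrow> (\<Sum>x\<in>X. 2 ^ r' x * w x) \<le> (\<Sum>x\<in>X. 2 ^ r x * w x)"
  shows "w x \<le> w x'"
proof (rule ccontr)
  assume "\<not> w x \<le> w x'"
  define r' where "r' = r(x := r x', x' := r x)"
  have ne: "x \<noteq> x'" using assms(5) by auto
  have inj: "inj_on r' X" using assms(2-4) ne unfolding r'_def inj_on_def by auto
  have im: "r' ` X = r ` X" using assms(3,4) ne unfolding r'_def by (auto simp: image_iff)
  let ?S = "X - {x, x'}"
  have split: "(\<Sum>x\<in>X. 2 ^ q x * w x) = 2 ^ q x * w x + 2 ^ q x' * w x' + (\<Sum>x\<in>?S. 2 ^ q x * w x)" for q :: "'a \<Rightarrow> nat"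
  proof -
    have "X = insert x (insert x' ?S)" using assms(3,4) by auto
    then have "(\<Sum>x\<in>X. 2 ^ q x * w x) = (\<Sum>x\<in>insert x (insert x' ?S). 2 ^ q x * w x)" by simp
    also have "\<dots> = 2 ^ q x * w x + 2 ^ q x' * w x' + (\<Sum>x\<in>?S. 2 ^ q x * w x)"
      using ne assms(1) by (subst sum.insert) auto
    finally show ?thesis .
  qed
  have "(\<Sum>x\<in>?S. 2 ^ r' x * w x) = (\<Sum>x\<in>?S. 2 ^ r x * w x)"
    by (intro sum.cong) (auto simp: r'_def)
  then have "2 ^ r x' * w x + 2 ^ r x * w x' \<le> 2 ^ r x * w x + 2 ^ r x' * w x'"
    using opt[OF inj im] ne unfolding split by (simp add: r'_def)
  moreover have "(2 ^ r x' - 2 ^ r x) * (int (w x) - int (w x')) > (0 :: int)"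
    using \<open>\<not> w x \<le> w x'\<close> assms(5) by (intro mult_pos_pos) (auto simp: power_strict_increasing)
  then have "2 ^ r x * int (w x) + 2 ^ r x' * int (w x') < 2 ^ r x' * int (w x) + 2 ^ r x * int (w x')"
    by (simp add: algebra_simps)
  then have "2 ^ r x * w x + 2 ^ r x' * w x' < 2 ^ r x' * w x + 2 ^ r x * w x'"
    by (metis (mono_tags, lifting) of_nat_add of_nat_less_iff of_nat_mult of_nat_numeral of_nat_power)
  ultimately show False by linarith
qed

text \<open>
  In the incidence matrix of \<open>R\<close> with rows ranked by \<open>r\<close> and columns by \<open>c\<close>, the rows increase
  lexicographically when read from the last column backwards.
\<close>

definition lex_sorted ::
    "('a \<Rightarrow> 'b \<Rightarrow> bool) \<Rightarrow> 'a set \<Rightarrow> 'b set \<Rightarrow> ('a \<Rightarrow> nat) \<Rightarrow> ('b \<Rightarrow> nat) \<Rightarrow> bool" where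
  "lex_sorted R X Y r c \<longleftrightarrow>
     (\<forall>x\<in>X. \<forall>x'\<in>X. \<forall>y\<in>Y. r x < r x' \<longrightarrow> R x y \<longrightarrow> \<not> R x' y \<longrightarrow>
        (\<exists>y'\<in>Y. R x' y' \<and> \<not> R x y' \<and> c y < c y'))"

lemma lex_sortedD:
  "lex_sorted R X Y r c \<Longrightarrow> x \<in> X \<Longrightarrow> x' \<in> X \<Longrightarrow> y \<in> Y \<Longrightarrow> r x < r x' \<Longrightarrow> R x y \<Longrightarrow> \<not> R x' y \<Longrightarrow>
    \<exists>y'\<in>Y. R x' y' \<and> \<not> R x y' \<and> c y < c y'"
  by (simp add: lex_sorted_def)

text \<open>
  Rows and columns can be sorted simultaneously: a pair of rankings that maximizes the sum of
  \<open>2 ^ (r x + c y)\<close> over the incidences is optimal for the rows with weights given by the columns, and vice versa.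
\<close>

lemma doubly_lexical_ranking:
  fixes R :: "'a \<Rightarrow> 'b \<Rightarrow> bool"
  assumes fin: "finite X" "finite Y"
  obtains r c where "inj_on r X" "inj_on c Y"
    "lex_sorted R X Y r c"
    "lex_sorted (\<lambda>y x. R x y) Y X c r"
proof -
  define \<Phi> where "\<Phi> r c = (\<Sum>x\<in>X. 2 ^ r x * (\<Sum>y\<in>{y\<in>Y. R x y}. (2 :: nat) ^ c y))"
    for r :: "'a \<Rightarrow> nat" and c :: "'b \<Rightarrow> nat"
  have \<Phi>_sym: "\<Phi> r c = (\<Sum>y\<in>Y. 2 ^ c y * (\<Sum>x\<in>{x\<in>X. R x y}. 2 ^ r x))" for r c
  proof -
    have "\<Phi> r c = (\<Sum>x\<in>X. \<Sum>y\<in>Y. if R x y then 2 ^ r x * 2 ^ c y else 0)"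
      unfolding \<Phi>_def sum_distrib_left by (intro sum.cong refl sum.inter_filter fin)
    also have "\<dots> = (\<Sum>y\<in>Y. \<Sum>x\<in>X. if R x y then 2 ^ c y * 2 ^ r x else 0)"
      by (subst sum.swap) (simp add: mult.commute cong: if_cong)
    also have "\<dots> = (\<Sum>y\<in>Y. 2 ^ c y * (\<Sum>x\<in>{x\<in>X. R x y}. 2 ^ r x))"
      unfolding sum_distrib_left by (intro sum.cong refl sum.inter_filter[symmetric] fin)
    finally show ?thesis .
  qed
  define P where "P p \<longleftrightarrow> (case p of (r, c) \<Rightarrow> bij_betw r X {..<card X} \<and> bij_betw c Y {..<card Y})"
    for p :: "('a \<Rightarrow> nat) \<times> ('b \<Rightarrow> nat)"
  have ex: "\<exists>p. P p"
    using finite_same_card_bij[OF fin(1), of "{..<card X}"] finite_same_card_bij[OF fin(2), of "{..<card Y}"]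
    by (auto simp: P_def)
  have "\<Phi> (fst p) (snd p) \<le> (\<Sum>x\<in>X. 2 ^ card X * (\<Sum>y\<in>Y. 2 ^ card Y))" if "P p" for p
    unfolding \<Phi>_def
  proof (intro sum_mono mult_mono)
    fix x assume x: "x \<in> X"
    show "2 ^ fst p x \<le> (2 :: nat) ^ card X"
      using that x by (intro power_increasing) (auto simp: P_def bij_betw_def intro: less_imp_le)
    have "(\<Sum>y\<in>{y\<in>Y. R x y}. 2 ^ snd p y) \<le> (\<Sum>y\<in>Y. (2 :: nat) ^ snd p y)"
      using fin by (intro sum_mono2) auto
    also have "\<dots> \<le> (\<Sum>y\<in>Y. 2 ^ card Y)"
      using that by (intro sum_mono power_increasing) (auto simp: P_def bij_betw_def intro: less_imp_le)
    finally show "(\<Sum>y\<in>{y\<in>Y. R x y}. 2 ^ snd p y) \<le> (\<Sum>y\<in>Y. (2 :: nat) ^ card Y)" .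
  qed auto
  then have "\<exists>p. P p \<and> (\<forall>q. P q \<longrightarrow> \<Phi> (fst q) (snd q) \<le> \<Phi> (fst p) (snd p))"
    by (intro ex_has_greatest_nat[where P = P and k = "SOME p. P p" and f = "\<lambda>p. \<Phi> (fst p) (snd p)"
          and b = "Suc (\<Sum>x\<in>X. 2 ^ card X * (\<Sum>y\<in>Y. 2 ^ card Y))"] someI_ex[OF ex])
      (auto intro: le_imp_less_Suc)
  then obtain r c where rc: "P (r, c)" and opt: "\<And>r' c'. P (r', c') \<Longrightarrow> \<Phi> r' c' \<le> \<Phi> r c" by fastforce
  have inj: "inj_on r X" "inj_on c Y" and im: "r ` X = {..<card X}" "c ` Y = {..<card Y}"
    using rc by (auto simp: P_def bij_betw_def)
  have rows: "(\<Sum>y\<in>{y\<in>Y. R x y}. 2 ^ c y) \<le> (\<Sum>y\<in>{y\<in>Y. R x' y}. (2 :: nat) ^ c y)"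
    if "x \<in> X" "x' \<in> X" "r x < r x'" for x x'
  proof (rule optimal_ranking_sorted[OF fin(1) inj(1) that])
    fix r' assume "inj_on r' X" "r' ` X = r ` X"
    then have "P (r', c)" using rc im by (auto simp: P_def bij_betw_def)
    then show "(\<Sum>x\<in>X. 2 ^ r' x * (\<Sum>y\<in>{y\<in>Y. R x y}. (2 :: nat) ^ c y)) \<le> (\<Sum>x\<in>X. 2 ^ r x * (\<Sum>y\<in>{y\<in>Y. R x y}. 2 ^ c y))"
      using opt by (simp add: \<Phi>_def)
  qed
  have cols: "(\<Sum>x\<in>{x\<in>X. R x y}. 2 ^ r x) \<le> (\<Sum>x\<in>{x\<in>X. R x y'}. (2 :: nat) ^ r x)"
    if "y \<in> Y" "y' \<in> Y" "c y < c y'" for y y'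
  proof (rule optimal_ranking_sorted[OF fin(2) inj(2) that])
    fix c' assume "inj_on c' Y" "c' ` Y = c ` Y"
    then have "P (r, c')" using rc im by (auto simp: P_def bij_betw_def)
    then show "(\<Sum>y\<in>Y. 2 ^ c' y * (\<Sum>x\<in>{x\<in>X. R x y}. (2 :: nat) ^ r x)) \<le> (\<Sum>y\<in>Y. 2 ^ c y * (\<Sum>x\<in>{x\<in>X. R x y}. 2 ^ r x))"
      using opt by (simp add: \<Phi>_sym)
  qed
  show ?thesis
  proof (rule that[OF inj]; unfold lex_sorted_def; intro ballI impI)
    fix x x' y assume a: "x \<in> X" "x' \<in> X" "y \<in> Y" "r x < r x'" "R x y" "\<not> R x' y"
    have "\<exists>y'\<in>{y\<in>Y. R x' y} - {y\<in>Y. R x y}. c y < c y'"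
      by (rule larger_element_of_larger_value[OF _ _ _ rows[OF a(1,2,4)]])
        (use fin a inj(2) in \<open>auto intro: inj_on_subset\<close>)
    then show "\<exists>y'\<in>Y. R x' y' \<and> \<not> R x y' \<and> c y < c y'" by auto
  next
    fix y y' x assume a: "y \<in> Y" "y' \<in> Y" "x \<in> X" "c y < c y'" "R x y" "\<not> R x y'"
    have "\<exists>x'\<in>{x\<in>X. R x y'} - {x\<in>X. R x y}. r x < r x'"
      by (rule larger_element_of_larger_value[OF _ _ _ cols[OF a(1,2,4)]])
        (use fin a inj(1) in \<open>auto intro: inj_on_subset\<close>)
    then show "\<exists>x'\<in>X. R x' y' \<and> \<not> R x' y \<and> r x < r x'" by auto
  qed
qed

text \<open>
  A partial zigzag, still open at its far end. The last clause records that each \<open>ys (i + 2)\<close> was chosen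
  with the largest possible rank; this is what excludes chords later. The corresponding conditions
  for \<open>xs\<close> are those of the converse relation.
\<close>

definition zigzag ::
    "('a \<Rightarrow> 'b \<Rightarrow> bool) \<Rightarrow> 'b set \<Rightarrow> ('a \<Rightarrow> nat) \<Rightarrow> ('b \<Rightarrow> nat) \<Rightarrow> nat \<Rightarrow>
     (nat \<Rightarrow> 'a) \<Rightarrow> (nat \<Rightarrow> 'b) \<Rightarrow> bool" where
  "zigzag R Y r c k xs ys \<longleftrightarrow>
     (\<forall>i<k. ys i \<in> Y) \<and>
     (\<forall>i<k. \<forall>j<k. R (xs i) (ys j) \<longleftrightarrow> i = Suc j \<or> j = Suc i \<or> i = 0 \<and> j = 0) \<and>
     (\<forall>i<k. \<forall>j<i. c (ys j) < c (ys i)) \<and>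
     (\<forall>i. Suc (Suc i) < k \<longrightarrow>
        (\<forall>y\<in>Y. R (xs (Suc i)) y \<and> \<not> R (xs i) y \<longrightarrow> c y \<le> c (ys (Suc (Suc i)))))"

lemma zigzag_mem: "zigzag R Y r c k xs ys \<Longrightarrow> i < k \<Longrightarrow> ys i \<in> Y"
  by (rule zigzag_def[THEN iffD1, THEN conjunct1, rule_format])

lemma zigzag_adj: "zigzag R Y r c k xs ys \<Longrightarrow> i < k \<Longrightarrow> j < k \<Longrightarrow>
    R (xs i) (ys j) \<longleftrightarrow> i = Suc j \<or> j = Suc i \<or> i = 0 \<and> j = 0"
  by (rule zigzag_def[THEN iffD1, THEN conjunct2, THEN conjunct1, rule_format])

lemma zigzag_mono: "zigzag R Y r c k xs ys \<Longrightarrow> i < k \<Longrightarrow> j < i \<Longrightarrow> c (ys j) < c (ys i)"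
  by (rule zigzag_def[THEN iffD1, THEN conjunct2, THEN conjunct2, THEN conjunct1, rule_format])

lemma zigzag_max: "zigzag R Y r c k xs ys \<Longrightarrow> Suc (Suc i) < k \<Longrightarrow> y \<in> Y \<Longrightarrow>
    R (xs (Suc i)) y \<Longrightarrow> \<not> R (xs i) y \<Longrightarrow> c y \<le> c (ys (Suc (Suc i)))"
  by (rule zigzag_def[THEN iffD1, THEN conjunct2, THEN conjunct2, THEN conjunct2, rule_format])
    (assumption | rule conjI)+

text \<open>
  The last two rows differ at the column \<open>ys (k + 1)\<close>, so sortedness provides a larger column where they
  differ the other way; take the largest such column \<open>y\<close>. If an earlier row \<open>xs i\<close> had a one in column \<open>y\<close>,
  take the last such row: comparing it with its successor, sortedness yields a column beyond \<open>y\<close> where the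
  successor was free to choose, contradicting the maximality of its choice.
\<close>

lemma zigzag_next:
  fixes R :: "'a \<Rightarrow> 'b \<Rightarrow> bool"
  assumes "finite Y"
    and lex: "lex_sorted R X Y r c"
    and xs: "\<And>i. i < Suc (Suc k) \<Longrightarrow> xs i \<in> X"
    and r: "\<And>i. Suc i < Suc (Suc k) \<Longrightarrow> r (xs i) < (r (xs (Suc i)) :: nat)"
    and z: "zigzag R Y r c (Suc (Suc k)) xs ys"
  obtains y where "y \<in> Y" "\<And>i. i < Suc (Suc k) \<Longrightarrow> R (xs i) y \<longleftrightarrow> i = Suc k"
    "c (ys (Suc k)) < c y" "\<And>y'. y' \<in> Y \<Longrightarrow> R (xs (Suc k)) y' \<Longrightarrow> \<not> R (xs k) y' \<Longrightarrow> c y' \<le> c y"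
proof -
  note adj = zigzag_adj[OF z] and ys = zigzag_mem[OF z] and mono = zigzag_mono[OF z]
    and maximal = zigzag_max[OF z]
  let ?S = "{y \<in> Y. R (xs (Suc k)) y \<and> \<not> R (xs k) y}"
  have "\<exists>y'\<in>Y. R (xs (Suc k)) y' \<and> \<not> R (xs k) y' \<and> c (ys (Suc k)) < c y'"
    using xs r ys adj by (intro lex_sortedD[OF lex]) auto
  then obtain y0 where y0: "y0 \<in> ?S" "c (ys (Suc k)) < c y0" by auto
  have fin_S: "finite (c ` ?S)" using assms(1) by simp
  then have "Max (c ` ?S) \<in> c ` ?S" using y0(1) by (intro Max_in) auto
  then obtain y where y_max: "y \<in> ?S" "Max (c ` ?S) = c y" by (rule imageE) blast
  have y: "y \<in> ?S" "\<And>y'. y' \<in> ?S \<Longrightarrow> c y' \<le> c y"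
    using y_max(1) Max_ge[OF fin_S] unfolding y_max(2) by blast+
  have gt: "c (ys (Suc k)) < c y" using y0 y(2)[OF y0(1)] by linarith
  have none: "\<not> R (xs (k - d)) y" if "d \<le> k" for d
    using that
  proof (induction d)
    case 0
    then show ?case using y(1) by simp
  next
    case (Suc d)
    define i where "i = k - Suc d"
    have i: "k - d = Suc i" "Suc (Suc i) < Suc (Suc k)" using Suc.prems by (auto simp: i_def)
    show ?case
    proof
      assume "R (xs (k - Suc d)) y"
      then have "\<exists>y'\<in>Y. R (xs (Suc i)) y' \<and> \<not> R (xs i) y' \<and> c y < c y'"
        using xs r i Suc y(1) by (intro lex_sortedD[OF lex]) (auto simp flip: i_def)
      then obtain y' where "y' \<in> Y" "R (xs (Suc i)) y'" "\<not> R (xs i) y'" "c y < c y'" by blast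
      moreover have "c (ys (Suc (Suc i))) \<le> c (ys (Suc k))"
        using mono[of "Suc k" "Suc (Suc i)"] i(2) by (cases "Suc i = k") auto
      ultimately show False using maximal[OF i(2)] gt by fastforce
    qed
  qed
  show ?thesis
  proof (rule that[of y])
    fix i assume i: "i < Suc (Suc k)"
    show "R (xs i) y \<longleftrightarrow> i = Suc k"
      using none[of "k - i"] i y(1) by (cases "i = Suc k") auto
  qed (use y gt in auto)
qed

lemma zigzag_extend:
  assumes z: "zigzag R Y r c (Suc (Suc k)) xs ys"
    and y: "y \<in> Y" "\<And>i. i < Suc (Suc k) \<Longrightarrow> R (xs i) y \<longleftrightarrow> i = Suc k" "c (ys (Suc k)) < c y"
      "\<And>y'. y' \<in> Y \<Longrightarrow> R (xs (Suc k)) y' \<Longrightarrow> \<not> R (xs k) y' \<Longrightarrow> c y' \<le> c y"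
    and x: "\<And>i. i < Suc (Suc k) \<Longrightarrow> R x (ys i) \<longleftrightarrow> i = Suc k" "\<not> R x y"
  shows "zigzag R Y r c (Suc (Suc (Suc k))) (xs(Suc (Suc k) := x)) (ys(Suc (Suc k) := y))"
proof -
  let ?n = "Suc (Suc k)"
  note adj = zigzag_adj[OF z] and ys = zigzag_mem[OF z] and mono = zigzag_mono[OF z]
    and maximal = zigzag_max[OF z]
  have lt: "c (ys j) < c y" if "j < ?n" for j
    using mono[of "Suc k" j] y(3) that by (cases "j = Suc k") auto
  show ?thesis
    unfolding zigzag_def
  proof (intro conjI allI impI ballI)
    fix i j assume "i < Suc ?n" "j < Suc ?n"
    then consider "i < ?n" "j < ?n" | "i = ?n" "j < ?n" | "i < ?n" "j = ?n" | "i = ?n" "j = ?n"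
      unfolding less_Suc_eq[of _ ?n] by blast
    then show "R ((xs(?n := x)) i) ((ys(?n := y)) j) \<longleftrightarrow> i = Suc j \<or> j = Suc i \<or> i = 0 \<and> j = 0"
      by cases (use adj y x in auto)
  next
    fix i y' assume i: "Suc (Suc i) < Suc ?n" "y' \<in> Y"
      "R ((xs(?n := x)) (Suc i)) y' \<and> \<not> R ((xs(?n := x)) i) y'"
    show "c y' \<le> c ((ys(?n := y)) (Suc (Suc i)))"
      using i maximal[of i y'] y(4)[of y'] by (cases "i = k") auto
  qed (use ys y(1) mono lt in auto)
qed

text \<open>
  In a doubly lexically sorted matrix, two rows and two columns that meet in ones except for the last
  entry start a zigzag. As long as its two new ends are not related it can be extended on both
  sides, and the ranks grow; since the matrix is finite, the ends eventually meet in a cycle.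
\<close>

lemma Gamma_free_or_long_cycle:
  fixes R :: "'a \<Rightarrow> 'b \<Rightarrow> bool" and r :: "'a \<Rightarrow> nat" and c :: "'b \<Rightarrow> nat"
  assumes fin: "finite X" "finite Y"
    and rows: "lex_sorted R X Y r c"
    and cols: "lex_sorted (\<lambda>y x. R x y) Y X c r"
    and no_cycle: "\<not> long_cycle R X Y"
    and in_X: "x \<in> X" "x' \<in> X" "r x < r x'" and in_Y: "y \<in> Y" "y' \<in> Y" "c y < c y'"
    and R: "R x y" "R x y'" "R x' y"
  shows "R x' y'"
proof (rule ccontr)
  assume nR: "\<not> R x' y'"
  define Z where "Z k xs ys \<longleftrightarrow> zigzag R Y r c k xs ys \<and> zigzag (\<lambda>y x. R x y) X c r k ys xs"
    for k xs ys
  have ex: "\<exists>xs ys. Z (Suc (Suc k)) xs ys" for k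
  proof (induction k)
    case 0
    have two: "i < Suc (Suc 0) \<longleftrightarrow> i = 0 \<or> i = Suc 0" for i by auto
    show ?case
      using in_X in_Y R nR by (intro exI[of _ "\<lambda>i. if i = 0 then x else x'"] exI[of _ "\<lambda>i. if i = 0 then y else y'"])
        (auto simp: Z_def zigzag_def two)
  next
    case (Suc k)
    then obtain xs ys where Z: "zigzag R Y r c (Suc (Suc k)) xs ys"
        "zigzag (\<lambda>y x. R x y) X c r (Suc (Suc k)) ys xs" by (auto simp: Z_def)
    have xs: "xs i \<in> X" "ys i \<in> Y" if "i < Suc (Suc k)" for i
      using Z that by (auto intro: zigzag_mem)
    have mono: "r (xs i) < r (xs j)" "c (ys i) < c (ys j)" if "j < Suc (Suc k)" "i < j" for i j
      using Z that by (auto intro: zigzag_mono)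
    obtain y where y: "y \<in> Y" "\<And>i. i < Suc (Suc k) \<Longrightarrow> R (xs i) y \<longleftrightarrow> i = Suc k" "c (ys (Suc k)) < c y"
        "\<And>y'. y' \<in> Y \<Longrightarrow> R (xs (Suc k)) y' \<Longrightarrow> \<not> R (xs k) y' \<Longrightarrow> c y' \<le> c y"
      by (rule zigzag_next[where X = X and r = r, OF fin(2) rows _ _ Z(1)]) (use xs mono in auto)
    obtain x where x: "x \<in> X" "\<And>i. i < Suc (Suc k) \<Longrightarrow> R x (ys i) \<longleftrightarrow> i = Suc k" "r (xs (Suc k)) < r x"
        "\<And>x'. x' \<in> X \<Longrightarrow> R x' (ys (Suc k)) \<Longrightarrow> \<not> R x' (ys k) \<Longrightarrow> r x' \<le> r x"
      by (rule zigzag_next[where X = Y and r = c, OF fin(1) cols _ _ Z(2)]) (use xs mono in auto)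
    let ?n = "Suc (Suc k)"
    let ?xs = "xs(?n := x)" and ?ys = "ys(?n := y)"
    have "\<not> R x y"
    proof
      assume "R x y"
      have lt: "r (xs i) < r x" "c (ys i) < c y" if "i < ?n" for i
        using that mono[of "Suc k" i] x(3) y(3) by (cases "i = Suc k"; simp)+
      (* If the new ends are related, the zigzag closes up to a cycle. *)
      have inj_x: "inj_on ?xs {..<Suc ?n}"
      proof (rule linorder_inj_onI')
        fix i j assume "i \<in> {..<Suc ?n}" "j \<in> {..<Suc ?n}" "i < j"
        then have "r (?xs i) < r (?xs j)" using lt(1)[of i] mono(1)[of j i] by auto
        then show "?xs i \<noteq> ?xs j" by auto
      qed
      have inj_y: "inj_on ?ys {..<Suc ?n}"
      proof (rule linorder_inj_onI')
        fix i j assume "i \<in> {..<Suc ?n}" "j \<in> {..<Suc ?n}" "i < j"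
        then have "c (?ys i) < c (?ys j)" using lt(2)[of i] mono(2)[of j i] by auto
        then show "?ys i \<noteq> ?ys j" by auto
      qed
      have adj: "R (?xs i) (?ys j) \<longleftrightarrow> i = Suc j \<or> j = Suc i \<or> i = j \<and> (i = 0 \<or> Suc i = Suc ?n)"
        if ij: "i < Suc ?n" "j < Suc ?n" for i j
      proof -
        consider "i < ?n" "j < ?n" | "i = ?n" "j < ?n" | "i < ?n" "j = ?n" | "i = ?n" "j = ?n"
          using ij unfolding less_Suc_eq[of _ ?n] by blast
        then show ?thesis
        proof cases
          case 1
          then have "R (xs i) (ys j) \<longleftrightarrow> i = Suc j \<or> j = Suc i \<or> i = 0 \<and> j = 0"
            by (rule zigzag_adj[OF Z(1)])
          then show ?thesis using 1 by auto
        qed (use x(2) y(2) \<open>R x y\<close> in auto)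
      qed
      have "closed_zigzag R (Suc ?n) ?xs ?ys"
        unfolding closed_zigzag_def using inj_x inj_y adj by simp
      moreover have "?xs ` {..<Suc ?n} \<subseteq> X" "?ys ` {..<Suc ?n} \<subseteq> Y"
        using xs x(1) y(1) by (auto simp: less_Suc_eq)
      ultimately show False using no_cycle unfolding long_cycle_def by blast
    qed
    then have "Z (Suc ?n) ?xs ?ys"
      unfolding Z_def using zigzag_extend[OF Z(1) y x(2)] zigzag_extend[OF Z(2) x y(2)] by blast
    then show ?case by blast
  qed
  then obtain xs ys where Z: "Z (Suc (Suc (card X))) xs ys" by blast
  have xs: "xs i \<in> X" if "i < Suc (Suc (card X))" for i
    using Z that by (auto simp: Z_def intro: zigzag_mem)
  have "inj_on xs {..<Suc (Suc (card X))}"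
  proof (rule linorder_inj_onI')
    fix i j assume "i \<in> {..<Suc (Suc (card X))}" "j \<in> {..<Suc (Suc (card X))}" "i < j"
    then have "r (xs i) < r (xs j)" using Z by (auto simp: Z_def intro: zigzag_mono)
    then show "xs i \<noteq> xs j" by auto
  qed
  then have "card {..<Suc (Suc (card X))} \<le> card X" using xs fin(1) by (intro card_inj_on_le) auto
  then show False by simp
qed

text \<open>
  The first row of a doubly lexical ranking is simple: by the preceding lemma, the columns that have
  a one in this row are nested in the order of their ranks.
\<close>

theorem simple_vertex_exists:
  fixes R :: "'a \<Rightarrow> 'b \<Rightarrow> bool"
  assumes fin: "finite X" "finite Y" and "X \<noteq> {}" and no_cycle: "\<not> long_cycle R X Y"
  obtains x where "x \<in> X"
    "\<And>y y'. y \<in> Y \<Longrightarrow> y' \<in> Y \<Longrightarrow> R x y \<Longrightarrow> R x y' \<Longrightarrow>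
      (\<forall>x'\<in>X. R x' y \<longrightarrow> R x' y') \<or> (\<forall>x'\<in>X. R x' y' \<longrightarrow> R x' y)"
proof -
  obtain r c where inj: "inj_on r X" "inj_on c Y"
    and rows: "lex_sorted R X Y r c"
    and cols: "lex_sorted (\<lambda>y x. R x y) Y X c r"
    by (rule doubly_lexical_ranking[where R = R, OF fin]) (rule that; assumption)
  obtain x where x: "x \<in> X" "\<And>x'. x' \<in> X \<Longrightarrow> r x \<le> r x'"
    using arg_min_if_finite(1)[OF fin(1) assms(3), of r] arg_min_least[OF fin(1) assms(3), of _ r]
    by blast
  have chain: "R x' y'" if "y \<in> Y" "y' \<in> Y" "R x y" "R x y'" "c y < c y'" "x' \<in> X" "R x' y" for x' y y'
  proof (cases "x' = x")
    case False
    then have "r x < r x'" using x that(6) inj(1) by (metis inj_onD le_neq_implies_less)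
    then show ?thesis
      using Gamma_free_or_long_cycle[OF fin rows cols no_cycle, of x x' y y'] x that by blast
  qed (use that in simp)
  show ?thesis
  proof (rule that[OF x(1)])
    fix y y' assume y: "y \<in> Y" "y' \<in> Y" "R x y" "R x y'"
    consider "c y < c y'" | "c y' < c y" | "y = y'" using inj(2) y by (metis inj_onD linorder_neqE_nat)
    then show "(\<forall>x'\<in>X. R x' y \<longrightarrow> R x' y') \<or> (\<forall>x'\<in>X. R x' y' \<longrightarrow> R x' y)"
      by cases (use chain y in blast)+
  qed
qed

section \<open>Edge ideals of bipartite graphs with loops\<close>

text \<open>
  The monomial \<open>x\<^sub>u x\<^sub>v\<close> divides \<open>x\<^sup>m\<close>; a loop needs exponent \<open>2\<close>.
\<close>

definition fits :: "'v \<Rightarrow> 'v \<Rightarrow> ('v \<Rightarrow> nat) \<Rightarrow> bool" where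
  "fits u v m \<longleftrightarrow> (if u = v then 2 \<le> m u else 1 \<le> m u \<and> 1 \<le> m v)"

definition edge_ideal :: "('v \<Rightarrow> 'v \<Rightarrow> bool) \<Rightarrow> ('v \<Rightarrow> nat) \<Rightarrow> bool" where
  "edge_ideal E m \<longleftrightarrow> (\<exists>u v. E u v \<and> fits u v m)"

text \<open>
  Total disjointness of the edges \<open>{u, u'}\<close> and \<open>{w, w'}\<close> in terms of the adjacency relation, which
  includes the loops.
\<close>

definition separated :: "('v \<Rightarrow> 'v \<Rightarrow> bool) \<Rightarrow> 'v \<Rightarrow> 'v \<Rightarrow> 'v \<Rightarrow> 'v \<Rightarrow> bool" where
  "separated E u u' w w' \<longleftrightarrow> \<not> E u w \<and> \<not> E u w' \<and> \<not> E u' w \<and> \<not> E u' w'"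

definition clear_star :: "('v \<Rightarrow> 'v \<Rightarrow> bool) \<Rightarrow> 'v \<Rightarrow> ('v \<Rightarrow> nat) \<Rightarrow> 'v \<Rightarrow> nat" where
  "clear_star E v m = (\<lambda>w. if w = v \<or> E v w then 0 else m w)"

lemma fits_mono: "fits u v m \<Longrightarrow> (\<And>w. m w \<le> n w) \<Longrightarrow> fits u v n"
  unfolding fits_def by (metis le_trans)

lemma fits_commute: "fits u v m \<longleftrightarrow> fits v u m"
  by (auto simp: fits_def)

lemma up_closed_edge_ideal: "up_closed (edge_ideal E)"
  unfolding up_closed_def edge_ideal_def le_fun_def using fits_mono by metis

lemma colon_edge_ideal:
  assumes "symp E"
  shows "colon (edge_ideal E) v m \<longleftrightarrow> (\<exists>w. E v w \<and> 1 \<le> m w) \<or> edge_ideal E m"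
proof
  assume "colon (edge_ideal E) v m"
  then obtain a b where ab: "E a b" "fits a b (m(v := Suc (m v)))"
    by (auto simp: colon_def edge_ideal_def)
  then show "(\<exists>w. E v w \<and> 1 \<le> m w) \<or> edge_ideal E m"
    using sympD[OF assms ab(1)] unfolding edge_ideal_def fits_def
    by (cases "a = v"; cases "b = v") (auto split: if_splits)
next
  assume "(\<exists>w. E v w \<and> 1 \<le> m w) \<or> edge_ideal E m"
  then show "colon (edge_ideal E) v m"
  proof
    assume "edge_ideal E m"
    then show ?thesis
      using up_closedD[OF up_closed_edge_ideal, of E m "m(v := Suc (m v))"] by (simp add: colon_def)
  next
    assume "\<exists>w. E v w \<and> 1 \<le> m w"
    then obtain w where "E v w" "1 \<le> m w" by blast
    then show ?thesis unfolding colon_def edge_ideal_def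
      by (intro exI[of _ v] exI[of _ w]) (auto simp: fits_def)
  qed
qed

context vertex_order
begin

text \<open>
  The colon ideal is generated by the neighbours of \<open>v\<close> and the edge ideal. Once the variables in it are
  eliminated, only edges away from \<open>v\<close> and its neighbours remain.
\<close>

lemma reg_bound_colon:
  assumes "symp E" "c \<ge> 1" "reg_bound TYPE('k::field) (edge_ideal E) (clear_star E v m) c"
  shows "reg_bound TYPE('k) (colon (edge_ideal E) v) (m(v := 0)) c"
proof (rule reg_bound_variables[where L = "{w. E v w}"])
  show "up_closed (colon (edge_ideal E) v)" by (intro up_closed_colon up_closed_edge_ideal)
next
  fix w and n :: "'v \<Rightarrow> nat" assume "w \<in> {w. E v w}" "1 \<le> n w"
  then show "colon (edge_ideal E) v n" by (auto simp: colon_edge_ideal[OF assms(1)])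
next
  have m': "(\<lambda>w. if w \<in> {w. E v w} then 0 else (m(v := 0)) w) = clear_star E v m"
    by (auto simp: clear_star_def)
  have "colon (edge_ideal E) v (lower (clear_star E v m) T) = edge_ideal E (lower (clear_star E v m) T)" for T
    by (auto simp: colon_edge_ideal[OF assms(1)] lower_def clear_star_def)
  then have "upper_koszul (colon (edge_ideal E) v) (clear_star E v m) = upper_koszul (edge_ideal E) (clear_star E v m)"
    by (simp add: upper_koszul_def)
  then show "reg_bound TYPE('k) (colon (edge_ideal E) v) (\<lambda>w. if w \<in> {w. E v w} then 0 else (m(v := 0)) w) c"
    using assms(3) unfolding m' by (simp add: reg_bound_def)
qed (rule assms(2))

lemma reg_bound_vertex:
  assumes "symp E" "c \<ge> 1" "m v = 1"
    and "reg_bound TYPE('k::field) (edge_ideal E) (m(v := 0)) (Suc c)"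
    and "reg_bound TYPE('k) (edge_ideal E) (clear_star E v m) c"
  shows "reg_bound TYPE('k) (edge_ideal E) m (Suc c)"
  by (rule reg_bound_step[where v = v, OF up_closed_edge_ideal assms(3,4)])
    (rule reg_bound_colon[OF assms(1,2,5)])

text \<open>
  An exponent that exceeds what the edges at \<open>v\<close> can use makes the complex a cone with apex \<open>v\<close>. The only
  other exponent greater than \<open>1\<close> is \<open>2\<close> at a loop.
\<close>

lemma reg_bound_not_squarefree:
  assumes "symp E" "c \<ge> 1" "m v \<ge> 2"
    and "m v = 2 \<Longrightarrow> E v v \<Longrightarrow> reg_bound TYPE('k::field) (edge_ideal E) (clear_star E v m) c"
  shows "reg_bound TYPE('k) (edge_ideal E) m (Suc c)"
proof (cases "m v = 2 \<and> E v v")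
  case True
  show ?thesis
  proof (rule reg_bound_square[where v = v, OF up_closed_edge_ideal _ _ assms(2)])
    show "edge_ideal E n" if "2 \<le> n v" for n
      unfolding edge_ideal_def by (intro exI[of _ v]) (use True that in \<open>simp add: fits_def\<close>)
    show "reg_bound TYPE('k) (colon (edge_ideal E) v) (m(v := 0)) c"
      using True assms(4) by (intro reg_bound_colon[OF assms(1,2)]) auto
  qed (use True in simp)
next
  case False
  have "edge_ideal E (lower m (insert v T))" if T: "v \<notin> T" "edge_ideal E (lower m T)" for T
  proof -
    obtain a b where ab: "E a b" "fits a b (lower m T)" using T(2) by (auto simp: edge_ideal_def)
    have "lower m (insert v T) w = lower m T w" if "w \<noteq> v" for w
      using that by (simp add: lower_def)
    moreover have "lower m (insert v T) v = m v - 1" by (simp add: lower_def)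
    ultimately have "fits a b (lower m (insert v T))"
      using ab assms(3) False by (cases "a = v"; cases "b = v") (auto simp: fits_def)
    then show ?thesis using ab(1) by (auto simp: edge_ideal_def)
  qed
  then show ?thesis using assms(3) by (intro reg_bound_cone[of v]) auto
qed

lemma fits_clear_star: "fits a b (clear_star E v m) \<Longrightarrow> \<not> E v a \<and> \<not> E v b \<and> a \<noteq> v \<and> b \<noteq> v \<and> fits a b m"
  by (auto simp: fits_def clear_star_def split: if_splits)

lemma sum_zero_at_less: "(m v :: nat) \<noteq> 0 \<Longrightarrow> sum (m(v := 0)) UNIV < sum m (UNIV :: 'v set)"
proof -
  assume "m v \<noteq> 0"
  then have "0 < m v" by simp
  then show ?thesis using sum_zero_at[of m v] by linarith
qed

text \<open>
  Let \<open>x\<close> have a largest neighbourhood. An edge \<open>u u'\<close> away from \<open>x\<close> and its neighbours, with \<open>u\<close> on the side of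
  \<open>x\<close>, has \<open>u'\<close> in the neighbourhood of \<open>u\<close> but not of \<open>x\<close>; hence some neighbour \<open>y\<close> of \<open>x\<close> is not adjacent to \<open>u\<close>,
  and \<open>x y\<close> is totally disjoint from \<open>u u'\<close>. So the colon ideal at \<open>x\<close> is generated by variables.
\<close>

theorem reg_bound_two:
  assumes sym: "symp E" and bip: "\<And>u v. E u v \<Longrightarrow> u \<noteq> v \<Longrightarrow> u \<in> X \<longleftrightarrow> v \<notin> X"
    and two: "\<And>u u' w w'. E u u' \<Longrightarrow> fits u u' m \<Longrightarrow> E w w' \<Longrightarrow> fits w w' m \<Longrightarrow> \<not> separated E u u' w w'"
  shows "reg_bound TYPE('k::field) (edge_ideal E) m 2"
  using two
proof (induction "sum m UNIV" arbitrary: m rule: less_induct)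
  case less
  have star: "reg_bound TYPE('k) (edge_ideal E) (clear_star E v m) 1" if "\<not> edge_ideal E (clear_star E v m)" for v
    using that by (intro reg_bound_trivial up_closed_edge_ideal)
  have "reg_bound TYPE('k) (edge_ideal E) m (Suc 1)"
  proof (cases "\<exists>v. m v \<ge> 2")
    case True
    then obtain v where v: "m v \<ge> 2" by blast
    show ?thesis
    proof (rule reg_bound_not_squarefree[where v = v and m = m, OF sym _ v])
      assume "m v = 2" "E v v"
      then show "reg_bound TYPE('k) (edge_ideal E) (clear_star E v m) 1"
        using less.prems[of v v] by (intro star) (fastforce simp: edge_ideal_def separated_def fits_def[of v v] dest: fits_clear_star)
    qed simp
  next
    case False
    then have m1: "m v \<le> 1" for v by (metis not_less_eq_eq numeral_2_eq_2 One_nat_def)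
    show ?thesis
    proof (cases "edge_ideal E m")
      case False
      then show ?thesis by (intro reg_bound_trivial up_closed_edge_ideal)
    next
      case True
      let ?S = "{x \<in> X. m x \<noteq> 0}"
      define N where "N x = {y. m y \<noteq> 0 \<and> E x y \<and> x \<noteq> y}" for x
      obtain a b where "E a b" "fits a b m" using True by (auto simp: edge_ideal_def)
      then have "?S \<noteq> {}" using bip[of a b] m1[of a] by (auto simp: fits_def split: if_splits)
      have "Max ((\<lambda>x. card (N x)) ` ?S) \<in> (\<lambda>x. card (N x)) ` ?S" using \<open>?S \<noteq> {}\<close> by (intro Max_in) auto
      then obtain x where x_max: "x \<in> ?S" "Max ((\<lambda>x. card (N x)) ` ?S) = card (N x)" by (rule imageE) blast
      have "card (N u) \<le> card (N x)" if "u \<in> ?S" for u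
        using Max_ge[of "(\<lambda>x. card (N x)) ` ?S" "card (N u)"] that unfolding x_max(2) by simp
      note x = x_max(1) this
      have "m x = 1" using x(1) m1[of x] by auto
      have key: False if "E u u'" "fits u u' (clear_star E x m)" "u \<in> X" "u \<noteq> u'" for u u'
      proof -
        have f: "\<not> E x u" "\<not> E x u'" "u \<noteq> x" "u' \<noteq> x" "fits u u' m" using fits_clear_star[OF that(2)] by auto
        have mu: "m u \<noteq> 0" "m u' \<noteq> 0" using f(5) that(4) by (auto simp: fits_def)
        have "u' \<in> N u - N x" using that(1,4) f mu by (auto simp: N_def)
        moreover have "card (N u) \<le> card (N x)" using x(2)[of u] that(3) mu by simp
        ultimately have "\<not> N x \<subseteq> N u" by (metis DiffE card_seteq finite subset_iff)
        then obtain y where y: "m y \<noteq> 0" "E x y" "x \<noteq> y" "y \<notin> N u" by (auto simp: N_def)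
        have "y \<notin> X" "u' \<notin> X" using bip[OF y(2,3)] bip[OF that(1,4)] x(1) that(3) by auto
        then have "\<not> E y u'" "\<not> E u y" using bip[of y u'] y f that(3) by (auto simp: N_def)
        then have "separated E x y u u'"
          using f y sympD[OF sym, of y u] by (auto simp: separated_def)
        moreover have "fits x y m" using y x(1) by (auto simp: fits_def)
        ultimately show False using less.prems[OF y(2) _ that(1) f(5)] by simp
      qed
      have "\<not> edge_ideal E (clear_star E x m)"
      proof
        assume "edge_ideal E (clear_star E x m)"
        then obtain u u' where u: "E u u'" "fits u u' (clear_star E x m)" by (auto simp: edge_ideal_def)
        have "u \<noteq> u'"
          using fits_clear_star[OF u(2)] m1[of u] by (auto simp: fits_def split: if_splits)
        moreover have "E u' u" "fits u' u (clear_star E x m)"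
          using sympD[OF sym u(1)] u(2) by (simp_all add: fits_commute)
        ultimately show False using key[OF u] key[of u' u] bip[OF u(1)] by blast
      qed
      moreover have "reg_bound TYPE('k) (edge_ideal E) (m(x := 0)) 2"
      proof (rule less.hyps)
        show "sum (m(x := 0)) UNIV < sum m UNIV" using x(1) by (intro sum_zero_at_less) simp
        show "\<not> separated E u u' w w'"
          if "E u u'" "fits u u' (m(x := 0))" "E w w'" "fits w w' (m(x := 0))" for u u' w w'
          using less.prems[OF that(1) _ that(3)] fits_mono[OF that(2)] fits_mono[OF that(4)] by simp
      qed
      ultimately show ?thesis
        using star reg_bound_vertex[where 'k = 'k and v = x and m = m and c = 1, OF sym _ \<open>m x = 1\<close>] by (simp add: numeral_2_eq_2)
    qed
  qed
  then show ?case by (simp add: numeral_2_eq_2)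
qed

text \<open>
  For a loop, since three pairwise totally disjoint edges are excluded, and for a simple vertex \<open>x\<close> of the bipartite complement, the edges away from the
  neighbourhood have no totally disjoint pair: two such edges \<open>u u'\<close> and \<open>w w'\<close> with \<open>u, w\<close> on the side of \<open>x\<close>
  would make the neighbourhoods of \<open>u'\<close> and \<open>w'\<close> in the bipartite complement incomparable. So the colon
  ideal has regularity at most \<open>2\<close>.
\<close>

theorem reg_bound_three:
  assumes sym: "symp E" and bip: "\<And>u v. E u v \<Longrightarrow> u \<noteq> v \<Longrightarrow> u \<in> X \<longleftrightarrow> v \<notin> X"
    and three: "\<And>a a' b b' c c'. E a a' \<Longrightarrow> E b b' \<Longrightarrow> E c c' \<Longrightarrow>
      separated E a a' b b' \<Longrightarrow> separated E a a' c c' \<Longrightarrow> separated E b b' c c' \<Longrightarrow> False"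
    and no_cycle: "\<not> long_cycle (\<lambda>x y. \<not> E x y) X (- X)"
  shows "reg_bound TYPE('k::field) (edge_ideal E) m 3"
proof (induction "sum m UNIV" arbitrary: m rule: less_induct)
  case less
  have star: "reg_bound TYPE('k) (edge_ideal E) (clear_star E v m) 2"
    if "\<And>u u' w w'. E u u' \<Longrightarrow> fits u u' (clear_star E v m) \<Longrightarrow> E w w' \<Longrightarrow>
      fits w w' (clear_star E v m) \<Longrightarrow> \<not> separated E u u' w w'" for v
    by (rule reg_bound_two[where X = X, OF sym bip that])
  have "reg_bound TYPE('k) (edge_ideal E) m (Suc 2)"
  proof (cases "\<exists>v. m v \<ge> 2")
    case True
    then obtain v where v: "m v \<ge> 2" by blast
    show ?thesis
    proof (rule reg_bound_not_squarefree[where v = v and m = m, OF sym _ v])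
      assume "m v = 2" "E v v"
      show "reg_bound TYPE('k) (edge_ideal E) (clear_star E v m) 2"
      proof (rule star)
        fix u u' w w' assume a: "E u u'" "fits u u' (clear_star E v m)" "E w w'" "fits w w' (clear_star E v m)"
        then show "\<not> separated E u u' w w'"
          using three[OF \<open>E v v\<close> a(1) a(3)] fits_clear_star by (metis separated_def)
      qed
    qed simp
  next
    case False
    then have m1: "m v \<le> 1" for v by (metis not_less_eq_eq numeral_2_eq_2 One_nat_def)
    let ?S = "{x \<in> X. m x \<noteq> 0}" and ?T = "{y \<in> - X. m y \<noteq> 0}"
    show ?thesis
    proof (cases "?S = {}")
      case True
      have "\<not> edge_ideal E m"
      proof
        assume "edge_ideal E m"
        then obtain a b where "E a b" "fits a b m" by (auto simp: edge_ideal_def)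
        then show False using True bip[of a b] m1[of a] by (auto simp: fits_def split: if_splits)
      qed
      then show ?thesis by (intro reg_bound_trivial up_closed_edge_ideal)
    next
      case False
      have "\<not> long_cycle (\<lambda>x y. \<not> E x y) ?S ?T"
        using no_cycle long_cycle_mono[of _ ?S ?T X "- X"] by blast
      then obtain x where x: "x \<in> ?S"
        "\<And>y y'. y \<in> ?T \<Longrightarrow> y' \<in> ?T \<Longrightarrow> \<not> E x y \<Longrightarrow> \<not> E x y' \<Longrightarrow>
          (\<forall>x'\<in>?S. \<not> E x' y \<longrightarrow> \<not> E x' y') \<or> (\<forall>x'\<in>?S. \<not> E x' y' \<longrightarrow> \<not> E x' y)"
        using simple_vertex_exists[of ?S ?T "\<lambda>x y. \<not> E x y", OF finite finite False] by blast
      have "m x = 1" using x(1) m1[of x] by auto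
      have key: False if "E u u'" "fits u u' (clear_star E x m)" "u \<in> X"
        "E w w'" "fits w w' (clear_star E x m)" "w \<in> X" "separated E u u' w w'" for u u' w w'
      proof -
        have f: "\<not> E x u'" "fits u u' m" "\<not> E x w'" "fits w w' m"
          using fits_clear_star[OF that(2)] fits_clear_star[OF that(5)] by auto
        have ne: "u \<noteq> u'" "w \<noteq> w'"
          using f m1[of u] m1[of w] by (auto simp: fits_def split: if_splits)
        have "u \<in> ?S" "w \<in> ?S" "u' \<in> ?T" "w' \<in> ?T"
          using f ne that(3,6) bip[OF that(1)] bip[OF that(4)] by (auto simp: fits_def)
        then show False
          using x(2)[of u' w'] f that(1,4,7) sympD[OF sym] unfolding separated_def by blast
      qed
      have "reg_bound TYPE('k) (edge_ideal E) (clear_star E x m) 2"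
      proof (rule star)
        fix u u' w w'
        assume a: "E u u'" "fits u u' (clear_star E x m)" "E w w'" "fits w w' (clear_star E x m)"
        have ne: "u \<noteq> u'" "w \<noteq> w'"
          using fits_clear_star[OF a(2)] fits_clear_star[OF a(4)] m1[of u] m1[of w]
          by (auto simp: fits_def split: if_splits)
        have a': "E u' u" "fits u' u (clear_star E x m)" "E w' w" "fits w' w (clear_star E x m)"
          using a sympD[OF sym] fits_commute by metis+
        have in_X: "u \<in> X \<or> u' \<in> X" "w \<in> X \<or> w' \<in> X" using bip a(1,3) ne by blast+
        show "\<not> separated E u u' w w'"
        proof
          assume s: "separated E u u' w w'"
          then have "separated E u' u w w'" "separated E u u' w' w" "separated E u' u w' w"
            by (auto simp: separated_def)
          with in_X s show False
            using key[OF a(1,2) _ a(3,4)] key[OF a'(1,2) _ a(3,4)] key[OF a(1,2) _ a'(3,4)]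
              key[OF a'(1,2) _ a'(3,4)] by blast
        qed
      qed
      moreover have "reg_bound TYPE('k) (edge_ideal E) (m(x := 0)) 3"
        using x(1) by (intro less.hyps sum_zero_at_less) simp
      ultimately show ?thesis
        using reg_bound_vertex[where 'k = 'k and v = x and m = m and c = 2, OF sym _ \<open>m x = 1\<close>] by (simp add: eval_nat_numeral)
    qed
  qed
  then show ?case by (simp add: eval_nat_numeral)
qed

end

section \<open>Nonvanishing homology\<close>

lemma exists_order_refining:
  fixes h :: "'v::finite \<Rightarrow> nat"
  obtains ord where "vertex_order ord" "\<And>u v. h u < h v \<Longrightarrow> ord u < ord v"
proof -
  obtain f :: "'v \<Rightarrow> nat" and n where f: "f ` UNIV = {i. i < n}" "inj_on f UNIV"
    using finite_imp_inj_to_nat_seg[of "UNIV :: 'v set"] by auto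
  have lt: "f v < n" for v using f(1) by auto
  define ord where "ord v = h v * n + f v" for v
  have ord: "ord u < ord v" if "h u < h v" for u v
  proof -
    have "h u * n + n \<le> h v * n" using that by (metis Suc_leI add.commute mult_Suc mult_le_mono1)
    then show ?thesis using lt[of u] by (simp add: ord_def)
  qed
  have "inj ord"
  proof (rule injI)
    fix u v assume eq: "ord u = ord v"
    then have "h u = h v" using ord[of u v] ord[of v u] by (metis less_irrefl linorder_neqE_nat)
    then show "u = v" using eq f(2) by (simp add: ord_def inj_on_eq_iff)
  qed
  then show ?thesis using that ord by (simp add: vertex_order_def)
qed

context vertex_order
begin

definition coboundary :: "('v set \<Rightarrow> 'k::field) \<Rightarrow> 'v set \<Rightarrow> 'k" where
  "coboundary \<phi> T = (\<Sum>v\<in>T. signed v T (\<phi> (T - {v})))"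

lemma signed_self: "signed v (insert v T) b = signed v T b"
proof -
  have "{u \<in> insert v T. ord u < ord v} = {u \<in> T. ord u < ord v}" by auto
  then show ?thesis by (simp only: signed_def)
qed

lemma signed_count: "{u \<in> T. ord u < ord v} = S \<Longrightarrow> signed v T b = (if even (card S) then b else - b)"
  by (simp only: signed_def)

lemma signed_mult: "signed v T (a * b) = a * signed v T (b :: 'k::field)"
  "signed v T (a * b) = signed v T a * (b :: 'k::field)"
  by (auto simp: signed_def)

text \<open>
  The coboundary is adjoint to the boundary.
\<close>

lemma sum_kdiff_coboundary:
  fixes h :: "'v set \<Rightarrow> 'k::field"
  shows "(\<Sum>T\<in>UNIV. \<phi> T * boundary h T) = (\<Sum>S\<in>UNIV. h S * coboundary \<phi> S)"
proof -
  have "(\<Sum>T\<in>UNIV. \<phi> T * boundary h T) =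
      (\<Sum>(T, v)\<in>Sigma UNIV (\<lambda>T. - T). \<phi> T * signed v T (h (insert v T)))"
    by (simp add: kdiff_def sum_distrib_left sum.Sigma)
  also have "\<dots> = (\<Sum>(S, v)\<in>Sigma UNIV (\<lambda>S. S). h S * signed v S (\<phi> (S - {v})))"
    by (rule sum.reindex_bij_witness[of _ "\<lambda>(S, v). (S - {v}, v)" "\<lambda>(T, v). (insert v T, v)"])
      (auto simp: insert_absorb signed_self signed_mult(1)[symmetric] mult.commute)
  also have "\<dots> = (\<Sum>S\<in>UNIV. h S * coboundary \<phi> S)"
    by (simp add: coboundary_def sum_distrib_left sum.Sigma)
  finally show ?thesis .
qed

lemma kdiff_indicator:
  "boundary (\<lambda>S. if S = \<rho> then 1 else 0) T \<noteq> (0 :: 'k::field) \<Longrightarrow> \<exists>v\<in>\<rho>. T = \<rho> - {v}"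
proof (rule ccontr)
  assume "\<not> (\<exists>v\<in>\<rho>. T = \<rho> - {v})"
  then have "insert v T \<noteq> \<rho>" if "v \<in> - T" for v using that by auto
  then have "boundary (\<lambda>S. if S = \<rho> then 1 else 0) T = (0 :: 'k)"
    unfolding kdiff_def by (intro sum.neutral) auto
  moreover assume "boundary (\<lambda>S. if S = \<rho> then 1 else 0) T \<noteq> (0 :: 'k)"
  ultimately show False by simp
qed

text \<open>
  All nonzero classes below are of the form \<open>\<partial>\<rho>\<close> for a simplex \<open>\<rho>\<close> whose facets, but not itself, lie in the
  complex. If the complex were acyclic, \<open>\<partial>\<rho>\<close> would bound a chain \<open>g\<close> of the complex.
\<close>

lemma not_acyclic_boundary:
  assumes card: "card \<rho> = Suc p" and facets: "\<And>v. v \<in> \<rho> \<Longrightarrow> \<rho> - {v} \<in> K"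
    and ac: "acyclic_at TYPE('k::field) K p"
  obtains g :: "'v set \<Rightarrow> 'k::field" where "\<And>T. g T \<noteq> 0 \<Longrightarrow> T \<in> K \<and> card T = Suc p"
    "\<And>T. boundary g T = boundary (\<lambda>S. if S = \<rho> then 1 else 0) T"
proof -
  let ?f = "boundary (\<lambda>S. if S = \<rho> then 1 else 0 :: 'k)"
  have "T \<in> K \<and> card T = p" if "?f T \<noteq> 0" for T
    using kdiff_indicator[OF that] facets card by (auto simp: card_gt_0_iff)
  moreover have "boundary ?f T = 0" for T by (intro kdiff_kdiff additive_id refl)
  ultimately show ?thesis using ac[unfolded acyclic_at_iff, rule_format, of ?f] that by blast
qed

lemma not_acyclic_cocycle:
  fixes \<phi> :: "'v set \<Rightarrow> 'k::field"
  assumes card: "card \<rho> = Suc p" and facets: "\<And>v. v \<in> \<rho> \<Longrightarrow> \<rho> - {v} \<in> K"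
    and cocycle: "\<And>T. T \<in> K \<Longrightarrow> card T = Suc p \<Longrightarrow> coboundary \<phi> T = 0" and nz: "coboundary \<phi> \<rho> \<noteq> 0"
  shows "\<not> acyclic_at TYPE('k) K p"
proof
  assume "acyclic_at TYPE('k) K p"
  then obtain g :: "'v set \<Rightarrow> 'k" where g: "\<And>T. g T \<noteq> 0 \<Longrightarrow> T \<in> K \<and> card T = Suc p"
    "\<And>T. boundary g T = boundary (\<lambda>S. if S = \<rho> then 1 else 0) T"
    using not_acyclic_boundary[OF card facets] by blast
  have "(\<Sum>S\<in>UNIV. g S * coboundary \<phi> S) = (\<Sum>S\<in>UNIV. (if S = \<rho> then 1 else 0) * coboundary \<phi> S)"
    by (simp only: sum_kdiff_coboundary[symmetric] g(2))
  also have "\<dots> = coboundary \<phi> \<rho>" by (simp add: if_distrib[of "\<lambda>x. x * _"] cong: if_cong)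
  also have "(\<Sum>S\<in>UNIV. g S * coboundary \<phi> S) = 0"
    using g(1) cocycle by (intro sum.neutral) (metis mult_eq_0_iff)
  finally show False using nz by simp
qed

lemma coboundary_2:
  fixes \<phi> :: "'v set \<Rightarrow> 'k::field"
  assumes "ord a < ord b"
  shows "coboundary \<phi> {a, b} = \<phi> {b} - \<phi> {a}"
proof -
  have "{a, b} - {a} = {b}" "{a, b} - {b} = {a}" and ne: "a \<noteq> b" using assms by auto
  moreover have "signed a {a, b} x = x" "signed b {a, b} x = - x" for x :: 'k
  proof -
    show "signed a {a, b} x = x" by (subst signed_count[of _ _ "{}"]) (use assms in auto)
    show "signed b {a, b} x = - x" by (subst signed_count[of _ _ "{a}"]) (use assms in auto)
  qed
  ultimately show ?thesis unfolding coboundary_def by (simp del: insert_Diff_single)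
qed

lemma coboundary_3:
  fixes \<phi> :: "'v set \<Rightarrow> 'k::field"
  assumes "ord a < ord b" "ord b < ord c"
  shows "coboundary \<phi> {a, b, c} = \<phi> {b, c} - \<phi> {a, c} + \<phi> {a, b}"
proof -
  have "{a, b, c} - {a} = {b, c}" "{a, b, c} - {b} = {a, c}" "{a, b, c} - {c} = {a, b}"
    and ne: "a \<noteq> b" "a \<noteq> c" "b \<noteq> c" using assms by auto
  moreover have "signed a {a, b, c} x = x" "signed b {a, b, c} x = - x" "signed c {a, b, c} x = x" for x :: 'k
  proof -
    show "signed a {a, b, c} x = x" by (subst signed_count[of _ _ "{}"]) (use assms in auto)
    show "signed b {a, b, c} x = - x" by (subst signed_count[of _ _ "{a}"]) (use assms in auto)
    show "signed c {a, b, c} x = x" by (subst signed_count[of _ _ "{a, b}"]) (use assms ne in auto)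
  qed
  ultimately show ?thesis unfolding coboundary_def by (simp del: insert_Diff_single)
qed

lemma coboundary_4:
  fixes \<phi> :: "'v set \<Rightarrow> 'k::field"
  assumes "ord a < ord b" "ord b < ord c" "ord c < ord d"
  shows "coboundary \<phi> {a, b, c, d} = \<phi> {b, c, d} - \<phi> {a, c, d} + \<phi> {a, b, d} - \<phi> {a, b, c}"
proof -
  have "{a, b, c, d} - {a} = {b, c, d}" "{a, b, c, d} - {b} = {a, c, d}"
    "{a, b, c, d} - {c} = {a, b, d}" "{a, b, c, d} - {d} = {a, b, c}"
    and ne: "a \<noteq> b" "a \<noteq> c" "b \<noteq> c" "a \<noteq> d" "b \<noteq> d" "c \<noteq> d" using assms by auto
  moreover have "signed a {a, b, c, d} x = x" "signed b {a, b, c, d} x = - x"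
    "signed c {a, b, c, d} x = x" "signed d {a, b, c, d} x = - x" for x :: 'k
  proof -
    show "signed a {a, b, c, d} x = x" by (subst signed_count[of _ _ "{}"]) (use assms in auto)
    show "signed b {a, b, c, d} x = - x" by (subst signed_count[of _ _ "{a}"]) (use assms in auto)
    show "signed c {a, b, c, d} x = x" by (subst signed_count[of _ _ "{a, b}"]) (use assms ne in auto)
    show "signed d {a, b, c, d} x = - x" by (subst signed_count[of _ _ "{a, b, c}"]) (use assms ne in auto)
  qed
  ultimately show ?thesis unfolding coboundary_def by (simp del: insert_Diff_single)
qed

lemma sorted_pair:
  assumes "card T = 2" obtains a b where "T = {a, b}" "ord a < ord b"
proof -
  obtain a b where "T = {a, b}" "a \<noteq> b" using assms by (auto simp: card_2_iff)
  moreover have "ord a \<noteq> ord b" using \<open>a \<noteq> b\<close> inj_ord by (auto dest: injD)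
  ultimately show ?thesis using that[of a b] that[of b a] by (metis insert_commute linorder_neqE_nat)
qed

lemma sorted_triple:
  assumes "card T = 3" obtains a b c where "T = {a, b, c}" "ord a < ord b" "ord b < ord c"
proof -
  have "T \<noteq> {}" using assms by auto
  then obtain a where a: "a \<in> T" "\<And>u. u \<in> T \<Longrightarrow> ord a \<le> ord u"
    using arg_min_if_finite(1)[of T ord] arg_min_least[of T _ ord] by (metis finite)
  have "card (T - {a}) = 2" using assms a(1) by simp
  then obtain b c where bc: "T - {a} = {b, c}" "ord b < ord c" by (rule sorted_pair)
  have "b \<in> T" "a \<noteq> b" using bc(1) by auto
  then have "ord a < ord b" using a inj_ord by (metis injD le_neq_implies_less)
  then show ?thesis using that[of a b c] bc a(1) by (metis insert_Diff)
qed

end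

subsection \<open>Totally disjoint edges\<close>

lemma separated_commute: "symp E \<Longrightarrow> separated E a a' b b' \<Longrightarrow> separated E b b' a a'"
  unfolding separated_def by (auto dest: sympD)

lemma separated_disjoint:
  assumes "symp E" "E a a'" "E b b'" "separated E a a' b b'"
  shows "{a, a'} \<inter> {b, b'} = {}"
  using assms(2-4) sympD[OF assms(1,2)] sympD[OF assms(1,3)] by (auto simp: separated_def)

text \<open>
  The product of the edges \<open>a i, b i\<close>; a loop contributes exponent \<open>2\<close>.
\<close>

definition matching_degree :: "('i \<Rightarrow> 'v) \<Rightarrow> ('i \<Rightarrow> 'v) \<Rightarrow> 'i set \<Rightarrow> 'v \<Rightarrow> nat" where
  "matching_degree a b J w = (\<Sum>i\<in>J. of_bool (w = a i) + of_bool (w = b i))"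

lemma sum_matching_degree:
  "finite J \<Longrightarrow> sum (matching_degree a b J) (UNIV :: 'v::finite set) = 2 * card J"
  unfolding matching_degree_def
  by (subst sum.swap) (simp add: sum.distrib of_bool_def)

text \<open>
  An edge dividing \<open>x\<^sup>m\<^sup>-\<^sup>T\<close> has to be one of the given edges, by total disjointness and by counting
  exponents. So a face is a set of endpoints that avoids at least one of the edges.
\<close>

lemma upper_koszul_matching:
  fixes a b :: "'i \<Rightarrow> 'v::finite"
  assumes "finite J" "symp E" "\<And>i. i \<in> J \<Longrightarrow> E (a i) (b i)"
    and sep: "\<And>i j. i \<in> J \<Longrightarrow> j \<in> J \<Longrightarrow> i \<noteq> j \<Longrightarrow> separated E (a i) (b i) (a j) (b j)"
  shows "upper_koszul (edge_ideal E) (matching_degree a b J) =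
    {T. T \<subseteq> (\<Union>i\<in>J. {a i, b i}) \<and> (\<exists>i\<in>J. T \<inter> {a i, b i} = {})}"
proof -
  let ?m = "matching_degree a b J"
  have disj: "w \<notin> {a j, b j}" if "i \<in> J" "j \<in> J" "i \<noteq> j" "w \<in> {a i, b i}" for i j w
    using separated_disjoint[OF assms(2) assms(3)[OF that(1)] assms(3)[OF that(2)] sep[OF that(1-3)]] that(4)
    by blast
  have m: "?m w = of_bool (w = a i) + of_bool (w = b i)" if "i \<in> J" "w \<in> {a i, b i}" for i w
  proof -
    have "?m w = (\<Sum>j\<in>{i}. of_bool (w = a j) + of_bool (w = b j))"
      unfolding matching_degree_def using disj[of i _ w] that assms(1)
      by (intro sum.mono_neutral_right) auto
    then show ?thesis by simp
  qed
  have supp: "supp ?m = (\<Union>i\<in>J. {a i, b i})"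
  proof
    show "supp ?m \<subseteq> (\<Union>i\<in>J. {a i, b i})"
    proof
      fix w assume "w \<in> supp ?m"
      then have "?m w \<noteq> 0" by (simp add: supp_def)
      then obtain i where "i \<in> J" "of_bool (w = a i) + of_bool (w = b i) \<noteq> (0 :: nat)"
        unfolding matching_degree_def by (rule sum.not_neutral_contains_not_neutral)
      then show "w \<in> (\<Union>i\<in>J. {a i, b i})" by (auto split: if_splits)
    qed
    show "(\<Union>i\<in>J. {a i, b i}) \<subseteq> supp ?m" using m by (auto simp: supp_def)
  qed
  have "edge_ideal E (lower ?m T) \<longleftrightarrow> (\<exists>i\<in>J. T \<inter> {a i, b i} = {})" if "T \<subseteq> (\<Union>i\<in>J. {a i, b i})" for T
  proof
    assume "edge_ideal E (lower ?m T)"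
    then obtain u v where uv: "E u v" "fits u v (lower ?m T)" by (auto simp: edge_ideal_def)
    have le: "lower ?m T w \<le> ?m w" for w by (simp add: lower_def)
    have "u \<in> supp ?m" "v \<in> supp ?m"
      using fits_mono[OF uv(2) le] by (auto simp: fits_def supp_def split: if_splits)
    then obtain i j where ij: "i \<in> J" "u \<in> {a i, b i}" "j \<in> J" "v \<in> {a j, b j}" by (auto simp: supp)
    have "i = j"
      using sep[OF ij(1,3)] ij(2,4) uv(1) by (auto simp: separated_def)
    have l: "lower ?m T (a i) = 1 + of_bool (a i = b i) - of_bool (a i \<in> T)"
      "lower ?m T (b i) = 1 + of_bool (a i = b i) - of_bool (b i \<in> T)"
      using m[OF ij(1)] by (auto simp: lower_def)
    have "fits (a i) (b i) (lower ?m T)"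
    proof (cases "u = v")
      case True
      then have "lower ?m T u \<ge> 2" using uv(2) by (simp add: fits_def)
      then show ?thesis using ij(2) l by (cases "a i = b i") (auto simp: fits_def split: if_splits)
    next
      case False
      then have "{u, v} = {a i, b i}" using ij \<open>i = j\<close> by auto
      then show ?thesis using uv(2) fits_commute[of u v] by (auto simp: doubleton_eq_iff)
    qed
    then have "T \<inter> {a i, b i} = {}"
      using l by (cases "a i = b i") (auto simp: fits_def split: if_splits)
    then show "\<exists>i\<in>J. T \<inter> {a i, b i} = {}" using ij(1) by blast
  next
    assume "\<exists>i\<in>J. T \<inter> {a i, b i} = {}"
    then obtain i where "i \<in> J" "T \<inter> {a i, b i} = {}" by blast
    then have "fits (a i) (b i) (lower ?m T)" using m[of i] by (auto simp: fits_def lower_def)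
    then show "edge_ideal E (lower ?m T)" using assms(3)[OF \<open>i \<in> J\<close>] by (auto simp: edge_ideal_def)
  qed
  then show ?thesis unfolding upper_koszul_def supp by blast
qed

context vertex_order
begin

text \<open>
  The complex has two connected components, one for each edge. The cochain \<open>\<phi>\<close> is the indicator of the
  first one.
\<close>

lemma two_separated_edges:
  assumes sym: "symp E" and E: "E a a'" "E b b'" and sep: "separated E a a' b b'"
  obtains m where "sum m UNIV = 4" "\<not> acyclic_at TYPE('k::field) (upper_koszul (edge_ideal E) m) 1"
proof -
  define x where "x i = (if i = (0::nat) then a else b)" for i
  define y where "y i = (if i = (0::nat) then a' else b')" for i
  define J where "J = {0::nat, 1}"
  let ?K = "upper_koszul (edge_ideal E) (matching_degree x y J)"
  have "E (x i) (y i)" if "i \<in> J" for i using that E by (auto simp: J_def x_def y_def)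
  moreover have "separated E (x i) (y i) (x j) (y j)" if "i \<in> J" "j \<in> J" "i \<noteq> j" for i j
    using that sep separated_commute[OF sym sep] by (auto simp: J_def x_def y_def)
  ultimately have "?K = {T. T \<subseteq> (\<Union>i\<in>J. {x i, y i}) \<and> (\<exists>i\<in>J. T \<inter> {x i, y i} = {})}"
    by (intro upper_koszul_matching[OF _ sym]) (simp add: J_def)
  moreover have "(\<Union>i\<in>J. {x i, y i}) = {a, a', b, b'}" by (auto simp: J_def x_def y_def)
  moreover have "(\<exists>i\<in>J. T \<inter> {x i, y i} = {}) \<longleftrightarrow> T \<inter> {a, a'} = {} \<or> T \<inter> {b, b'} = {}" for T
    by (simp add: J_def x_def y_def)
  ultimately have K: "?K = {T. T \<subseteq> {a, a', b, b'} \<and> (T \<inter> {a, a'} = {} \<or> T \<inter> {b, b'} = {})}"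
    by (simp only:)
  have disj: "{a, a'} \<inter> {b, b'} = {}" by (rule separated_disjoint[OF sym E sep])
  define \<phi> :: "'v set \<Rightarrow> 'k" where "\<phi> T = of_bool (T \<subseteq> {a, a'})" for T
  have "\<not> acyclic_at TYPE('k) ?K 1"
  proof (rule not_acyclic_cocycle[where \<phi> = \<phi> and \<rho> = "{a, b}"])
    show "card {a, b} = Suc 1" using disj by (auto simp: card_insert_if)
    show "{a, b} - {v} \<in> ?K" if "v \<in> {a, b}" for v using that disj unfolding K by auto
    show "coboundary \<phi> T = 0" if "T \<in> ?K" "card T = Suc 1" for T
    proof -
      obtain u v where uv: "T = {u, v}" "ord u < ord v" using sorted_pair[of T] \<open>card T = Suc 1\<close> by auto
      show ?thesis using that(1) disj unfolding uv(1) coboundary_2[OF uv(2)] K by (auto simp: \<phi>_def)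
    qed
    show "coboundary \<phi> {a, b} \<noteq> 0"
    proof -
      have ne: "a \<noteq> b" and \<phi>: "\<phi> {a} = 1" "\<phi> {b} = 0" using disj by (auto simp: \<phi>_def)
      have "ord a \<noteq> ord b" using ne inj_ord by (auto dest: injD)
      then consider "ord a < ord b" | "ord b < ord a" by linarith
      then show ?thesis
      proof cases
        case 2
        then show ?thesis using coboundary_2[of b a \<phi>] by (simp add: \<phi> insert_commute)
      qed (simp add: coboundary_2 \<phi>)
    qed
  qed
  moreover have "sum (matching_degree x y J) UNIV = 4" by (simp add: sum_matching_degree J_def)
  ultimately show ?thesis using that by blast
qed

text \<open>
  The complex is a triangle boundary with its three vertices blown up to the three edges. Ordering
  the vertices block by block, the cochain that picks the segments from the first to the second
  block is a cocycle, because no face meets all three blocks; on \<open>\<rho> = {a, b, c}\<close> it takes the value \<open>1\<close>.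
\<close>

lemma three_separated_edges:
  assumes sym: "symp E" and E: "E a a'" "E b b'" "E c c'"
    and sep: "separated E a a' b b'" "separated E a a' c c'" "separated E b b' c c'"
    and ord: "\<And>u v. u \<in> {a, a'} \<Longrightarrow> v \<in> {b, b'} \<union> {c, c'} \<Longrightarrow> ord u < ord v"
      "\<And>u v. u \<in> {b, b'} \<Longrightarrow> v \<in> {c, c'} \<Longrightarrow> ord u < ord v"
  obtains m where "sum m UNIV = 6" "\<not> acyclic_at TYPE('k::field) (upper_koszul (edge_ideal E) m) 2"
proof -
  define x where "x i = (if i = (0::nat) then a else if i = 1 then b else c)" for i
  define y where "y i = (if i = (0::nat) then a' else if i = 1 then b' else c')" for i
  define J where "J = {0::nat, 1, 2}"
  let ?K = "upper_koszul (edge_ideal E) (matching_degree x y J)"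
  have "E (x i) (y i)" if "i \<in> J" for i using that E by (auto simp: J_def x_def y_def)
  moreover have "separated E (x i) (y i) (x j) (y j)" if "i \<in> J" "j \<in> J" "i \<noteq> j" for i j
    using that sep sep[THEN separated_commute[OF sym]] by (auto simp: J_def x_def y_def)
  ultimately have "?K = {T. T \<subseteq> (\<Union>i\<in>J. {x i, y i}) \<and> (\<exists>i\<in>J. T \<inter> {x i, y i} = {})}"
    by (intro upper_koszul_matching[OF _ sym]) (simp add: J_def)
  moreover have "(\<Union>i\<in>J. {x i, y i}) = {a, a', b, b', c, c'}" by (auto simp: J_def x_def y_def)
  moreover have "(\<exists>i\<in>J. T \<inter> {x i, y i} = {}) \<longleftrightarrow> T \<inter> {a, a'} = {} \<or> T \<inter> {b, b'} = {} \<or> T \<inter> {c, c'} = {}" for T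
    by (simp add: J_def x_def y_def)
  ultimately have K: "?K = {T. T \<subseteq> {a, a', b, b', c, c'} \<and> (T \<inter> {a, a'} = {} \<or> T \<inter> {b, b'} = {} \<or> T \<inter> {c, c'} = {})}"
    by (simp only:)
  have disj: "{a, a'} \<inter> {b, b'} = {}" "{a, a'} \<inter> {c, c'} = {}" "{b, b'} \<inter> {c, c'} = {}"
    by (rule separated_disjoint[OF sym E(1,2) sep(1)] separated_disjoint[OF sym E(1,3) sep(2)]
        separated_disjoint[OF sym E(2,3) sep(3)])+
  define blk where "blk v = (if v \<in> {a, a'} then 0 else if v \<in> {b, b'} then 1 else 2 :: nat)" for v
  have blk_eq: "blk v = 0 \<longleftrightarrow> v \<in> {a, a'}" "v \<in> {b, b'} \<Longrightarrow> blk v = 1" "v \<in> {c, c'} \<Longrightarrow> blk v = 2" for v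
    using disj by (auto simp: blk_def)
  have blk_cases: "blk v = 0 \<and> v \<in> {a, a'} \<or> blk v = 1 \<and> v \<in> {b, b'} \<or> blk v = 2 \<and> v \<in> {c, c'}"
    if "v \<in> {a, a', b, b', c, c'}" for v
    using that by (simp add: blk_def) blast
  have blk_le: "blk v \<le> 2" if "v \<in> {a, a', b, b', c, c'}" for v by (simp add: blk_def)
  have blk_mono: "blk u \<le> blk v"
    if "ord u < ord v" "u \<in> {a, a', b, b', c, c'}" "v \<in> {a, a', b, b', c, c'}" for u v
  proof (rule ccontr)
    assume "\<not> blk u \<le> blk v"
    then have "ord v < ord u" using blk_cases[OF that(2)] blk_cases[OF that(3)] ord by fastforce
    then show False using that(1) by simp
  qed
  define \<phi> :: "'v set \<Rightarrow> 'k" where "\<phi> T = of_bool (blk ` T = {0, 1})" for T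
  have \<phi>: "\<phi> {u, v} = of_bool (blk u = 0 \<and> blk v = 1)" if "blk u \<le> blk v" for u v
  proof -
    have "{blk u, blk v} = {0, 1} \<longleftrightarrow> blk u = 0 \<and> blk v = 1" using that by (auto simp: doubleton_eq_iff)
    then show ?thesis by (simp add: \<phi>_def)
  qed
  have "\<not> acyclic_at TYPE('k) ?K 2"
  proof (rule not_acyclic_cocycle[where \<phi> = \<phi> and \<rho> = "{a, b, c}"])
    have ne: "a \<noteq> b" "a \<noteq> c" "b \<noteq> c" using disj by auto
    then show "card {a, b, c} = Suc 2" by simp
    show "{a, b, c} - {v} \<in> ?K" if "v \<in> {a, b, c}" for v using that disj unfolding K by auto
    show "coboundary \<phi> T = 0" if "T \<in> ?K" "card T = Suc 2" for T
    proof -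
      obtain t u v where T: "T = {t, u, v}" "ord t < ord u" "ord u < ord v"
        using sorted_triple[of T] \<open>card T = Suc 2\<close> by auto
      have mem: "t \<in> {a, a', b, b', c, c'}" "u \<in> {a, a', b, b', c, c'}" "v \<in> {a, a', b, b', c, c'}"
        using that(1) unfolding K T(1) by auto
      have le: "blk t \<le> blk u" "blk u \<le> blk v" "blk t \<le> blk v"
        using T(2,3) blk_mono mem by (meson less_trans)+
      have "blk t \<noteq> 0 \<or> blk u \<noteq> 1 \<or> blk v \<noteq> 2"
      proof (rule ccontr)
        assume "\<not> ?thesis"
        then have "t \<in> {a, a'}" "u \<in> {b, b'}" "v \<in> {c, c'}"
          using blk_cases[OF mem(1)] blk_cases[OF mem(2)] blk_cases[OF mem(3)] by linarith+
        then have "T \<inter> {a, a'} \<noteq> {}" "T \<inter> {b, b'} \<noteq> {}" "T \<inter> {c, c'} \<noteq> {}"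
          unfolding T(1) by blast+
        then show False using that(1) unfolding K by blast
      qed
      then show ?thesis
        unfolding T(1) coboundary_3[OF T(2,3)] \<phi>[OF le(1)] \<phi>[OF le(2)] \<phi>[OF le(3)]
        using le blk_le[OF mem(1)] blk_le[OF mem(2)] blk_le[OF mem(3)]
        by (cases "blk t"; cases "blk u"; cases "blk v") (auto simp: le_Suc_eq numeral_2_eq_2)
    qed
    have "ord a < ord b" "ord b < ord c" using ord by auto
    moreover have "blk a = 0" "blk b = 1" "blk c = 2" using blk_eq by auto
    ultimately show "coboundary \<phi> {a, b, c} \<noteq> 0" by (simp add: coboundary_3 \<phi>)
  qed
  moreover have "sum (matching_degree x y J) UNIV = 6" by (simp add: sum_matching_degree J_def)
  ultimately show ?thesis using that by blast
qed

end

subsection \<open>Induced cycles of the bipartite complement\<close>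

context vertex_order
begin

text \<open>
  Passing to complements in \<open>W\<close> turns the boundary into the coboundary, up to the signs \<open>\<epsilon>\<close>.
\<close>

lemma cocycle_of_cycle:
  fixes h :: "'v set \<Rightarrow> 'k::field"
  assumes cyc: "\<And>T. boundary h T = 0" and supp: "\<And>T. h T \<noteq> 0 \<Longrightarrow> T \<subseteq> W"
  obtains \<epsilon> :: "'v set \<Rightarrow> 'k" where "\<And>T. \<epsilon> T \<noteq> 0"
    "\<And>T. T \<subseteq> W \<Longrightarrow> coboundary (\<lambda>S. \<epsilon> S * h (W - S)) T = 0"
proof -
  define s where "s v = signed v W (1 :: 'k)" for v
  define \<epsilon> where "\<epsilon> T = (\<Prod>v\<in>T. s v)" for T
  have s2: "s v * s v = 1" for v by (simp add: s_def signed_def)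
  have "\<epsilon> T \<noteq> 0" for T using s2 by (auto simp: \<epsilon>_def prod_zero_iff) (metis mult_zero_left zero_neq_one)
  moreover have "coboundary (\<lambda>S. \<epsilon> S * h (W - S)) T = 0" if T: "T \<subseteq> W" for T
  proof -
    have sgn: "signed v (W - T) b = s v * signed v T b" if "v \<in> T" for v and b :: 'k
    proof -
      have "{u \<in> W. ord u < ord v} = {u \<in> W - T. ord u < ord v} \<union> {u \<in> T. ord u < ord v}"
        using T by auto
      then have "card {u \<in> W. ord u < ord v} = card {u \<in> W - T. ord u < ord v} + card {u \<in> T. ord u < ord v}"
        by (simp add: card_Un_disjoint disjoint_iff)
      then show ?thesis by (auto simp: signed_def s_def)
    qed
    have "0 = boundary h (W - T)" using cyc by simp
    also have "\<dots> = (\<Sum>v\<in>T. signed v (W - T) (h (W - (T - {v}))))"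
    proof -
      have "boundary h (W - T) = (\<Sum>v\<in>T. signed v (W - T) (h (insert v (W - T))))"
        unfolding kdiff_def
      proof (rule sum.mono_neutral_right)
        show "\<forall>v\<in>- (W - T) - T. signed v (W - T) (h (insert v (W - T))) = 0"
        proof
          fix v assume "v \<in> - (W - T) - T"
          then have "\<not> insert v (W - T) \<subseteq> W" by auto
          then show "signed v (W - T) (h (insert v (W - T))) = 0" using supp by auto
        qed
      qed auto
      also have "\<dots> = (\<Sum>v\<in>T. signed v (W - T) (h (W - (T - {v}))))"
      proof (rule sum.cong[OF refl])
        fix v assume "v \<in> T"
        then have "insert v (W - T) = W - (T - {v})" using T by auto
        then show "signed v (W - T) (h (insert v (W - T))) = signed v (W - T) (h (W - (T - {v})))" by simp
      qed
      finally show ?thesis .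
    qed
    finally have "0 = \<epsilon> T * (\<Sum>v\<in>T. signed v (W - T) (h (W - (T - {v}))))" by simp
    also have "\<dots> = coboundary (\<lambda>S. \<epsilon> S * h (W - S)) T"
      unfolding coboundary_def sum_distrib_left
    proof (rule sum.cong[OF refl])
      fix v assume v: "v \<in> T"
      have "\<epsilon> T = s v * \<epsilon> (T - {v})" using v by (simp add: \<epsilon>_def prod.remove)
      then have "\<epsilon> T * signed v (W - T) b = (s v * s v) * signed v T (\<epsilon> (T - {v}) * b)" for b
        unfolding sgn[OF v] by (simp add: signed_mult(1))
      then show "\<epsilon> T * signed v (W - T) (h (W - (T - {v}))) = signed v T (\<epsilon> (T - {v}) * h (W - (T - {v})))"
        by (simp add: s2)
    qed
    finally show ?thesis by simp
  qed
  ultimately show ?thesis using that by blast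
qed

text \<open>
  A cocycle \<open>u\<close> on triples that vanishes within \<open>X\<close> and within \<open>Y\<close> has a primitive on pairs that vanishes
  within \<open>X\<close> and is the difference of a function \<open>\<theta>\<close> within \<open>Y\<close>: take the cone from the first vertex \<open>a\<close> of \<open>X\<close>,
  and within \<open>Y\<close> also from the first vertex \<open>b\<close> of \<open>Y\<close>. On mixed pairs it is \<open>w\<close>, and \<open>q = w - \<theta>\<close> detects
  the values of \<open>u\<close> on mixed triples. The order with \<open>X\<close> before \<open>Y\<close> keeps all signs fixed.
\<close>

lemma cocycle_potential:
  fixes u :: "'v set \<Rightarrow> 'k::field"
  assumes disj: "X \<inter> Y = {}" and ne: "X \<noteq> {}" "Y \<noteq> {}"
    and ord: "\<And>x y. x \<in> X \<Longrightarrow> y \<in> Y \<Longrightarrow> ord x < ord y"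
    and cocycle: "\<And>T. T \<subseteq> X \<union> Y \<Longrightarrow> card T = 4 \<Longrightarrow> coboundary u T = 0"
    and X0: "\<And>T. T \<subseteq> X \<Longrightarrow> card T = 3 \<Longrightarrow> u T = 0"
    and Y0: "\<And>T. T \<subseteq> Y \<Longrightarrow> card T = 3 \<Longrightarrow> u T = 0"
  obtains q :: "'v \<Rightarrow> 'v \<Rightarrow> 'k" where
    "\<And>x y z. x \<in> X \<Longrightarrow> y \<in> Y \<Longrightarrow> z \<in> Y \<Longrightarrow> y \<noteq> z \<Longrightarrow> u {x, y, z} = 0 \<Longrightarrow> q x y = q x z"
    "\<And>x x' y. x \<in> X \<Longrightarrow> x' \<in> X \<Longrightarrow> x \<noteq> x' \<Longrightarrow> y \<in> Y \<Longrightarrow> u {x, x', y} = 0 \<longleftrightarrow> q x y = q x' y"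
proof -
  obtain a where a: "a \<in> X" "\<And>x. x \<in> X \<Longrightarrow> ord a \<le> ord x"
    using arg_min_if_finite(1)[of X ord] arg_min_least[of X _ ord] ne(1) by (metis finite)
  obtain b where b: "b \<in> Y" "\<And>y. y \<in> Y \<Longrightarrow> ord b \<le> ord y"
    using arg_min_if_finite(1)[of Y ord] arg_min_least[of Y _ ord] ne(2) by (metis finite)
  have a_less: "ord a < ord x" if "x \<in> X" "x \<noteq> a" for x
    using a that inj_ord by (metis injD le_neq_implies_less)
  have b_less: "ord b < ord y" if "y \<in> Y" "y \<noteq> b" for y
    using b that inj_ord by (metis injD le_neq_implies_less)
  have coc: "u {j, k, l} - u {i, k, l} + u {i, j, l} - u {i, j, k} = 0"
    if "{i, j, k, l} \<subseteq> X \<union> Y" "ord i < ord j" "ord j < ord k" "ord k < ord l" for i j k l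
  proof -
    have "card {i, j, k, l} = 4" using that(2-4) by (auto simp: card_insert_if)
    then show ?thesis using cocycle[OF that(1)] coboundary_4[OF that(2-4), of u] by simp
  qed
  have card3: "card {i, j, k} = 3" if "ord i < ord j" "ord j < ord k" for i j k
    using that by (auto simp: card_insert_if)
  define w where "w x y = (if x = a then 0 else u {a, x, y})" for x y
  define \<theta> where "\<theta> y = (if y = b then 0 else u {a, b, y})" for y
  have XXY: "u {x, x', y} = w x' y - w x y" if "x \<in> X" "x' \<in> X" "ord x < ord x'" "y \<in> Y" for x x' y
  proof (cases "x = a")
    case True
    then show ?thesis using that(3) by (auto simp: w_def)
  next
    case False
    have "u {a, x, x'} = 0"
      using X0[of "{a, x, x'}"] card3[OF a_less[OF that(1) False] that(3)] a(1) that by auto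
    then show ?thesis
      using coc[of a x x' y] a_less[OF that(1) False] that ord[of x' y] a(1) False a_less[of x']
      by (auto simp: w_def algebra_simps)
  qed
  have aYY: "u {a, y, z} = \<theta> z - \<theta> y" if "y \<in> Y" "z \<in> Y" "ord y < ord z" for y z
  proof (cases "y = b")
    case True
    then show ?thesis using that(3) by (auto simp: \<theta>_def)
  next
    case False
    have "z \<noteq> b" using that(3) b(2)[OF that(1)] by auto
    have "u {b, y, z} = 0"
      using Y0[of "{b, y, z}"] card3[OF b_less[OF that(1) False] that(3)] b(1) that by auto
    then show ?thesis
      using coc[of a b y z] ord[OF a(1) b(1)] b_less[OF that(1) False] that a(1) b(1) False \<open>z \<noteq> b\<close>
      by (auto simp: \<theta>_def algebra_simps)
  qed
  have XYY: "u {x, y, z} = (\<theta> z - \<theta> y) - w x z + w x y" if "x \<in> X" "y \<in> Y" "z \<in> Y" "ord y < ord z" for x y z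
  proof (cases "x = a")
    case True
    then show ?thesis using aYY[OF that(2-4)] by (simp add: w_def)
  next
    case False
    then show ?thesis
      using coc[of a x y z] a_less[OF that(1) False] ord[OF that(1,2)] that a(1) aYY[OF that(2-4)]
      by (auto simp: w_def algebra_simps)
  qed
  have neq: "ord i \<noteq> ord j" if "i \<noteq> j" for i j using that inj_ord by (auto dest: injD)
  show ?thesis
  proof (rule that[of "\<lambda>x y. w x y - \<theta> y"])
    fix x y z assume A: "x \<in> X" "y \<in> Y" "z \<in> Y" "y \<noteq> z" "u {x, y, z} = 0"
    consider "ord y < ord z" | "ord z < ord y" using neq[OF A(4)] by linarith
    then show "w x y - \<theta> y = w x z - \<theta> z"
    proof cases
      case 1
      then show ?thesis using XYY[OF A(1,2,3)] A(5) by (simp add: algebra_simps)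
    next
      case 2
      have "{x, y, z} = {x, z, y}" by auto
      then show ?thesis using XYY[OF A(1,3,2) 2] A(5) by (simp add: algebra_simps)
    qed
  next
    fix x x' y assume A: "x \<in> X" "x' \<in> X" "x \<noteq> x'" "y \<in> Y"
    consider "ord x < ord x'" | "ord x' < ord x" using neq[OF A(3)] by linarith
    then show "u {x, x', y} = 0 \<longleftrightarrow> w x y - \<theta> y = w x' y - \<theta> y"
    proof cases
      case 1
      then show ?thesis using XXY[OF A(1,2) 1 A(4)] by (auto simp: algebra_simps)
    next
      case 2
      have "{x, x', y} = {x', x, y}" by auto
      then show ?thesis using XXY[OF A(2,1) 2 A(4)] by (auto simp: algebra_simps)
    qed
  qed
qed

text \<open>
  Count the pairs related by \<open>B\<close> whose first component lies in the level set of \<open>x0\<close>. By rows the number is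
  even. By columns, \<open>y0\<close> contributes one if \<open>x1\<close> is outside the level set, and every other column
  contributes zero or two.
\<close>

lemma parity_of_level_sets:
  fixes q :: "'v \<Rightarrow> 'a"
  assumes disj: "X \<inter> Y = {}"
    and degX: "\<And>x. x \<in> X \<Longrightarrow> card {y \<in> Y. B x y} = 2"
    and nbY: "\<And>y. y \<in> Y \<Longrightarrow> y \<noteq> y0 \<Longrightarrow> \<exists>x x'. x \<noteq> x' \<and> {x \<in> X. B x y} = {x, x'} \<and> q x = q x'"
    and y0: "y0 \<in> Y" "{x \<in> X. B x y0} = {x0, x1}" "x0 \<noteq> x1"
  shows "q x0 = q (x1 :: 'v)"
proof (rule ccontr)
  assume neq: "q x0 \<noteq> q x1"
  define D where "D = {x \<in> X. q x = q x0}"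
  have count: "card {a \<in> A. P a} = (\<Sum>a\<in>A. if P a then 1 else 0)" for A :: "'v set" and P
    by (simp only: card_eq_sum sum.inter_filter[OF finite])
  have "2 * card D = (\<Sum>x\<in>D. card {y \<in> Y. B x y})" using degX by (simp add: D_def)
  also have "\<dots> = (\<Sum>x\<in>D. \<Sum>y\<in>Y. if B x y then 1 else 0)" by (simp only: count)
  also have "\<dots> = (\<Sum>y\<in>Y. \<Sum>x\<in>D. if B x y then 1 else 0)" by (rule sum.swap)
  also have "\<dots> = (\<Sum>y\<in>Y. card {x \<in> D. B x y})" by (simp only: count)
  also have "\<dots> = card {x \<in> D. B x y0} + (\<Sum>y\<in>Y - {y0}. card {x \<in> D. B x y})"
    using y0(1) by (simp add: sum.remove)
  also have "{x \<in> D. B x y0} = {x \<in> {x0, x1}. q x = q x0}"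
    using y0(2) by (auto simp: D_def)
  also have "\<dots> = {x0}" using neq by auto
  also have "even (\<Sum>y\<in>Y - {y0}. card {x \<in> D. B x y})"
  proof (rule dvd_sum)
    fix y assume "y \<in> Y - {y0}"
    then obtain x x' where x: "x \<noteq> x'" "{x \<in> X. B x y} = {x, x'}" "q x = q x'" using nbY by blast
    have "{z \<in> D. B z y} = {z \<in> {x, x'}. q z = q x0}" using x(2) by (auto simp: D_def)
    also have "\<dots> = (if q x = q x0 then {x, x'} else {})" using x(3) by auto
    finally show "even (card {x \<in> D. B x y})" using x(1) by simp
  qed
  then have "odd (card {x0} + (\<Sum>y\<in>Y - {y0}. card {x \<in> D. B x y}))" by simp
  ultimately have "odd (2 * card D)" by simp
  then show False by simp
qed

text \<open>
  A face of the complex is a set whose complement in \<open>W = X \<union> Y\<close> contains an edge. The triple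
  \<open>{x0, x1, y0}\<close> around a vertex \<open>y0\<close> of the cycle is a maximal independent set, so its complement \<open>\<rho>\<close> is a
  minimal nonface. If \<open>\<partial>\<rho> = \<partial>g\<close> with \<open>g\<close> supported on faces, then \<open>\<rho> - g\<close> becomes a cocycle \<open>u\<close> on triples whose
  only nonzero value on an independent triple is the one on \<open>{x0, x1, y0}\<close>. Its potential \<open>q\<close> is then constant
  along the cycle except for a jump at \<open>y0\<close>, which parity forbids.
\<close>

theorem induced_cycle_not_acyclic:
  assumes sym: "symp E" and disj: "X \<inter> Y = {}"
    and EX: "\<And>x x'. x \<in> X \<Longrightarrow> x' \<in> X \<Longrightarrow> x \<noteq> x' \<Longrightarrow> \<not> E x x'"
    and EY: "\<And>y y'. y \<in> Y \<Longrightarrow> y' \<in> Y \<Longrightarrow> y \<noteq> y' \<Longrightarrow> \<not> E y y'"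
    and degX: "\<And>x. x \<in> X \<Longrightarrow> card {y \<in> Y. \<not> E x y} = 2"
    and degY: "\<And>y. y \<in> Y \<Longrightarrow> card {x \<in> X. \<not> E x y} = 2"
    and y0: "y0 \<in> Y" "\<And>y. y \<in> Y \<Longrightarrow> y \<noteq> y0 \<Longrightarrow> {x \<in> X. \<not> E x y} \<noteq> {x \<in> X. \<not> E x y0}"
    and ord: "\<And>x y. x \<in> X \<Longrightarrow> y \<in> Y \<Longrightarrow> ord x < ord y"
    and four: "card (X \<union> Y) = Suc p + 3"
  shows "\<not> acyclic_at TYPE('k::field) (upper_koszul (edge_ideal E) (\<lambda>v. of_bool (v \<in> X \<union> Y))) p"
proof
  let ?m = "\<lambda>v. of_bool (v \<in> X \<union> Y) :: nat"
  let ?W = "X \<union> Y"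
  let ?K = "upper_koszul (edge_ideal E) ?m"
  assume ac: "acyclic_at TYPE('k) ?K p"
  have low: "lower ?m T v = of_bool (v \<in> ?W - T)" for T v by (simp add: lower_def)
  have K: "T \<in> ?K \<longleftrightarrow> T \<subseteq> ?W \<and> (\<exists>x y. x \<in> X - T \<and> y \<in> Y - T \<and> E x y)" for T
  proof -
    have "edge_ideal E (lower ?m T) \<longleftrightarrow> (\<exists>u v. E u v \<and> u \<noteq> v \<and> u \<in> ?W - T \<and> v \<in> ?W - T)"
      unfolding edge_ideal_def fits_def low by auto
    also have "\<dots> \<longleftrightarrow> (\<exists>x y. x \<in> X - T \<and> y \<in> Y - T \<and> E x y)"
    proof
      assume "\<exists>u v. E u v \<and> u \<noteq> v \<and> u \<in> ?W - T \<and> v \<in> ?W - T"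
      then obtain u v where uv: "E u v" "E v u" "u \<noteq> v" "u \<in> ?W - T" "v \<in> ?W - T"
        using sympD[OF sym] by blast
      then have "u \<in> X \<and> v \<in> Y \<or> v \<in> X \<and> u \<in> Y" using EX[of u v] EY[of u v] by blast
      then show "\<exists>x y. x \<in> X - T \<and> y \<in> Y - T \<and> E x y" using uv by blast
    qed (use disj in blast)
    finally have "edge_ideal E (lower ?m T) \<longleftrightarrow> (\<exists>x y. x \<in> X - T \<and> y \<in> Y - T \<and> E x y)" .
    moreover have "supp ?m = ?W" by (auto simp: supp_def)
    ultimately show ?thesis unfolding upper_koszul_def by blast
  qed
  obtain x0 x1 where x01: "{x \<in> X. \<not> E x y0} = {x0, x1}" "x0 \<noteq> x1"
    using degY[OF y0(1)] by (auto simp: card_2_iff)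
  have x_in: "x0 \<in> X" "x1 \<in> X" "\<not> E x0 y0" "\<not> E x1 y0" using x01(1) by auto
  have xy: "x0 \<noteq> y0" "x1 \<noteq> y0" using x_in y0(1) disj by auto
  define \<rho> where "\<rho> = ?W - {x0, x1, y0}"
  have "card {x0, x1, y0} = 3" using x01(2) xy by simp
  then have card_\<rho>: "card \<rho> = Suc p" using four x_in y0(1) by (simp add: \<rho>_def card_Diff_subset)
  have facets: "\<rho> - {v} \<in> ?K" if v: "v \<in> \<rho>" for v
  proof (cases "v \<in> X")
    case True
    then have "E v y0" using v x01(1) by (auto simp: \<rho>_def)
    then show ?thesis unfolding K using True y0(1) v by (intro conjI exI[of _ v] exI[of _ y0]) (auto simp: \<rho>_def)
  next
    case False
    then have vY: "v \<in> Y" "v \<noteq> y0" using v by (auto simp: \<rho>_def)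
    have "\<not> {x0, x1} \<subseteq> {x \<in> X. \<not> E x v}"
    proof
      assume "{x0, x1} \<subseteq> {x \<in> X. \<not> E x v}"
      then have "{x0, x1} = {x \<in> X. \<not> E x v}"
        using degY[OF vY(1)] x01(2) by (intro card_subset_eq) auto
      then show False using y0(2)[OF vY] x01(1) by simp
    qed
    then obtain x where "x \<in> {x0, x1}" "E x v" using x_in by auto
    then show ?thesis unfolding K using vY x_in v by (intro conjI exI[of _ x] exI[of _ v]) (auto simp: \<rho>_def)
  qed
  obtain g :: "'v set \<Rightarrow> 'k" where g: "\<And>T. g T \<noteq> 0 \<Longrightarrow> T \<in> ?K \<and> card T = Suc p"
    "\<And>T. boundary g T = boundary (\<lambda>S. if S = \<rho> then 1 else 0) T"
    using not_acyclic_boundary[OF card_\<rho> facets ac] by blast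
  define h where "h T = (if T = \<rho> then 1 else 0) - g T" for T
  have h_cyc: "boundary h T = 0" for T
    unfolding h_def by (simp add: kdiff_diff additive_id g(2))
  have h_supp: "T \<subseteq> ?W" if "h T \<noteq> 0" for T
    using that g(1)[of T] K by (auto simp: h_def \<rho>_def split: if_splits)
  obtain \<epsilon> :: "'v set \<Rightarrow> 'k" where \<epsilon>: "\<And>T. \<epsilon> T \<noteq> 0"
    "\<And>T. T \<subseteq> ?W \<Longrightarrow> coboundary (\<lambda>S. \<epsilon> S * h (?W - S)) T = 0"
    using cocycle_of_cycle[OF h_cyc h_supp] by blast
  define u where "u S = \<epsilon> S * h (?W - S)" for S
  have \<rho>_not: "\<rho> \<notin> ?K"
  proof
    assume "\<rho> \<in> ?K"
    then obtain x y where "x \<in> X - \<rho>" "y \<in> Y - \<rho>" "E x y" unfolding K by blast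
    then show False using x_in y0(1) disj by (auto simp: \<rho>_def)
  qed
  have u_ind: "u S = 0 \<longleftrightarrow> S \<noteq> {x0, x1, y0}"
    if "S \<subseteq> ?W" "\<And>x y. x \<in> X \<inter> S \<Longrightarrow> y \<in> Y \<inter> S \<Longrightarrow> \<not> E x y" for S
  proof -
    have "?W - S \<notin> ?K" using that unfolding K by blast
    then have "g (?W - S) = 0" using g(1) by blast
    moreover have "?W - S = \<rho> \<longleftrightarrow> S = {x0, x1, y0}"
      using that(1) x_in y0(1) unfolding \<rho>_def by blast
    ultimately show ?thesis using \<epsilon>(1) by (simp add: u_def h_def)
  qed
  have ne: "X \<noteq> {}" "Y \<noteq> {}" using x_in y0(1) by auto
  obtain q :: "'v \<Rightarrow> 'v \<Rightarrow> 'k" where q: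
    "\<And>x y z. x \<in> X \<Longrightarrow> y \<in> Y \<Longrightarrow> z \<in> Y \<Longrightarrow> y \<noteq> z \<Longrightarrow> u {x, y, z} = 0 \<Longrightarrow> q x y = q x z"
    "\<And>x x' y. x \<in> X \<Longrightarrow> x' \<in> X \<Longrightarrow> x \<noteq> x' \<Longrightarrow> y \<in> Y \<Longrightarrow> u {x, x', y} = 0 \<longleftrightarrow> q x y = q x' y"
  proof (rule cocycle_potential[OF disj ne ord, of u])
    show "coboundary u T = 0" if "T \<subseteq> ?W" "card T = 4" for T
      using \<epsilon>(2)[OF that(1)] by (simp add: u_def[abs_def])
    show "u T = 0" if "T \<subseteq> X" "card T = 3" for T
      using u_ind[of T] that(1) y0(1) disj by blast
    show "u T = 0" if "T \<subseteq> Y" "card T = 3" for T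
      using u_ind[of T] that(1) x_in(1) disj by blast
  qed blast+
  define Q where "Q x = q x (SOME y. y \<in> Y \<and> \<not> E x y)" for x
  have Q: "Q x = q x y" if "x \<in> X" "y \<in> Y" "\<not> E x y" for x y
  proof -
    define z where "z = (SOME y. y \<in> Y \<and> \<not> E x y)"
    have z: "z \<in> Y" "\<not> E x z" using someI[of "\<lambda>y. y \<in> Y \<and> \<not> E x y" y] that by (auto simp: z_def)
    have "q x z = q x y"
    proof (cases "z = y")
      case False
      have "u {x, z, y} = 0 \<longleftrightarrow> {x, z, y} \<noteq> {x0, x1, y0}"
      proof (rule u_ind)
        fix x' y' assume "x' \<in> X \<inter> {x, z, y}" "y' \<in> Y \<inter> {x, z, y}"
        then have "x' = x" "y' = z \<or> y' = y" using that z disj by auto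
        then show "\<not> E x' y'" using that z by auto
      qed (use that z in auto)
      moreover have "{x, z, y} \<noteq> {x0, x1, y0}"
        using x_in x01(2) that z disj False by (auto simp: set_eq_iff) metis+
      ultimately show ?thesis using q(1)[OF that(1) z(1) that(2) False] by simp
    qed simp
    then show ?thesis by (simp add: Q_def z_def)
  qed
  have "Q x0 = Q x1"
  proof (rule parity_of_level_sets[OF disj degX _ y0(1) x01])
    fix y assume y: "y \<in> Y" "y \<noteq> y0"
    then obtain x x' where x: "{x \<in> X. \<not> E x y} = {x, x'}" "x \<noteq> x'"
      using degY[OF y(1)] by (auto simp: card_2_iff)
    then have x': "x \<in> X" "x' \<in> X" "\<not> E x y" "\<not> E x' y" by auto
    have "u {x, x', y} = 0 \<longleftrightarrow> {x, x', y} \<noteq> {x0, x1, y0}"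
    proof (rule u_ind)
      fix a b assume "a \<in> X \<inter> {x, x', y}" "b \<in> Y \<inter> {x, x', y}"
      then have "b = y" "a = x \<or> a = x'" using x' y disj by auto
      then show "\<not> E a b" using x' by auto
    qed (use x' y in auto)
    moreover have "{x, x', y} \<noteq> {x0, x1, y0}" using y x' y0(1) x_in disj by auto
    ultimately have "q x y = q x' y" using q(2)[OF x'(1,2) x(2) y(1)] by simp
    then have "Q x = Q x'" using Q x' y(1) by simp
    then show "\<exists>x x'. x \<noteq> x' \<and> {x \<in> X. \<not> E x y} = {x, x'} \<and> Q x = Q x'" using x by blast
  qed
  moreover have "Q x0 \<noteq> Q x1"
  proof -
    have "u {x0, x1, y0} \<noteq> 0"
    proof -
      have "u {x0, x1, y0} = 0 \<longleftrightarrow> {x0, x1, y0} \<noteq> {x0, x1, y0}"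
      proof (rule u_ind)
        fix a b assume "a \<in> X \<inter> {x0, x1, y0}" "b \<in> Y \<inter> {x0, x1, y0}"
        then have "b = y0" "a = x0 \<or> a = x1" using x_in y0(1) disj by auto
        then show "\<not> E a b" using x_in by auto
      qed (use x_in y0(1) in auto)
      then show ?thesis by simp
    qed
    then show ?thesis using q(2)[OF x_in(1,2) x01(2) y0(1)] Q x_in y0(1) by simp
  qed
  ultimately show False by simp
qed

end

section \<open>Homogeneous components\<close>

lemma homogeneous_iff:
  "homogeneous d p \<longleftrightarrow> (\<forall>n. lookup p n \<noteq> 0 \<longrightarrow> int (tdeg n) = d)"
  by (auto simp: homogeneous_def in_keys_iff)

lemma tdeg_add: "tdeg (m + n) = tdeg m + tdeg n"
  by (simp add: tdeg_def lookup_add sum.distrib)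

lemma tdeg_0 [simp]: "tdeg 0 = 0"
  by (simp add: tdeg_def)

lemma tdeg_eq_0: "tdeg n = 0 \<longleftrightarrow> n = 0"
  by (auto simp: tdeg_def poly_mapping_eq_iff fun_eq_iff)

lemma homogeneous_0 [simp]: "homogeneous d 0"
  by (simp add: homogeneous_def)

lemma homogeneous_diff: "homogeneous d p \<Longrightarrow> homogeneous d q \<Longrightarrow> homogeneous d (p - q)"
  by (simp add: homogeneous_iff lookup_minus) metis

lemma homogeneous_mult:
  assumes "homogeneous d p" "homogeneous e q" shows "homogeneous (d + e) (p * q)"
  unfolding homogeneous_def
proof
  fix n assume "n \<in> keys (p * q)"
  then obtain a b where "n = a + b" "a \<in> keys p" "b \<in> keys q"
    using keys_mult[of p q] by blast
  then show "int (tdeg n) = d + e" using assms by (simp add: homogeneous_def tdeg_add)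
qed

lemma homogeneous_Var: "homogeneous 1 (Var v)"
  by (simp add: homogeneous_def Var_def mon_def tdeg_def lookup_single when_def)

lemma homogeneous_negative: "homogeneous d p \<Longrightarrow> d < 0 \<Longrightarrow> p = 0"
  by (rule poly_mapping_eqI) (auto simp: homogeneous_iff)

definition hcomp :: "int \<Rightarrow> ('v::finite, 'k::field) mpol \<Rightarrow> ('v, 'k) mpol" where
  "hcomp d = Poly_Mapping.mapp (\<lambda>n a. if int (tdeg n) = d then a else 0)"

lemma lookup_hcomp:
  "lookup (hcomp d p) n = (if int (tdeg n) = d then lookup p n else 0)"
  by (simp add: hcomp_def lookup_mapp when_def in_keys_iff)

lemma homogeneous_hcomp: "homogeneous d (hcomp d p)"
  by (simp add: homogeneous_iff lookup_hcomp)

lemma hcomp_homogeneous: "homogeneous d p \<Longrightarrow> hcomp d p = p"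
  by (rule poly_mapping_eqI) (auto simp: homogeneous_iff lookup_hcomp)

lemma hcomp_0 [simp]: "hcomp d 0 = 0"
  by (simp add: hcomp_homogeneous)

lemma hcomp_sum: "hcomp d (sum f A) = (\<Sum>x\<in>A. hcomp d (f x))"
  by (rule poly_mapping_eqI) (simp add: lookup_hcomp lookup_sum)

text \<open>
  The remaining part \<open>q\<close> of \<open>p\<close> has no monomial of degree \<open>d\<close>, so \<open>a * q\<close> has none of degree \<open>e + d\<close>.
\<close>

lemma hcomp_mult:
  assumes "homogeneous e a" shows "hcomp (e + d) (a * p) = a * hcomp d p"
proof -
  define q where "q = p - hcomp d p"
  have "hcomp (e + d) (a * q) = 0"
  proof (rule poly_mapping_eqI)
    fix n
    have "lookup (a * q) n = 0" if "int (tdeg n) = e + d"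
    proof (rule ccontr)
      assume "lookup (a * q) n \<noteq> 0"
      then obtain b c where bc: "n = b + c" "b \<in> keys a" "c \<in> keys q"
        using keys_mult[of a q] by (auto simp: in_keys_iff)
      have "int (tdeg b) = e" using assms bc(2) by (simp add: homogeneous_def)
      then have "int (tdeg c) = d" using that bc(1) by (simp add: tdeg_add)
      then show False using bc(3) by (simp add: q_def in_keys_iff lookup_minus lookup_hcomp)
    qed
    then show "lookup (hcomp (e + d) (a * q)) n = lookup 0 n"
      by (simp add: lookup_hcomp)
  qed
  moreover have "a * p = a * hcomp d p + a * q" by (simp add: q_def algebra_simps)
  moreover have "hcomp d (x + y) = hcomp d x + hcomp d y" for d and x y :: "('a, 'b) mpol"
    by (rule poly_mapping_eqI) (simp add: lookup_hcomp lookup_add)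
  ultimately show ?thesis
    using hcomp_homogeneous[OF homogeneous_mult[OF assms homogeneous_hcomp, of d p]] by simp
qed

lemma sum_hcomp:
  assumes "\<And>n. n \<in> keys p \<Longrightarrow> int (tdeg n) \<in> D" "finite D"
  shows "(\<Sum>d\<in>D. hcomp d p) = p"
proof (rule poly_mapping_eqI)
  fix n
  show "lookup (\<Sum>d\<in>D. hcomp d p) n = lookup p n"
    using assms by (cases "lookup p n = 0") (auto simp: lookup_sum lookup_hcomp in_keys_iff)
qed

lemma lookup_Var_times_0: "lookup (Var (v :: 'v::finite) * f) 0 = (0 :: 'k::field)"
  using lookup_Var_times[of v f "\<lambda>_. 0"] monomial_of_lookup[of "0 :: 'v mon"]
  by (simp add: lookup_zero[abs_def])

lemma lookup_mult_0: "lookup (a * b) 0 = lookup a 0 * lookup (b :: ('v::finite, 'k::field) mpol) 0"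
proof -
  have split: "p = single 0 (lookup p 0) + (p - hcomp 0 p)" for p :: "('v, 'k) mpol"
    by (rule poly_mapping_eqI) (auto simp: lookup_add lookup_minus lookup_hcomp lookup_single when_def tdeg_eq_0)
  have zero: "lookup (p * q) 0 = 0" if "lookup q 0 = 0" for p q :: "('v, 'k) mpol"
  proof (rule ccontr)
    assume "lookup (p * q) 0 \<noteq> 0"
    then obtain b c where bc: "0 = b + c" "b \<in> keys p" "c \<in> keys q"
      using keys_mult[of p q] by (auto simp: in_keys_iff)
    have "tdeg c = 0" using bc(1) tdeg_add[of b c] by simp
    then show False using bc(3) that by (simp add: tdeg_eq_0 in_keys_iff)
  qed
  define a' b' where "a' = a - hcomp 0 a" and "b' = b - hcomp 0 b"
  have z: "lookup a' 0 = 0" "lookup b' 0 = 0"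
    by (simp_all add: a'_def b'_def lookup_minus lookup_hcomp)
  let ?a = "single 0 (lookup a 0) :: ('v, 'k) mpol"
    and ?b = "single 0 (lookup b 0) :: ('v, 'k) mpol"
  have "a * b = ?a * ?b + ?b * a' + a * b'"
  proof -
    have "a * b = a * (?b + b')" using split[of b] by (simp add: b'_def)
    also have "\<dots> = (?a + a') * ?b + a * b'" using split[of a] by (simp add: a'_def algebra_simps)
    finally show ?thesis by (simp add: algebra_simps)
  qed
  then have "lookup (a * b) 0 = lookup (?a * ?b) 0"
    by (simp only: lookup_add zero[OF z(1)] zero[OF z(2)] add_0_right)
  then show ?thesis by (simp add: mult_single)
qed

lemma irrelevant_ideal_lookup_0:
  "p \<in> irrelevant_ideal \<Longrightarrow> lookup (p :: ('v::finite, 'k::field) mpol) 0 = 0"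
  unfolding irrelevant_ideal_def ideal_generated_def
proof (induction rule: module.span_induct_alt[OF module_times, consumes 1, case_names base step])
  case (step c x y)
  then show ?case by (auto simp: lookup_add lookup_mult_0 lookup_Var_times_0[of _ 1, simplified])
qed simp

subsection \<open>Graded submodules of free modules\<close>

definition vscale :: "'a::comm_ring_1 \<Rightarrow> (nat \<Rightarrow> 'a) \<Rightarrow> nat \<Rightarrow> 'a" where
  "vscale a f = (\<lambda>k. a * f k)"

interpretation vec_module: module "vscale :: 'a::comm_ring_1 \<Rightarrow> _"
proof (rule module.intro)
  fix a b :: 'a and x y :: "nat \<Rightarrow> 'a"
  show "vscale a (x + y) = vscale a x + vscale a y" "vscale (a + b) x = vscale a x + vscale b x"
    by (auto simp add: fun_eq_iff vscale_def distrib_left distrib_right)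
  show "vscale a (vscale b x) = vscale (a * b) x" "vscale 1 x = x"
    by (auto simp add: fun_eq_iff vscale_def mult.assoc)
qed

text \<open>
  Homogeneity for the grading where the \<open>k\<close>-th basis vector has degree \<open>s k\<close>.
\<close>

definition vhom :: "(nat \<Rightarrow> int) \<Rightarrow> int \<Rightarrow> (nat \<Rightarrow> ('v::finite, 'k::field) mpol) \<Rightarrow> bool" where
  "vhom s d f \<longleftrightarrow> (\<forall>k. homogeneous (d - s k) (f k))"

definition vcomp :: "(nat \<Rightarrow> int) \<Rightarrow> int \<Rightarrow> (nat \<Rightarrow> ('v::finite, 'k::field) mpol) \<Rightarrow> nat \<Rightarrow> ('v, 'k) mpol" where
  "vcomp s d f = (\<lambda>k. hcomp (d - s k) (f k))"

definition graded_submodule ::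
    "nat \<Rightarrow> (nat \<Rightarrow> int) \<Rightarrow> (nat \<Rightarrow> ('v::finite, 'k::field) mpol) set \<Rightarrow> bool" where
  "graded_submodule r s Z \<longleftrightarrow> Z \<subseteq> free_module r \<and> module.subspace vscale Z \<and> (\<forall>d. \<forall>f\<in>Z. vcomp s d f \<in> Z)"

lemma vector_sum_apply: "(\<Sum>x\<in>A. f x) k = (\<Sum>x\<in>A. f x k :: 'a::comm_monoid_add)"
  by (induction A rule: infinite_finite_induct) auto

lemma vhom_vcomp: "vhom s d (vcomp s d f)"
  by (simp add: vhom_def vcomp_def homogeneous_hcomp)

lemma vcomp_vhom: "vhom s d f \<Longrightarrow> vcomp s d f = f"
  by (simp add: vhom_def vcomp_def hcomp_homogeneous)

lemma strand_vhom: "strand Z s j T = {f \<in> Z. vhom s (j - int (card T)) f}"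
  by (simp add: strand_def vhom_def)

lemma subspace_free_module: "module.subspace vscale (free_module r)"
  by (simp add: vec_module.subspace_def free_module_def vscale_def)

lemma free_module_zero: "f \<in> free_module r \<Longrightarrow> \<not> k < r \<Longrightarrow> f k = 0"
  by (simp add: free_module_def)

lemma mat_map_additive: "additive (mat_map r r' A)"
  by unfold_locales (simp add: mat_map_def fun_eq_iff distrib_left sum.distrib)

lemma mat_map_vscale: "mat_map r r' A (vscale a f) = vscale a (mat_map r r' A f)"
  by (simp add: mat_map_def vscale_def fun_eq_iff sum_distrib_left mult_ac)

definition homogeneous_matrix ::
    "nat \<Rightarrow> (nat \<Rightarrow> int) \<Rightarrow> nat \<Rightarrow> (nat \<Rightarrow> int) \<Rightarrow> (nat \<Rightarrow> nat \<Rightarrow> ('v::finite, 'k::field) mpol) \<Rightarrow> bool" where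
  "homogeneous_matrix r s r' s' A \<longleftrightarrow> (\<forall>k<r. \<forall>l<r'. homogeneous (s' l - s k) (A k l))"

lemma vcomp_mat_map:
  assumes "homogeneous_matrix r s r' s' A"
  shows "vcomp s d (mat_map r r' A f) = mat_map r r' A (vcomp s' d f)"
proof
  fix k
  have "hcomp (d - s k) (A k l * f l) = A k l * hcomp (d - s' l) (f l)" if "k < r" "l < r'" for l
  proof -
    have "homogeneous (s' l - s k) (A k l)" using assms that by (simp add: homogeneous_matrix_def)
    from hcomp_mult[OF this, of "d - s' l" "f l"] show ?thesis by simp
  qed
  then show "vcomp s d (mat_map r r' A f) k = mat_map r r' A (vcomp s' d f) k"
    by (simp add: vcomp_def mat_map_def hcomp_sum)
qed

lemma vcomp_free: "f \<in> free_module r \<Longrightarrow> vcomp s d f \<in> free_module r"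
  by (simp add: free_module_def vcomp_def)

definition mat_kernel ::
    "nat \<Rightarrow> nat \<Rightarrow> (nat \<Rightarrow> nat \<Rightarrow> 'a::comm_ring_1) \<Rightarrow> (nat \<Rightarrow> 'a) set" where
  "mat_kernel r r' A = {f \<in> free_module r'. mat_map r r' A f = (\<lambda>_. 0)}"

lemma graded_mat_kernel:
  assumes "homogeneous_matrix r s r' s' A"
  shows "graded_submodule r' s' (mat_kernel r r' A)"
  unfolding graded_submodule_def
proof (intro conjI allI ballI)
  show "module.subspace vscale (mat_kernel r r' A)"
    using subspace_free_module[of r'] mat_map_additive[of r r' A]
    by (auto simp: vec_module.subspace_def mat_kernel_def mat_map_vscale additive.add additive.zero
        zero_fun_def[symmetric])
next
  fix d f assume "f \<in> mat_kernel r r' A"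
  then show "vcomp s' d f \<in> mat_kernel r r' A"
    using vcomp_mat_map[OF assms, of d f] by (auto simp: mat_kernel_def vcomp_free vcomp_def[of s])
qed (auto simp: mat_kernel_def)

context vertex_order
begin

lemma exact_at_zero_chain:
  assumes X: "\<And>v. X v 0 = 0" and C: "\<And>T. 0 \<in> C T"
    and c: "\<And>T. T \<noteq> {} \<Longrightarrow> c T = 0" and b: "\<And>v. b v \<in> C {v}" "(\<Sum>v\<in>UNIV. X v (b v)) = c {}"
  shows "\<exists>g\<in>chains C (Suc 0). \<forall>T. kdiff X g T = c T"
proof (intro bexI[of _ "\<lambda>T. if card T = Suc 0 then b (the_elem T) else 0"] allI)
  let ?g = "\<lambda>T. if card T = Suc 0 then b (the_elem T) else 0"
  show "?g \<in> chains C (Suc 0)"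
    using b(1) C by (auto intro!: chainsI simp: card_Suc_eq)
  show "kdiff X ?g T = c T" for T
  proof (cases "T = {}")
    case True
    then show ?thesis using b(2) by (simp add: kdiff_def signed_def)
  next
    case False
    have "card (insert v T) \<noteq> Suc 0" if "v \<notin> T" for v using that False by simp
    then have "kdiff X ?g T = 0" unfolding kdiff_def using X by (intro sum.neutral) auto
    then show ?thesis using c[OF False] by simp
  qed
qed

text \<open>
  Koszul homology in degree \<open>0\<close> is the quotient \<open>Z / (x\<^sub>1, \<dots>, x\<^sub>n) Z\<close>.
\<close>

lemma exact_at_zero:
  assumes X: "\<And>v. X v 0 = 0" and C: "\<And>T. 0 \<in> C T"
  shows "exact_at X C 0 \<longleftrightarrow> (\<forall>z\<in>C {}. \<exists>b. (\<forall>v. b v \<in> C {v}) \<and> (\<Sum>v\<in>UNIV. X v (b v)) = z)"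
proof
  assume ex: "exact_at X C 0"
  show "\<forall>z\<in>C {}. \<exists>b. (\<forall>v. b v \<in> C {v}) \<and> (\<Sum>v\<in>UNIV. X v (b v)) = z"
  proof
    fix z assume z: "z \<in> C {}"
    define c where "c T = (if T = {} then z else 0)" for T :: "'v set"
    have "c \<in> chains C 0" using z C by (auto intro!: chainsI simp: c_def)
    moreover have "kdiff X c T = 0" for T by (simp add: kdiff_def c_def X)
    ultimately obtain g where g: "g \<in> chains C (Suc 0)" "\<And>T. kdiff X g T = c T"
      using exact_atD[OF ex] by metis
    have "(\<Sum>v\<in>UNIV. X v (g {v})) = z" using g(2)[of "{}"] by (simp add: kdiff_def signed_def c_def)
    then show "\<exists>b. (\<forall>v. b v \<in> C {v}) \<and> (\<Sum>v\<in>UNIV. X v (b v)) = z"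
      using chains_mem[OF g(1)] by (intro exI[of _ "\<lambda>v. g {v}"]) auto
  qed
next
  assume R: "\<forall>z\<in>C {}. \<exists>b. (\<forall>v. b v \<in> C {v}) \<and> (\<Sum>v\<in>UNIV. X v (b v)) = z"
  show "exact_at X C 0"
    unfolding exact_at_def
  proof (intro ballI impI)
    fix c assume c: "c \<in> chains C 0"
    obtain b where b: "\<And>v. b v \<in> C {v}" "(\<Sum>v\<in>UNIV. X v (b v)) = c {}"
      using R chains_mem[OF c, of "{}"] by blast
    show "\<exists>b\<in>chains C (Suc 0). \<forall>T. kdiff X b T = c T"
      by (rule exact_at_zero_chain[where X = X and C = C and c = c and b = b, OF X C _ b]) (use chains_card[OF c] in auto)
  qed
qed

lemma upper_koszul_True: "upper_koszul (\<lambda>_. True) m = Pow (supp m)"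
  by (auto simp: upper_koszul_def)

lemma acyclic_simplex:
  assumes "supp m \<noteq> {} \<or> p \<noteq> 0"
  shows "acyclic_at TYPE('k::field) (upper_koszul (\<lambda>_. True) m) p"
proof (cases "supp m = {}")
  case True
  then show ?thesis
    using assms unfolding acyclic_at_iff upper_koszul_True
    by (auto intro!: exI[of _ "\<lambda>_. 0"] simp: kdiff_def)
next
  case False
  then obtain v where "v \<in> supp m" by blast
  then show ?thesis by (intro acyclic_cone[of _ v]) (auto simp: upper_koszul_True)
qed

lemma free_module_monomial_power: "free_module r = monomial_power r (\<lambda>_. True)"
  by (simp add: monomial_power_def)

text \<open>
  In a multidegree \<open>m\<close> the complex is the full simplex on the support of \<open>m\<close>, which is acyclic unless
  \<open>m = 0\<close> and the degree is \<open>0\<close>.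
\<close>

lemma exact_free_module:
  "exact_at var_scale (strand (free_module r) s j :: 'v set \<Rightarrow> (nat \<Rightarrow> ('v, 'k::field) mpol) set) (Suc p)"
  unfolding free_module_monomial_power exact_monomial_power by (simp add: acyclic_simplex)

lemma irrelevant_decomposition:
  fixes p :: "('v, 'k::field) mpol"
  assumes "homogeneous d p" "lookup p 0 = 0"
  obtains g where "\<And>v. homogeneous (d - 1) (g v)" "(\<Sum>v\<in>UNIV. Var v * g v) = p"
proof (cases "d = 0")
  case True
  have "p = 0"
  proof (rule poly_mapping_eqI)
    fix n show "lookup p n = lookup 0 n"
      using assms True by (cases "n = 0") (auto simp: homogeneous_iff tdeg_eq_0)
  qed
  then show ?thesis using that[of "\<lambda>_. 0"] by simp
next
  case False
  have part: "monomial_part (\<lambda>_. True) d T = {f :: ('v, 'k) mpol. homogeneous (d - int (card T)) f}" for T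
    by (simp add: monomial_part_def homogeneous_def)
  have "acyclic_at TYPE('k) (upper_koszul (\<lambda>_. True) m) 0" if "int (sum m UNIV) = d" for m
  proof (rule acyclic_simplex)
    have "m = (\<lambda>_. 0)" if "supp m = {}" using that by (auto simp: supp_def)
    then show "supp m \<noteq> {} \<or> 0 \<noteq> (0 :: nat)" using that False by force
  qed
  then have "exact_at (\<lambda>v f. Var v * f) (monomial_part (\<lambda>_. True) d :: 'v set \<Rightarrow> ('v, 'k) mpol set) 0"
    by (simp add: exact_monomial_part)
  then have "\<exists>b. (\<forall>v. b v \<in> monomial_part (\<lambda>_. True) d {v}) \<and> (\<Sum>v\<in>UNIV. Var v * b v) = p"
    using assms(1) by (subst (asm) exact_at_zero) (auto simp: part)
  then show ?thesis using that by (auto simp: part)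
qed

lemma irrelevant_vector_decomposition:
  fixes f :: "nat \<Rightarrow> ('v, 'k::field) mpol"
  assumes "f \<in> free_module r" "vhom s j f" "\<And>l. l < r \<Longrightarrow> lookup (f l) 0 = 0"
  obtains b where "\<And>v. b v \<in> strand (free_module r) s j {v}" "(\<Sum>v\<in>UNIV. var_scale v (b v)) = f"
proof -
  have "\<exists>g. (\<forall>v. homogeneous (j - s l - 1) (g v)) \<and> (\<Sum>v\<in>UNIV. Var v * g v) = f l" if "l < r" for l
    using irrelevant_decomposition[OF _ assms(3)[OF that], of "j - s l"] assms(2) by (metis vhom_def)
  then obtain g where g: "\<And>l v. l < r \<Longrightarrow> homogeneous (j - s l - 1) (g l v)"
    "\<And>l. l < r \<Longrightarrow> (\<Sum>v\<in>UNIV. Var v * g l v) = f l" by metis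
  define b where "b v = (\<lambda>l. if l < r then g l v else 0)" for v
  have "b v \<in> strand (free_module r) s j {v}" for v
    using g(1) by (simp add: strand_def free_module_def b_def algebra_simps)
  moreover have "(\<Sum>v\<in>UNIV. var_scale v (b v)) = f"
  proof
    fix l show "(\<Sum>v\<in>UNIV. var_scale v (b v)) l = f l"
      using g(2)[of l] free_module_zero[OF assms(1), of l] by (cases "l < r") (simp_all add: b_def vector_sum_apply)
  qed
  ultimately show ?thesis using that by blast
qed

end

section \<open>Betti numbers from Koszul homology\<close>

definition in_max_ideal :: "nat \<Rightarrow> (nat \<Rightarrow> ('v::finite, 'k::field) mpol) \<Rightarrow> bool" where
  "in_max_ideal r f \<longleftrightarrow> (\<forall>l<r. lookup (f l) 0 = 0)"

text \<open>
  One step of a minimal resolution: a homogeneous presentation of \<open>Z\<close> by generators of degrees \<open>s' l\<close>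
  such that no relation has a nonzero constant coefficient.
\<close>

locale minimal_cover = vertex_order ord for ord :: "'v::finite \<Rightarrow> nat" +
  fixes r :: nat and s :: "nat \<Rightarrow> int" and Z :: "(nat \<Rightarrow> ('v, 'k::field) mpol) set"
    and r' :: nat and s' :: "nat \<Rightarrow> int" and A :: "nat \<Rightarrow> nat \<Rightarrow> ('v, 'k) mpol"
  assumes homog: "homogeneous_matrix r s r' s' A"
    and image: "mat_map r r' A ` free_module r' = Z"
    and minimal: "f \<in> mat_kernel r r' A \<Longrightarrow> in_max_ideal r' f"
begin

lemma lift_homogeneous:
  assumes "z \<in> Z" "vhom s d z"
  obtains f where "f \<in> free_module r'" "vhom s' d f" "mat_map r r' A f = z"
proof -
  obtain f where f: "f \<in> free_module r'" "mat_map r r' A f = z" using assms(1) image by blast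
  show ?thesis
    using that[of "vcomp s' d f"] f vcomp_mat_map[OF homog, of d f] vcomp_vhom[OF assms(2)]
    by (simp add: vcomp_free vhom_vcomp)
qed

lemma mat_map_vhom:
  assumes "vhom s' d f" shows "vhom s d (mat_map r r' A f)"
  using vcomp_mat_map[OF homog, of d f] vcomp_vhom[OF assms] vhom_vcomp[of s d "mat_map r r' A f"] by simp

lemma koszul_sequence_cover:
  "koszul_sequence ord var_scale var_scale (mat_map r r' A)
    (strand (mat_kernel r r' A) s' j) (strand (free_module r') s' j) (strand Z s j)"
proof
  show "mat_map r r' A ` strand (free_module r') s' j T = strand Z s j T" for T
  proof
    show "mat_map r r' A ` strand (free_module r') s' j T \<subseteq> strand Z s j T"
      using mat_map_vhom image by (auto simp: strand_vhom)
    show "strand Z s j T \<subseteq> mat_map r r' A ` strand (free_module r') s' j T"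
    proof
      fix z assume "z \<in> strand Z s j T"
      then have "z \<in> Z" "vhom s (j - int (card T)) z" by (auto simp: strand_vhom)
      then obtain f where "f \<in> free_module r'" "vhom s' (j - int (card T)) f" "mat_map r r' A f = z"
        by (rule lift_homogeneous)
      then show "z \<in> mat_map r r' A ` strand (free_module r') s' j T" by (auto simp: strand_vhom)
    qed
  qed
  show "strand (mat_kernel r r' A) s' j T = {b \<in> strand (free_module r') s' j T. mat_map r r' A b = 0}" for T
    by (auto simp: strand_def mat_kernel_def zero_fun_def)
  show "var_scale v (var_scale w b) = var_scale w (var_scale v b)" for v w and b :: "nat \<Rightarrow> ('v, 'k) mpol"
    by (simp add: mult.left_commute)
  show "mat_map r r' A (var_scale v b) = var_scale v (mat_map r r' A b)" for v b
    using mat_map_vscale[of r r' A "Var v" b] by (simp add: vscale_def)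
  show "var_scale v (x + y) = var_scale v x + var_scale v y" for v and x y :: "nat \<Rightarrow> ('v, 'k) mpol"
    by (simp add: fun_eq_iff distrib_left)
  show "mat_map r r' A (x + y) = mat_map r r' A x + mat_map r r' A y" for x y
    by (rule additive.add[OF mat_map_additive])
  show "a - b \<in> strand (free_module r') s' j T"
    if "a \<in> strand (free_module r') s' j T" "b \<in> strand (free_module r') s' j T" for a b T
    using that by (auto simp: strand_def free_module_def intro: homogeneous_diff)
  show "var_scale v b \<in> strand (free_module r') s' j T"
    if "v \<notin> T" "b \<in> strand (free_module r') s' j (insert v T)" for v T b
  proof -
    have "homogeneous (j - int (card T) - s' k) (Var v * b k)" for k
    proof -
      have "homogeneous (j - int (card (insert v T)) - s' k) (b k)" using that(2) by (simp add: strand_def)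
      from homogeneous_mult[OF homogeneous_Var this, of v] show ?thesis
        using that(1) by (simp add: algebra_simps)
    qed
    then show ?thesis using that(2) by (simp add: strand_def free_module_def)
  qed
qed (simp add: strand_def free_module_def)

text \<open>
  The dimension shift along \<open>0 \<rightarrow> kernel \<rightarrow> R\<^sup>r\<^sup>' \<rightarrow> Z \<rightarrow> 0\<close>. In degree \<open>0\<close>, minimality says that elements of the
  kernel are combinations of the variables, hence boundaries in the free module.
\<close>

lemma exact_cover:
  "exact_at var_scale (strand Z s j) (Suc p) \<longleftrightarrow> exact_at var_scale (strand (mat_kernel r r' A) s' j) p"
proof -
  interpret K: koszul_sequence ord var_scale var_scale "mat_map r r' A"
    "strand (mat_kernel r r' A) s' j" "strand (free_module r') s' j" "strand Z s j"
    by (rule koszul_sequence_cover)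
  show ?thesis
  proof
    assume Z: "exact_at var_scale (strand Z s j) (Suc p)"
    show "exact_at var_scale (strand (mat_kernel r r' A) s' j) p"
    proof (rule K.exact_kernel[OF _ Z])
      fix c assume c: "c \<in> chains (strand (mat_kernel r r' A) s' j) p" and cyc: "\<And>T. kdiff var_scale c T = 0"
      have cF: "c \<in> chains (strand (free_module r') s' j) p" using c by (simp add: K.chains_K)
      show "\<exists>b\<in>chains (strand (free_module r') s' j) (Suc p). \<forall>T. kdiff var_scale b T = c T"
      proof (cases p)
        case 0
        have "c {} \<in> strand (mat_kernel r r' A) s' j {}" by (rule chains_mem[OF c])
        then have c0: "c {} \<in> free_module r'" "vhom s' j (c {})" "in_max_ideal r' (c {})"
          using minimal by (auto simp: strand_vhom mat_kernel_def)
        obtain b where b: "\<And>v. b v \<in> strand (free_module r') s' j {v}" "(\<Sum>v\<in>UNIV. var_scale v (b v)) = c {}"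
          using irrelevant_vector_decomposition[OF c0(1,2)] c0(3) unfolding in_max_ideal_def by blast
        show ?thesis
          unfolding 0
          by (rule exact_at_zero_chain[where X = var_scale and b = b and c = c])
            (use b K.F_0 chains_card[OF c] 0 in \<open>auto simp: zero_fun_def\<close>)
      next
        case (Suc q)
        show ?thesis
          using exact_atD[OF exact_free_module cF[unfolded Suc]] cyc unfolding Suc by metis
      qed
    qed
  next
    assume "exact_at var_scale (strand (mat_kernel r r' A) s' j) p"
    then show "exact_at var_scale (strand Z s j) (Suc p)"
      by (rule K.exact_image[OF exact_free_module])
  qed
qed

text \<open>
  By Nakayama: if the image of the \<open>l\<close>-th basis vector were a combination of variables times elements of
  \<open>Z\<close>, lifting this combination would give a relation with constant coefficient \<open>1\<close> at \<open>l\<close>.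
\<close>

lemma exact_cover_zero:
  "exact_at var_scale (strand Z s j) 0 \<longleftrightarrow> \<not> (\<exists>l<r'. s' l = j)"
proof -
  interpret K: koszul_sequence ord var_scale var_scale "mat_map r r' A"
    "strand (mat_kernel r r' A) s' j" "strand (free_module r') s' j" "strand Z s j"
    by (rule koszul_sequence_cover)
  have zero: "var_scale v 0 = 0" for v by (simp add: zero_fun_def)
  have f_sum: "mat_map r r' A (\<Sum>v\<in>UNIV. var_scale v (b v)) = (\<Sum>v\<in>UNIV. var_scale v (mat_map r r' A (b v)))" for b
    by (simp add: additive.sum[OF mat_map_additive] K.f_X)
  show ?thesis
    unfolding exact_at_zero[of var_scale "strand Z s j", OF zero K.Z_0]
  proof
    assume R: "\<forall>z\<in>strand Z s j {}. \<exists>b. (\<forall>v. b v \<in> strand Z s j {v}) \<and> (\<Sum>v\<in>UNIV. var_scale v (b v)) = z"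
    show "\<not> (\<exists>l<r'. s' l = j)"
    proof (intro notI, elim exE conjE)
      fix l assume l: "l < r'" "s' l = j"
      define e where "e = (\<lambda>k. if k = l then 1 else 0 :: ('v, 'k) mpol)"
      have e: "e \<in> free_module r'" "vhom s' j e"
        using l by (auto simp: e_def free_module_def vhom_def homogeneous_iff lookup_one when_def)
      then have "mat_map r r' A e \<in> strand Z s j {}" using K.f_surj[of "{}"] by (auto simp: strand_vhom)
      then obtain b where b: "\<And>v. b v \<in> strand Z s j {v}" "(\<Sum>v\<in>UNIV. var_scale v (b v)) = mat_map r r' A e"
        using R by blast
      have "\<exists>g. g \<in> strand (free_module r') s' j {v} \<and> mat_map r r' A g = b v" for v
        using b(1)[of v] K.f_surj[of "{v}"] by (metis imageE)
      then obtain g where g: "\<And>v. g v \<in> strand (free_module r') s' j {v}" "\<And>v. mat_map r r' A (g v) = b v"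
        by metis
      define w where "w = e - (\<Sum>v\<in>UNIV. var_scale v (g v))"
      have "mat_map r r' A w = 0"
        by (simp add: w_def additive.diff[OF mat_map_additive] f_sum g(2) b(2))
      moreover have "w \<in> free_module r'"
        using g(1) e(1) by (auto simp: w_def free_module_def strand_def vector_sum_apply)
      ultimately have "w \<in> mat_kernel r r' A" by (simp add: mat_kernel_def zero_fun_def)
      then have "lookup (w l) 0 = 0" using minimal l(1) by (simp add: in_max_ideal_def)
      moreover have "lookup (w l) 0 = 1"
        by (simp add: w_def e_def lookup_minus vector_sum_apply lookup_sum lookup_Var_times_0)
      ultimately show False by simp
    qed
  next
    assume none: "\<not> (\<exists>l<r'. s' l = j)"
    show "\<forall>z\<in>strand Z s j {}. \<exists>b. (\<forall>v. b v \<in> strand Z s j {v}) \<and> (\<Sum>v\<in>UNIV. var_scale v (b v)) = z"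
    proof
      fix z assume "z \<in> strand Z s j {}"
      then obtain f where f: "f \<in> free_module r'" "vhom s' j f" "mat_map r r' A f = z"
        using lift_homogeneous[of z j] by (auto simp: strand_vhom)
      have "lookup (f l) 0 = 0" if "l < r'" for l
      proof (rule ccontr)
        assume "lookup (f l) 0 \<noteq> 0"
        then have "int (tdeg (0 :: 'v mon)) = j - s' l" using f(2) unfolding vhom_def homogeneous_iff by blast
        then show False using none that by auto
      qed
      then obtain b where b: "\<And>v. b v \<in> strand (free_module r') s' j {v}" "(\<Sum>v\<in>UNIV. var_scale v (b v)) = f"
        using irrelevant_vector_decomposition[OF f(1,2)] by blast
      have "mat_map r r' A (b v) \<in> strand Z s j {v}" for v using b(1)[of v] K.f_surj[of "{v}"] by blast
      moreover have "(\<Sum>v\<in>UNIV. var_scale v (mat_map r r' A (b v))) = z"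
        using f_sum[of b] b(2) f(3) by simp
      ultimately show "\<exists>b. (\<forall>v. b v \<in> strand Z s j {v}) \<and> (\<Sum>v\<in>UNIV. var_scale v (b v)) = z"
        by (intro exI[of _ "\<lambda>v. mat_map r r' A (b v)"]) auto
    qed
  qed
qed

end

definition monomial_ideal :: "(('v \<Rightarrow> nat) \<Rightarrow> bool) \<Rightarrow> ('v::finite, 'k::field) mpol set" where
  "monomial_ideal A = {f. \<forall>n\<in>keys f. A (lookup n)}"

context vertex_order
begin

text \<open>
  The resolution is cut into short exact sequences. To treat the augmentation like the other maps, the
  ideal is viewed as a submodule of \<open>R\<^sup>1\<close>, so that indices move up by one.
\<close>

theorem resolution_shifts:
  fixes F :: "('v, 'k::field) mpol graded_free_complex"
  assumes "minimal_graded_free_resolution (monomial_ideal A) F"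
  shows "(\<exists>l<rk F i. shift F i l = j) \<longleftrightarrow>
    (\<exists>m. int (sum m UNIV) = j \<and> \<not> acyclic_at TYPE('k) (upper_koszul A m) i)"
proof -
  have res: "graded_free_resolution (monomial_ideal A) F"
    and min: "\<And>i k l. k < rk F i \<Longrightarrow> l < rk F (Suc i) \<Longrightarrow> dmat F i k l \<in> irrelevant_ideal"
    using assms by (auto simp: minimal_graded_free_resolution_def)
  define R where "R i = (case i of 0 \<Rightarrow> 1 | Suc i \<Rightarrow> rk F i)" for i
  define S where "S i = (case i of 0 \<Rightarrow> \<lambda>_. 0 | Suc i \<Rightarrow> shift F i)" for i
  define M where "M i = (case i of 0 \<Rightarrow> \<lambda>_ l. aug F l | Suc i \<Rightarrow> dmat F i)" for i
  define Z where "Z i = (case i of 0 \<Rightarrow> monomial_power 1 A | Suc i \<Rightarrow> mat_kernel (R i) (R (Suc i)) (M i))" for i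
  have M0: "mat_map (Suc 0) (rk F 0) (\<lambda>_ l. aug F l) f = (\<lambda>k. if k = 0 then aug_map F f else 0)" for f
    by (auto simp: mat_map_def aug_map_def fun_eq_iff)
  have Z0: "monomial_power 1 A = {f \<in> free_module 1. f 0 \<in> monomial_ideal A}"
    by (simp add: monomial_power_def monomial_ideal_def)
  have image: "mat_map (R i) (R (Suc i)) (M i) ` free_module (R (Suc i)) = Z i" for i
  proof (cases i)
    case 0
    have im: "aug_map F ` free_module (rk F 0) = monomial_ideal A"
      using res by (simp add: graded_free_resolution_def)
    have "mat_map (Suc 0) (rk F 0) (\<lambda>_ l. aug F l) ` free_module (rk F 0) =
        (\<lambda>a k. if k = (0::nat) then a else 0) ` monomial_ideal A"
      unfolding im[symmetric] image_image M0 by simp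
    also have "\<dots> = {f \<in> free_module 1. f 0 \<in> monomial_ideal A}" (is "?L = ?R")
    proof
      show "?R \<subseteq> ?L"
      proof
        fix f :: "nat \<Rightarrow> ('v, 'k) mpol" assume f: "f \<in> ?R"
        then have "f = (\<lambda>k. if k = 0 then f 0 else 0)" by (auto simp: free_module_def)
        then show "f \<in> ?L" using f by blast
      qed
    qed (auto simp: free_module_def)
    finally show ?thesis unfolding 0 Z_def Z0 R_def M_def by (simp add: Z0[simplified])
  next
    case (Suc i')
    then show ?thesis
    proof (cases i')
      case 0
      have "{f \<in> free_module (rk F 0). aug_map F f = 0} = mat_kernel (Suc 0) (rk F 0) (\<lambda>_ l. aug F l)"
        by (auto simp: mat_kernel_def M0 fun_eq_iff)
      then show ?thesis
        using res unfolding graded_free_resolution_def diff_map_def Suc 0 by (simp add: R_def M_def Z_def)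
    next
      case (Suc i'')
      then show ?thesis
        using res \<open>i = Suc i'\<close> unfolding graded_free_resolution_def diff_map_def
        by (simp add: R_def M_def Z_def mat_kernel_def)
    qed
  qed
  have cover: "minimal_cover ord (R i) (S i) (Z i) (R (Suc i)) (S (Suc i)) (M i)" for i
  proof
    show "homogeneous_matrix (R i) (S i) (R (Suc i)) (S (Suc i)) (M i)"
      using res by (cases i) (simp_all add: graded_free_resolution_def homogeneous_matrix_def R_def S_def M_def)
    show "mat_map (R i) (R (Suc i)) (M i) ` free_module (R (Suc i)) = Z i" by (rule image)
    fix f assume "f \<in> mat_kernel (R i) (R (Suc i)) (M i)"
    then have "f \<in> Z (Suc i)" by (simp add: Z_def)
    then obtain g where g: "f = mat_map (R (Suc i)) (R (Suc (Suc i))) (M (Suc i)) g"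
      using image[of "Suc i"] by blast
    have "lookup (dmat F i k l) 0 = 0" if "k < rk F i" "l < rk F (Suc i)" for k l
      using irrelevant_ideal_lookup_0[OF min[OF that]] .
    then show "in_max_ideal (R (Suc i)) f"
      by (simp add: in_max_ideal_def g mat_map_def R_def M_def lookup_sum lookup_mult_0)
  qed
  have shift: "exact_at var_scale (strand (Z 0) (S 0) j) (i + p) \<longleftrightarrow> exact_at var_scale (strand (Z i) (S i) j) p" for i p
  proof (induction i arbitrary: p)
    case (Suc i)
    show ?case
      using Suc[of "Suc p"] minimal_cover.exact_cover[OF cover[of i], of j p] by (simp add: Z_def)
  qed simp
  have "exact_at var_scale (strand (Z 0) (S 0) j) i \<longleftrightarrow> \<not> (\<exists>l<rk F i. shift F i l = j)"
    using shift[of i 0] minimal_cover.exact_cover_zero[OF cover[of i], of j] by (simp add: R_def S_def)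
  moreover have "exact_at var_scale (strand (Z 0) (S 0) j) i \<longleftrightarrow>
      (\<forall>m. int (sum m UNIV) = j \<longrightarrow> acyclic_at TYPE('k) (upper_koszul A m) i)"
    by (simp add: Z_def S_def exact_monomial_power)
  ultimately show ?thesis by blast
qed

end

section \<open>Existence of minimal graded free resolutions\<close>

definition kscale :: "'k::field \<Rightarrow> (nat \<Rightarrow> ('v::finite, 'k) mpol) \<Rightarrow> nat \<Rightarrow> ('v, 'k) mpol" where
  "kscale c f = vscale (single 0 c) f"

interpretation coefficient_space: vector_space "kscale :: 'k::field \<Rightarrow> (nat \<Rightarrow> ('v::finite, 'k) mpol) \<Rightarrow> _"
proof
  fix a b :: 'k and x y :: "nat \<Rightarrow> ('v, 'k) mpol"
  show "kscale a (x + y) = kscale a x + kscale a y"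
    by (simp add: kscale_def vec_module.scale_right_distrib)
  show "kscale (a + b) x = kscale a x + kscale b x"
    by (simp add: kscale_def single_add vec_module.scale_left_distrib)
  show "kscale a (kscale b x) = kscale (a * b) x"
    by (simp add: kscale_def mult_single)
  show "kscale 1 x = x" by (simp add: kscale_def)
qed

lemma sum_single_lookup: "(\<Sum>n\<in>keys f. single n (lookup f n)) = f"
proof (rule poly_mapping_eqI)
  fix n
  show "lookup (\<Sum>n\<in>keys f. single n (lookup f n)) n
      = lookup f n"
    by (cases "n \<in> keys f") (auto simp: lookup_sum lookup_single when_def in_keys_iff)
qed

lemma finite_monomials_of_degree: "finite {n :: 'v::finite mon. int (tdeg n) = d}"
proof -
  have "{n :: 'v mon. int (tdeg n) = d} \<subseteq> monomial_of ` {m. sum m UNIV \<le> nat d}"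
  proof
    fix n :: "'v mon" assume "n \<in> {n. int (tdeg n) = d}"
    then have "int (sum (lookup n) UNIV) = d" unfolding tdeg_def mem_Collect_eq .
    then have "sum (lookup n) UNIV \<le> nat d" by (metis nat_int order_refl)
    then show "n \<in> monomial_of ` {m. sum m UNIV \<le> nat d}"
      by (intro image_eqI[of _ _ "lookup n"]) auto
  qed
  then show ?thesis using finite_bounded_degree finite_surj by blast
qed

lemma finite_degree_span:
  obtains B :: "(nat \<Rightarrow> ('v::finite, 'k::field) mpol) set" where "finite B"
    "{f \<in> free_module r. vhom s d f} \<subseteq> module.span kscale B"
proof -
  define unit where "unit k n = (\<lambda>i. if i = k then single n 1 else 0 :: ('v, 'k) mpol)"
    for k :: nat and n
  define B where "B = (\<Union>k<r. unit k ` {n. int (tdeg n) = d - s k})"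
  have "f \<in> module.span kscale B" if f: "f \<in> free_module r" "vhom s d f" for f
  proof -
    have f_sum: "f = (\<Sum>k<r. \<Sum>n\<in>keys (f k). kscale (lookup (f k) n) (unit k n))"
    proof
      fix i
      have "(\<Sum>n\<in>keys (f k). kscale (lookup (f k) n) (unit k n)) i =
          (if k = i then f i else 0)" for k
        by (auto simp: vector_sum_apply kscale_def vscale_def unit_def mult_single sum_single_lookup)
      then show "f i = (\<Sum>k<r. \<Sum>n\<in>keys (f k). kscale (lookup (f k) n) (unit k n)) i"
        using free_module_zero[OF f(1), of i] by (simp add: vector_sum_apply)
    qed
    have unit_B: "unit k n \<in> B" if "k < r" "n \<in> keys (f k)" for k n
      using f(2) that by (auto simp: B_def vhom_def homogeneous_def)
    show ?thesis
      by (subst f_sum, rule coefficient_space.span_sum, rule coefficient_space.span_sum,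
          rule coefficient_space.span_scale, rule coefficient_space.span_base, rule unit_B) auto
  qed
  moreover have "finite B" by (simp add: B_def finite_monomials_of_degree)
  ultimately show ?thesis using that by blast
qed

text \<open>
  A homogeneous part of a free module of finite rank is a finite-dimensional vector space, so a basis
  of a homogeneous part of \<open>Z\<close> is finite.
\<close>

lemma finite_degree_generators:
  fixes Z :: "(nat \<Rightarrow> ('v::finite, 'k::field) mpol) set"
  assumes "graded_submodule r s Z"
  obtains S where "finite S" "S \<subseteq> {f \<in> Z. vhom s d f}" "{f \<in> Z. vhom s d f} \<subseteq> module.span vscale S"
proof -
  obtain B :: "(nat \<Rightarrow> ('v, 'k) mpol) set"
    where B: "finite B" "{f \<in> free_module r. vhom s d f} \<subseteq> module.span kscale B"
    by (rule finite_degree_span)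
  obtain S where S: "S \<subseteq> {f \<in> Z. vhom s d f}" "\<not> module.dependent kscale S"
      "{f \<in> Z. vhom s d f} \<subseteq> module.span kscale S"
    by (rule coefficient_space.maximal_independent_subset[of "{f \<in> Z. vhom s d f}"]) (rule that)
  have "S \<subseteq> module.span kscale B"
    using S(1) B(2) assms by (auto simp: graded_submodule_def)
  then have "finite S"
    using coefficient_space.independent_span_bound[OF B(1) S(2)] by blast
  moreover have "module.span kscale S \<subseteq> module.span vscale S"
  proof (rule coefficient_space.span_minimal[OF vec_module.span_superset])
    show "module.subspace kscale (module.span vscale S)"
      unfolding coefficient_space.subspace_def
      by (auto simp: kscale_def intro: vec_module.span_zero vec_module.span_add vec_module.span_scale)
  qed
  ultimately show ?thesis using that S by blast
qed

lemma sum_vcomp: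
  assumes "f \<in> free_module r"
  obtains D where "finite D" "(\<Sum>d\<in>D. vcomp s d f) = f"
proof -
  define D where "D = (\<Union>k<r. (\<lambda>n. int (tdeg n) + s k) ` keys (f k))"
  have fin: "finite D" by (simp add: D_def)
  have "(\<Sum>d\<in>D. vcomp s d f) k = f k" for k
  proof (cases "k < r")
    case True
    have "(\<Sum>d\<in>D. hcomp (d - s k) (f k)) = (\<Sum>e\<in>(\<lambda>d. d - s k) ` D. hcomp e (f k))"
      by (simp add: sum.reindex inj_on_def)
    also have "\<dots> = f k"
    proof (rule sum_hcomp)
      fix n assume "n \<in> keys (f k)"
      then have "int (tdeg n) + s k \<in> D" using True by (auto simp: D_def)
      then show "int (tdeg n) \<in> (\<lambda>d. d - s k) ` D" by (intro image_eqI[of _ _ "int (tdeg n) + s k"]) auto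
    qed (simp add: fin)
    finally show ?thesis by (simp add: vector_sum_apply vcomp_def)
  next
    case False
    then show ?thesis using free_module_zero[OF assms] by (simp add: vector_sum_apply vcomp_def)
  qed
  then show ?thesis using that fin by blast
qed

context vertex_order
begin

text \<open>
  Exactness in degree \<open>0\<close> beyond \<open>N\<close> says that every homogeneous element of degree greater than \<open>N\<close> comes from
  smaller degrees. Degrees are bounded below by the smallest shift, so bases of the finitely many
  parts between these bounds generate \<open>Z\<close>.
\<close>

lemma graded_generators:
  fixes Z :: "(nat \<Rightarrow> ('v, 'k::field) mpol) set"
  assumes Z: "graded_submodule r s Z" and ex: "\<And>j. N < j \<Longrightarrow> exact_at var_scale (strand Z s j) 0"
  obtains S where "finite S" "S \<subseteq> Z" "\<And>g. g \<in> S \<Longrightarrow> \<exists>d. vhom s d g" "module.span vscale S = Z"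
proof -
  have sub: "module.subspace vscale Z" and free: "Z \<subseteq> free_module r"
    and comp: "\<And>d f. f \<in> Z \<Longrightarrow> vcomp s d f \<in> Z"
    using Z by (auto simp: graded_submodule_def)
  define lo where "lo = Min (insert 0 (s ` {..<r}))"
  have lo: "lo \<le> s k" if "k < r" for k using that by (simp add: lo_def)
  have "\<exists>S. finite S \<and> S \<subseteq> {f \<in> Z. vhom s d f} \<and> {f \<in> Z. vhom s d f} \<subseteq> module.span vscale S" for d
    by (rule finite_degree_generators[OF Z, of d]) blast
  then have "\<exists>B. \<forall>d. finite (B d) \<and> B d \<subseteq> {f \<in> Z. vhom s d f} \<and>
      {f \<in> Z. vhom s d f} \<subseteq> module.span vscale (B d)"
    by (intro choice allI)
  then obtain B where B': "\<forall>d. finite (B d) \<and> B d \<subseteq> {f \<in> Z. vhom s d f} \<and>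
      {f \<in> Z. vhom s d f} \<subseteq> module.span vscale (B d)" ..
  have B: "finite (B d)" "B d \<subseteq> {f \<in> Z. vhom s d f}"
    "{f \<in> Z. vhom s d f} \<subseteq> module.span vscale (B d)" for d
    using B'[rule_format, of d] by simp_all
  define S where "S = (\<Union>d\<in>{lo..N}. B d)"
  have span: "f \<in> module.span vscale S" if "f \<in> Z" "vhom s d f" for f d
    using that
  proof (induction "nat (d - lo + 1)" arbitrary: d f rule: less_induct)
    case less
    consider "d < lo" | "lo \<le> d" "d \<le> N" | "lo \<le> d" "N < d" by linarith
    then show ?case
    proof cases
      case 1
      have "f k = 0" for k
      proof (cases "k < r")
        case True
        then show ?thesis using less.prems(2) lo[OF True] 1 by (intro homogeneous_negative) (auto simp: vhom_def)
      qed (use less.prems(1) free free_module_zero in blast)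
      then have "f = 0" by (simp add: fun_eq_iff)
      show ?thesis unfolding \<open>f = 0\<close> by (rule vec_module.span_zero)
    next
      case 2
      then have "f \<in> module.span vscale (B d)" using less.prems B(3) by blast
      moreover have "B d \<subseteq> S" using 2 by (auto simp: S_def)
      ultimately show ?thesis using vec_module.span_mono by blast
    next
      case 3
      have "f \<in> strand Z s d {}" using less.prems by (simp add: strand_vhom)
      moreover have "0 \<in> strand Z s d T" for T
        using vec_module.subspace_0[OF sub] by (simp add: strand_def)
      moreover from this have "\<forall>z\<in>strand Z s d {}. \<exists>b. (\<forall>v. b v \<in> strand Z s d {v}) \<and>
          (\<Sum>v\<in>UNIV. var_scale v (b v)) = z"
        using ex[OF 3(2)] by (subst (asm) exact_at_zero) (auto simp: zero_fun_def)
      ultimately obtain b where b: "\<And>v. b v \<in> strand Z s d {v}" "(\<Sum>v\<in>UNIV. var_scale v (b v)) = f"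
        by blast
      have "b v \<in> module.span vscale S" for v
        using b(1)[of v] 3 by (intro less.hyps[of "d - 1"]) (auto simp: strand_vhom)
      then have "(\<Sum>v\<in>UNIV. vscale (Var v) (b v)) \<in> module.span vscale S"
        by (intro vec_module.span_sum vec_module.span_scale)
      then show ?thesis using b(2) by (simp add: vscale_def)
    qed
  qed
  have "Z \<subseteq> module.span vscale S"
  proof
    fix f assume f: "f \<in> Z"
    then obtain D where "finite D" "(\<Sum>d\<in>D. vcomp s d f) = f"
      using sum_vcomp[of f r s] free by blast
    then show "f \<in> module.span vscale S"
      using span comp[OF f] vhom_vcomp by (metis vec_module.span_sum)
  qed
  moreover have "S \<subseteq> Z" using B(2) by (auto simp: S_def)
  then have "module.span vscale S \<subseteq> Z" by (rule vec_module.span_minimal[OF _ sub])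
  moreover have "finite S" using B(1) by (simp add: S_def)
  moreover have "\<exists>d. vhom s d g" if "g \<in> S" for g using that B(2) by (auto simp: S_def)
  ultimately show ?thesis using that[of S] \<open>S \<subseteq> Z\<close> by blast
qed

text \<open>
  Take a homogeneous generating set with as few elements as possible. If some relation had a nonzero
  constant coefficient, its homogeneous component in the degree of that generator would express the
  generator by the others.
\<close>

lemma minimal_cover_exists:
  fixes Z :: "(nat \<Rightarrow> ('v, 'k::field) mpol) set"
  assumes Z: "graded_submodule r s Z" and ex: "\<And>j. N < j \<Longrightarrow> exact_at var_scale (strand Z s j) 0"
  shows "\<exists>r' s' A. minimal_cover ord r s Z r' s' A"
proof -
  define G where "G S \<longleftrightarrow> finite S \<and> S \<subseteq> Z \<and> (\<forall>g\<in>S. \<exists>d. vhom s d g) \<and> module.span vscale S = Z" for S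
  have "\<exists>S. G S" using graded_generators[OF Z ex] unfolding G_def by metis
  then obtain S where S: "G S" and least: "\<And>S'. G S' \<Longrightarrow> card S \<le> card S'"
    using exists_least_iff[of "\<lambda>n. \<exists>S. G S \<and> card S = n"] by (metis not_less)
  have fin: "finite S" and free: "S \<subseteq> free_module r"
    using S Z by (auto simp: G_def graded_submodule_def)
  obtain h where h: "bij_betw h {..<card S} S"
    using ex_bij_betw_nat_finite[OF fin] by (auto simp: lessThan_atLeast0)
  have h_in: "h l \<in> S" if "l < card S" for l using h that by (auto simp: bij_betw_def)
  define deg where "deg l = (SOME d. vhom s d (h l))" for l
  have deg: "vhom s (deg l) (h l)" if "l < card S" for l
    unfolding deg_def by (rule someI_ex) (use S h_in[OF that] in \<open>auto simp: G_def\<close>)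
  define A where "A k l = h l k" for k l
  have mat: "mat_map r (card S) A f = (\<Sum>l<card S. vscale (f l) (h l))" for f
  proof
    fix k
    show "mat_map r (card S) A f k = (\<Sum>l<card S. vscale (f l) (h l)) k"
    proof (cases "k < r")
      case True
      then show ?thesis by (simp add: mat_map_def A_def vector_sum_apply vscale_def mult.commute)
    next
      case False
      have "h l k = 0" if "l < card S" for l using free h_in[OF that] free_module_zero False by blast
      then show ?thesis using False by (simp add: mat_map_def vector_sum_apply vscale_def)
    qed
  qed
  have homog: "homogeneous_matrix r s (card S) deg A"
    using deg by (simp add: homogeneous_matrix_def A_def vhom_def)
  have "minimal_cover ord r s Z (card S) deg A"
  proof
    show "mat_map r (card S) A ` free_module (card S) = Z"
    proof
      show "mat_map r (card S) A ` free_module (card S) \<subseteq> Z"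
      proof clarify
        fix f
        have "(\<Sum>l<card S. vscale (f l) (h l)) \<in> module.span vscale S"
          using h_in by (intro vec_module.span_sum vec_module.span_scale vec_module.span_base) auto
        then show "mat_map r (card S) A f \<in> Z" using S by (simp add: mat G_def)
      qed
      show "Z \<subseteq> mat_map r (card S) A ` free_module (card S)"
      proof
        fix z assume "z \<in> Z"
        then have "z \<in> module.span vscale S" using S by (simp add: G_def)
        then obtain c where "z = (\<Sum>g\<in>S. vscale (c g) g)"
          using vec_module.span_finite[OF fin] by auto
        then have z: "z = (\<Sum>l<card S. vscale (c (h l)) (h l))"
          using sum.reindex_bij_betw[OF h, of "\<lambda>g. vscale (c g) g"] by simp
        define f where "f l = (if l < card S then c (h l) else 0)" for l
        have "z = mat_map r (card S) A f" unfolding mat z by (intro sum.cong) (auto simp: f_def)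
        moreover have "f \<in> free_module (card S)" by (simp add: f_def free_module_def)
        ultimately show "z \<in> mat_map r (card S) A ` free_module (card S)" by blast
      qed
    qed
  next
    fix f assume f: "f \<in> mat_kernel r (card S) A"
    show "in_max_ideal (card S) f"
      unfolding in_max_ideal_def
    proof (intro allI impI, rule ccontr)
      fix i assume i: "i < card S" and nz: "lookup (f i) 0 \<noteq> 0"
      define c where "c = lookup (f i) 0"
      (* In degree deg i the coefficient of h i is a nonzero constant, which can be inverted. *)
      define q where "q = vcomp deg (deg i) f"
      have "mat_map r (card S) A q = vcomp s (deg i) (mat_map r (card S) A f)"
        by (simp add: q_def vcomp_mat_map[OF homog])
      also have "\<dots> = 0" using f by (auto simp: mat_kernel_def vcomp_def)
      finally have rel: "(\<Sum>l<card S. vscale (q l) (h l)) = 0" by (simp add: mat)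
      have qi: "q i = single 0 c"
        by (rule poly_mapping_eqI)
          (auto simp: q_def vcomp_def lookup_hcomp tdeg_eq_0 c_def lookup_single when_def)
      have "vscale (q i) (h i) + (\<Sum>l\<in>{..<card S} - {i}. vscale (q l) (h l)) = 0"
        using rel i by (simp add: sum.remove)
      then have "vscale (q i) (h i) = - (\<Sum>l\<in>{..<card S} - {i}. vscale (q l) (h l))"
        by (simp add: eq_neg_iff_add_eq_0)
      moreover have "(\<Sum>l\<in>{..<card S} - {i}. vscale (q l) (h l)) \<in> module.span vscale (S - {h i})"
      proof (intro vec_module.span_sum vec_module.span_scale vec_module.span_base)
        fix l assume "l \<in> {..<card S} - {i}"
        then show "h l \<in> S - {h i}" using h_in i h by (auto simp: bij_betw_def inj_on_eq_iff)
      qed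
      ultimately have "vscale (q i) (h i) \<in> module.span vscale (S - {h i})"
        by (simp add: vec_module.span_neg)
      then have "vscale (single 0 (1 / c)) (vscale (q i) (h i)) \<in> module.span vscale (S - {h i})"
        by (rule vec_module.span_scale)
      moreover have "vscale (single 0 (1 / c)) (vscale (q i) (h i)) = h i"
        using nz by (simp add: qi c_def mult_single)
      ultimately have "h i \<in> module.span vscale (S - {h i})" by simp
      then have "S \<subseteq> module.span vscale (S - {h i})"
        by (auto intro: vec_module.span_base)
      then have "module.span vscale (S - {h i}) = module.span vscale S"
        by (intro equalityI vec_module.span_minimal vec_module.span_mono vec_module.subspace_span) auto
      then have "G (S - {h i})" using S by (auto simp: G_def)
      then have "card S \<le> card (S - {h i})" by (rule least)
      then show False using h_in[OF i] fin by (metis card_Diff1_less not_le)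
    qed
  qed (rule homog)
  then show ?thesis by blast
qed

lemma homogeneous_irrelevant:
  fixes p :: "('v, 'k::field) mpol"
  assumes "homogeneous d p" "lookup p 0 = 0"
  shows "p \<in> irrelevant_ideal"
proof -
  obtain g where g: "(\<Sum>v\<in>UNIV. Var v * g v) = p" using irrelevant_decomposition[OF assms] by blast
  have "g v * Var v \<in> irrelevant_ideal" for v
    unfolding irrelevant_ideal_def ideal_generated_def
    by (intro module.span_scale[OF module_times] module.span_base[OF module_times]) simp
  then have "(\<Sum>v\<in>UNIV. g v * Var v) \<in> irrelevant_ideal"
    unfolding irrelevant_ideal_def ideal_generated_def by (intro module.span_sum[OF module_times])
  then show ?thesis using g by (simp add: mult.commute)
qed

text \<open>
  The bound \<open>N\<close> on the degrees of Koszul homology is inherited by the kernel of a minimal cover, by the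
  dimension shift, so covers can be chosen one after the other.
\<close>

theorem minimal_resolution_exists:
  assumes bound: "\<And>m p. N < int (sum m UNIV) \<Longrightarrow> acyclic_at TYPE('k::field) (upper_koszul A m) p"
    and up: "up_closed A"
  shows "\<exists>F. minimal_graded_free_resolution (monomial_ideal A :: ('v, 'k) mpol set) F"
proof -
  define good where "good x \<longleftrightarrow> (case x of (r, s, Z) \<Rightarrow> graded_submodule r s Z \<and>
      (\<forall>p. \<forall>j>N. exact_at var_scale (strand Z s j) p))" for x :: "nat \<times> (nat \<Rightarrow> int) \<times> (nat \<Rightarrow> ('v, 'k) mpol) set"
  define next_syz where "next_syz x y \<longleftrightarrow> (case x of (r, s, Z) \<Rightarrow> case y of (r', s', Z') \<Rightarrow>
      \<exists>A. minimal_cover ord r s Z r' s' A \<and> Z' = mat_kernel r r' A)"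
    for x y :: "nat \<times> (nat \<Rightarrow> int) \<times> (nat \<Rightarrow> ('v, 'k) mpol) set"
  have step: "\<exists>y. good y \<and> next_syz x y" if good: "good x" for x
  proof -
    obtain r s Z where x: "x = (r, s, Z)" by (cases x)
    then have Z: "graded_submodule r s Z" "\<And>p j. N < j \<Longrightarrow> exact_at var_scale (strand Z s j) p"
      using good by (auto simp: good_def)
    obtain r' s' A where cover: "minimal_cover ord r s Z r' s' A"
      using minimal_cover_exists[OF Z(1) Z(2)] by blast
    interpret minimal_cover ord r s Z r' s' A by (rule cover)
    have "good (r', s', mat_kernel r r' A)"
      using graded_mat_kernel[OF homog] Z(2) by (auto simp: good_def simp flip: exact_cover)
    then show ?thesis using cover unfolding x next_syz_def by blast
  qed
  define x0 where "x0 = (1 :: nat, (\<lambda>_. 0) :: nat \<Rightarrow> int, monomial_power 1 A :: (nat \<Rightarrow> ('v, 'k) mpol) set)"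
  have "graded_submodule 1 (\<lambda>_. 0) (monomial_power 1 A :: (nat \<Rightarrow> ('v, 'k) mpol) set)"
    unfolding graded_submodule_def
  proof (intro conjI allI ballI)
    have mult: "A (lookup n)"
      if n: "n \<in> keys (a * f)" "\<And>n. n \<in> keys f \<Longrightarrow> A (lookup n)"
      for n and a f :: "('v, 'k) mpol"
    proof -
      obtain b c where "n = b + c" "c \<in> keys f" using keys_mult[of a f] n(1) by blast
      then show ?thesis using up_closedD[OF up n(2)[of c]] by (simp add: lookup_add)
    qed
    show "module.subspace vscale (monomial_power 1 A :: (nat \<Rightarrow> ('v, 'k) mpol) set)"
      using mult keys_add by (fastforce simp: vec_module.subspace_def monomial_power_def free_module_def vscale_def)
  next
    fix d and f :: "nat \<Rightarrow> ('v, 'k) mpol" assume "f \<in> monomial_power 1 A"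
    then show "vcomp (\<lambda>_. 0) d f \<in> monomial_power 1 A"
      by (auto simp: monomial_power_def free_module_def vcomp_def in_keys_iff lookup_hcomp split: if_splits)
  qed (auto simp: monomial_power_def)
  then have "good x0"
    using bound by (auto simp: good_def x0_def exact_monomial_power)
  have "\<exists>x. \<forall>i. (good (x i) \<and> (i = 0 \<longrightarrow> x i = x0)) \<and> next_syz (x i) (x (Suc i))"
  proof (rule dependent_nat_choice)
    show "\<exists>y. good y \<and> ((0 :: nat) = 0 \<longrightarrow> y = x0)" using \<open>good x0\<close> by blast
    show "\<exists>z. (good z \<and> (Suc i = 0 \<longrightarrow> z = x0)) \<and> next_syz y z" if "good y \<and> (i = 0 \<longrightarrow> y = x0)" for y i
      using step[of y] that by blast
  qed
  then obtain x where "\<forall>i. (good (x i) \<and> (i = 0 \<longrightarrow> x i = x0)) \<and> next_syz (x i) (x (Suc i))" ..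
  then have x: "x 0 = x0" "good (x i)" "next_syz (x i) (x (Suc i))" for i by simp_all
  define R where "R i = fst (x i)" for i
  define S where "S i = fst (snd (x i))" for i
  define Z where "Z i = snd (snd (x i))" for i
  have "\<exists>M. minimal_cover ord (R i) (S i) (Z i) (R (Suc i)) (S (Suc i)) M \<and> Z (Suc i) = mat_kernel (R i) (R (Suc i)) M" for i
    using x(3)[of i] by (simp add: next_syz_def R_def S_def Z_def case_prod_beta)
  then obtain M where cover: "\<And>i. minimal_cover ord (R i) (S i) (Z i) (R (Suc i)) (S (Suc i)) (M i)"
    and Z: "\<And>i. Z (Suc i) = mat_kernel (R i) (R (Suc i)) (M i)" by metis
  have init: "R 0 = 1" "S 0 = (\<lambda>_. 0)" "Z 0 = monomial_power 1 A" by (simp_all add: R_def S_def Z_def x(1) x0_def)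
  note homog = minimal_cover.homog[OF cover] and image = minimal_cover.image[OF cover]
    and minimal = minimal_cover.minimal[OF cover]
  define F where "F = \<lparr>rk = (\<lambda>i. R (Suc i)), shift = (\<lambda>i. S (Suc i)), aug = M 0 0, dmat = (\<lambda>i. M (Suc i))\<rparr>"
  have aug: "aug_map F f = mat_map (R 0) (R (Suc 0)) (M 0) f 0" for f
    by (simp add: aug_map_def mat_map_def F_def init)
  have "aug_map F ` free_module (rk F 0) = (\<lambda>f. f 0) ` Z 0"
    unfolding image[of 0, symmetric] image_image aug by (simp add: F_def)
  also have "\<dots> = monomial_ideal A"
  proof
    show "(\<lambda>f. f 0) ` Z 0 \<subseteq> monomial_ideal A" by (auto simp: init monomial_power_def monomial_ideal_def)
    show "monomial_ideal A \<subseteq> (\<lambda>f. f 0) ` Z 0"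
    proof
      fix p :: "('v, 'k) mpol" assume "p \<in> monomial_ideal A"
      then have "(\<lambda>k. if k = 0 then p else 0) \<in> Z 0"
        by (auto simp: init monomial_power_def monomial_ideal_def free_module_def)
      then show "p \<in> (\<lambda>f. f 0) ` Z 0" by (rule rev_image_eqI) simp
    qed
  qed
  finally have im0: "aug_map F ` free_module (rk F 0) = monomial_ideal A" .
  have "aug_map F f = 0 \<longleftrightarrow> mat_map (R 0) (R (Suc 0)) (M 0) f = (\<lambda>_. 0)" for f
    unfolding aug by (auto simp: fun_eq_iff mat_map_def init)
  then have ker0: "{f \<in> free_module (rk F 0). aug_map F f = 0} = diff_map F 0 ` free_module (rk F 1)"
    using image[of 1] by (simp add: Z mat_kernel_def F_def diff_map_def)
  have ker: "{f \<in> free_module (rk F (Suc i)). diff_map F i f = (\<lambda>_. 0)} =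
      diff_map F (Suc i) ` free_module (rk F (Suc (Suc i)))" for i
    using image[of "Suc (Suc i)"] by (simp add: Z mat_kernel_def F_def diff_map_def)
  have "graded_free_resolution (monomial_ideal A) F"
    unfolding graded_free_resolution_def
  proof (intro conjI allI impI)
    fix l assume "l < rk F 0"
    then show "homogeneous (shift F 0 l) (aug F l)"
      using homog[of 0] by (simp add: homogeneous_matrix_def F_def init)
  next
    fix i k l assume "k < rk F i" "l < rk F (Suc i)"
    then show "homogeneous (shift F (Suc i) l - shift F i k) (dmat F i k l)"
      using homog[of "Suc i"] by (simp add: homogeneous_matrix_def F_def)
  qed (rule im0 ker0 ker)+
  moreover have "dmat F i k l \<in> irrelevant_ideal" if "k < rk F i" "l < rk F (Suc i)" for i k l
  proof (rule homogeneous_irrelevant)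
    show "homogeneous (S (Suc (Suc i)) l - S (Suc i) k) (dmat F i k l)"
      using homog[of "Suc i"] that by (simp add: homogeneous_matrix_def F_def)
    define e where "e = (\<lambda>k. if k = l then 1 else 0 :: ('v, 'k) mpol)"
    have "e \<in> free_module (R (Suc (Suc i)))" using that by (simp add: e_def free_module_def F_def)
    then have "mat_map (R (Suc i)) (R (Suc (Suc i))) (M (Suc i)) e \<in> Z (Suc i)" using image[of "Suc i"] by blast
    then have "in_max_ideal (R (Suc i)) (mat_map (R (Suc i)) (R (Suc (Suc i))) (M (Suc i)) e)"
      using minimal[of _ i] by (simp add: Z)
    then have "lookup (mat_map (R (Suc i)) (R (Suc (Suc i))) (M (Suc i)) e k) 0 = 0"
      using that(1) by (simp add: in_max_ideal_def F_def)
    moreover have "mat_map (R (Suc i)) (R (Suc (Suc i))) (M (Suc i)) e k = M (Suc i) k l"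
      using that by (simp add: mat_map_def e_def F_def if_distrib cong: if_cong)
    ultimately show "lookup (dmat F i k l) 0 = 0" by (simp add: F_def)
  qed
  ultimately have "minimal_graded_free_resolution (monomial_ideal A) F"
    by (simp add: minimal_graded_free_resolution_def)
  then show ?thesis by blast
qed

end

section \<open>Regularity of an edge ideal\<close>

lemma ideal_generated_monomials:
  "(ideal_generated (mon ` M) :: ('v::finite, 'k::field) mpol set) =
    monomial_ideal (\<lambda>n. \<exists>m\<in>M. \<forall>v. lookup m v \<le> n v)"
proof
  let ?A = "\<lambda>n. \<exists>m\<in>M. \<forall>v. lookup m v \<le> n v"
  show "(ideal_generated (mon ` M) :: ('v, 'k) mpol set) \<subseteq> monomial_ideal ?A"
  proof
    fix f :: "('v, 'k) mpol" assume "f \<in> ideal_generated (mon ` M)"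
    then show "f \<in> monomial_ideal ?A"
      unfolding ideal_generated_def
    proof (induction rule: module.span_induct_alt[OF module_times, consumes 1, case_names base step])
      case base
      show ?case by (simp add: monomial_ideal_def)
    next
      case (step c x y)
      then obtain m where m: "m \<in> M" "x = mon m" by blast
      have "?A (lookup n)" if "n \<in> keys (c * x + y)" for n
      proof (cases "n \<in> keys y")
        case True
        then show ?thesis using step by (simp add: monomial_ideal_def)
      next
        case False
        then have "n \<in> keys (c * x)" using that keys_add[of "c * x" y] by blast
        then obtain a b where "n = a + b" "b \<in> keys x" using keys_mult[of c x] by blast
        then have "n = a + m" by (simp add: m(2) mon_def)
        then show ?thesis using m(1) by (intro bexI[of _ m]) (auto simp: lookup_add)
      qed
      then show ?case by (simp add: monomial_ideal_def)
    qed
  qed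
  show "monomial_ideal ?A \<subseteq> (ideal_generated (mon ` M) :: ('v, 'k) mpol set)"
  proof
    fix f :: "('v, 'k) mpol" assume f: "f \<in> monomial_ideal ?A"
    have "single n (lookup f n) \<in> ideal_generated (mon ` M)"
      if "n \<in> keys f" for n
    proof -
      obtain m where m: "m \<in> M" "\<And>v. lookup m v \<le> lookup n v"
        using f \<open>n \<in> keys f\<close> by (auto simp: monomial_ideal_def)
      have "(n - m) + m = n" using m(2) by (simp add: poly_mapping_eq_iff fun_eq_iff lookup_add lookup_minus)
      then have "single n (lookup f n) =
          single (n - m) (lookup f n) * mon m"
        by (simp add: mon_def mult_single)
      then show ?thesis
        unfolding ideal_generated_def using m(1)
        by (simp add: module.span_scale[OF module_times] module.span_base[OF module_times])
    qed
    then have "(\<Sum>n\<in>keys f. single n (lookup f n)) \<in> ideal_generated (mon ` M)"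
      unfolding ideal_generated_def by (intro module.span_sum[OF module_times])
    then show "f \<in> ideal_generated (mon ` M)" by (simp add: sum_single_lookup)
  qed
qed

lemma keys_Var_Var:
  "keys (Var u * Var v :: ('v::finite, 'k::field) mpol) =
    {single u 1 + single v 1}"
  by (simp add: Var_def mon_def mult_single)

lemma fits_iff: "fits u v n \<longleftrightarrow>
    (\<forall>w. lookup (single u 1 + single v 1) w \<le> n w)"
proof
  assume "fits u v n"
  then show "\<forall>w. lookup (single u 1 + single v 1) w \<le> n w"
    by (auto simp: fits_def lookup_add lookup_single when_def split: if_splits)
next
  assume le: "\<forall>w. lookup (single u 1 + single v 1) w \<le> n w"
  then show "fits u v n"
    using le[rule_format, of u] le[rule_format, of v]
    by (auto simp: fits_def lookup_add lookup_single when_def split: if_splits)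
qed

lemma degree_two_monomial:
  assumes "tdeg m = 2" obtains u v where "m = single u 1 + single v 1"
proof -
  have pick: "\<exists>u n'. n = single u 1 + n' \<and> tdeg n' = k" if "tdeg n = Suc k" for n :: "'a mon" and k
  proof -
    have "\<exists>u. lookup n u \<noteq> 0"
    proof (rule ccontr)
      assume "\<nexists>u. lookup n u \<noteq> 0"
      then have "tdeg n = 0" by (simp add: tdeg_def)
      then show False using that by simp
    qed
    then obtain u where u: "lookup n u \<noteq> 0" by blast
    have n: "n = single u 1 + (n - single u 1)"
      using u by (auto simp: poly_mapping_eq_iff fun_eq_iff lookup_add lookup_minus lookup_single when_def)
    have "tdeg (single u (1 :: nat)) = 1" by (simp add: tdeg_def lookup_single when_def)
    then have "tdeg (n - single u 1) = k"
      using that n tdeg_add[of "single u 1" "n - single u 1"] by simp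
    then show ?thesis using n by blast
  qed
  obtain u n where "m = single u 1 + n" "tdeg n = Suc 0"
    using pick[of m "Suc 0"] assms by (auto simp: numeral_2_eq_2)
  moreover then obtain v n' where "n = single v 1 + n'" "tdeg n' = 0"
    using pick[of n 0] by auto
  ultimately show ?thesis using that[of u v] by (simp add: tdeg_eq_0)
qed

lemma degree_two_ideal:
  fixes I :: "('v::finite, 'k::field) mpol set"
  assumes "monomial_ideal_generated_in_degree 2 I"
  shows "I = monomial_ideal (edge_ideal (\<lambda>u v. Var u * Var v \<in> I))"
proof -
  obtain M where M: "\<And>m. m \<in> M \<Longrightarrow> tdeg m = 2" "I = ideal_generated (mon ` M)"
    using assms by (auto simp: monomial_ideal_generated_in_degree_def)
  let ?A = "\<lambda>n. \<exists>m\<in>M. \<forall>v. lookup m v \<le> n v"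
  have I: "I = monomial_ideal ?A" by (simp add: M(2) ideal_generated_monomials)
  have E: "Var u * Var v \<in> I \<longleftrightarrow> ?A (lookup (single u 1 + single v 1))" for u v
    by (simp add: I monomial_ideal_def keys_Var_Var)
  have "?A n \<longleftrightarrow> edge_ideal (\<lambda>u v. Var u * Var v \<in> I) n" for n
  proof
    assume "?A n"
    then obtain m where m: "m \<in> M" "\<And>v. lookup m v \<le> n v" by blast
    obtain u v where uv: "m = single u 1 + single v 1"
      using degree_two_monomial[OF M(1)[OF m(1)]] by blast
    have "Var u * Var v \<in> I" unfolding E using m(1) uv by (intro bexI[of _ m]) auto
    moreover have "fits u v n" using m(2) by (simp add: fits_iff uv)
    ultimately show "edge_ideal (\<lambda>u v. Var u * Var v \<in> I) n" by (auto simp: edge_ideal_def)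
  next
    assume "edge_ideal (\<lambda>u v. Var u * Var v \<in> I) n"
    then obtain u v where "Var u * Var v \<in> I" and fits: "fits u v n" by (auto simp: edge_ideal_def)
    then obtain m where "m \<in> M"
      "\<And>w. lookup m w \<le> lookup (single u 1 + single v 1) w"
      unfolding E by blast
    then show "?A n" using fits unfolding fits_iff by (meson order_trans)
  qed
  then have "?A = edge_ideal (\<lambda>u v. Var u * Var v \<in> I)" by (intro ext)
  then show ?thesis using I by simp
qed

context vertex_order
begin

text \<open>
  Some exponent \<open>m v\<close> is at least \<open>3\<close>. An edge uses at most two copies of \<open>v\<close>, so one copy can always be put
  into the face, and the complex is a cone.
\<close>

lemma acyclic_large_degree:
  assumes "2 * card (UNIV :: 'v set) < sum m UNIV"
  shows "acyclic_at TYPE('k::field) (upper_koszul (edge_ideal E) m) p"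
proof -
  have "\<exists>v. 2 < m v"
  proof (rule ccontr)
    assume "\<nexists>v. 2 < m v"
    then have "sum m UNIV \<le> (\<Sum>v\<in>(UNIV :: 'v set). 2)" by (intro sum_mono) (simp add: not_less)
    then show False using assms by simp
  qed
  then obtain v where v: "2 < m v" by blast
  have "insert v T \<in> upper_koszul (edge_ideal E) m" if T: "T \<in> upper_koszul (edge_ideal E) m" for T
  proof -
    obtain a b where ab: "E a b" "fits a b (lower m T)" using T by (auto simp: upper_koszul_def edge_ideal_def)
    have "lower m (insert v T) w = lower m T w" if "w \<noteq> v" for w using that by (simp add: lower_def)
    moreover have "2 \<le> lower m (insert v T) v" using v by (simp add: lower_def)
    ultimately have "fits a b (lower m (insert v T))"
      using ab(2) by (cases "a = v"; cases "b = v") (auto simp: fits_def)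
    then show ?thesis using T ab(1) v by (auto simp: upper_koszul_def edge_ideal_def supp_def)
  qed
  then show ?thesis by (rule acyclic_cone)
qed

lemma not_acyclic_card:
  assumes "\<not> acyclic_at TYPE('k::field) K p" shows "p \<le> card (UNIV :: 'v set)"
proof (rule ccontr)
  assume p: "\<not> p \<le> card (UNIV :: 'v set)"
  have "card T \<noteq> p" for T :: "'v set" using card_mono[of UNIV T] p by auto
  then have "acyclic_at TYPE('k) K p"
    unfolding acyclic_at_iff by (auto intro!: exI[of _ "\<lambda>_. 0"] simp: kdiff_def)
  then show False using assms by simp
qed

text \<open>
  The chosen resolution is minimal because one exists, and every minimal resolution has the
  shifts computed above.
\<close>

theorem betti_edge_ideal:
  "graded_betti (monomial_ideal (edge_ideal E) :: ('v, 'k::field) mpol set) i j \<noteq> 0 \<longleftrightarrow>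
    (\<exists>m. int (sum m UNIV) = j \<and> \<not> acyclic_at TYPE('k) (upper_koszul (edge_ideal E) m) i)"
proof -
  let ?I = "monomial_ideal (edge_ideal E) :: ('v, 'k) mpol set"
  define F where "F = (SOME F. minimal_graded_free_resolution ?I F)"
  have "minimal_graded_free_resolution ?I F"
    unfolding F_def
  proof (rule someI_ex, rule minimal_resolution_exists[OF _ up_closed_edge_ideal])
    show "acyclic_at TYPE('k) (upper_koszul (edge_ideal E) m) p"
      if "int (2 * card (UNIV :: 'v set)) < int (sum m UNIV)" for m p
      using that by (intro acyclic_large_degree) linarith
  qed
  from resolution_shifts[OF this, of i j]
  show ?thesis by (auto simp: graded_betti_def Let_def F_def[symmetric] card_eq_0_iff)
qed

end

definition betti_range :: "('v::finite, 'k::field) mpol set \<Rightarrow> int set" where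
  "betti_range I = {j - int i | i j. graded_betti I i j \<noteq> 0}"

context vertex_order
begin

lemma betti_range_iff:
  "d \<in> betti_range (monomial_ideal (edge_ideal E) :: ('v, 'k::field) mpol set) \<longleftrightarrow>
    (\<exists>m p. d = int (sum m UNIV) - int p \<and> \<not> acyclic_at TYPE('k) (upper_koszul (edge_ideal E) m) p)"
  unfolding betti_range_def betti_edge_ideal by blast

lemma finite_betti_range: "finite (betti_range (monomial_ideal (edge_ideal E) :: ('v, 'k::field) mpol set))"
proof (rule finite_subset)
  show "betti_range (monomial_ideal (edge_ideal E) :: ('v, 'k) mpol set) \<subseteq>
    {- int (card (UNIV :: 'v set))..2 * int (card (UNIV :: 'v set))}"
  proof
    fix d assume "d \<in> betti_range (monomial_ideal (edge_ideal E) :: ('v, 'k) mpol set)"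
    then obtain m p where d: "d = int (sum m UNIV) - int p"
      and nac: "\<not> acyclic_at TYPE('k) (upper_koszul (edge_ideal E) m) p"
      unfolding betti_range_iff by blast
    have "p \<le> card (UNIV :: 'v set)" by (rule not_acyclic_card[OF nac])
    moreover have "sum m UNIV \<le> 2 * card (UNIV :: 'v set)" using acyclic_large_degree[of m E p] nac not_less by blast
    ultimately show "d \<in> {- int (card (UNIV :: 'v set))..2 * int (card (UNIV :: 'v set))}"
      unfolding d by (simp del: of_nat_sum)
  qed
qed simp

lemma betti_range_bound:
  assumes "\<And>m. reg_bound TYPE('k::field) (edge_ideal E) m c"
    and "d \<in> betti_range (monomial_ideal (edge_ideal E) :: ('v, 'k) mpol set)"
  shows "d \<le> int c"
proof -
  obtain m p where d: "d = int (sum m UNIV) - int p"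
    and nac: "\<not> acyclic_at TYPE('k) (upper_koszul (edge_ideal E) m) p"
    using assms(2) unfolding betti_range_iff by blast
  have "\<not> p + c < sum m UNIV" using assms(1)[of m] nac unfolding reg_bound_def by blast
  then show ?thesis unfolding d by linarith
qed

text \<open>
  The complex consists of the empty face only, and its homology in degree \<open>0\<close> is the coefficient
  field. So \<open>2\<close> is a value of \<open>j - i\<close>, and the maximum defining the regularity is over a nonempty set.
\<close>

lemma edge_degree_not_acyclic:
  assumes "symp E" "E a b"
  obtains m where "sum m UNIV = 2" "\<not> acyclic_at TYPE('k::field) (upper_koszul (edge_ideal E) m) 0"
proof -
  let ?m = "matching_degree (\<lambda>_. a) (\<lambda>_. b) {()}"
  have "upper_koszul (edge_ideal E) ?m = {T. T \<subseteq> {a, b} \<and> T \<inter> {a, b} = {}}"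
    using upper_koszul_matching[of "{()}" E "\<lambda>_. a" "\<lambda>_. b"] assms by simp
  then have K: "upper_koszul (edge_ideal E) ?m = {{}}" by auto
  have "\<not> acyclic_at TYPE('k) (upper_koszul (edge_ideal E) ?m) 0"
    unfolding K
    by (rule not_acyclic_cocycle[where \<phi> = "\<lambda>_. 1" and \<rho> = "{a}"]) (auto simp: coboundary_def signed_def)
  moreover have "sum ?m UNIV = 2" by (simp add: sum_matching_degree)
  ultimately show ?thesis using that by blast
qed

end

section \<open>Induced cycles\<close>

text \<open>
  Used to show that an induced cycle of length at least \<open>5\<close> contains neither a square nor a triangle.
\<close>

lemma connected_graph_closed:
  assumes "connected_graph C" "u \<in> S" "S \<subseteq> verts C"
    and closed: "\<And>a b. a \<in> S \<Longrightarrow> {a, b} \<in> edges C \<Longrightarrow> b \<in> S"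
  shows "verts C = S"
proof
  show "verts C \<subseteq> S"
  proof
    fix v assume "v \<in> verts C"
    then have "(u, v) \<in> {(a, b). {a, b} \<in> edges C}\<^sup>*"
      using assms(1-3) unfolding connected_graph_def by blast
    then show "v \<in> S"
      by (induction rule: rtrancl_induct) (use assms(2) closed in auto)
  qed
qed (rule assms(3))

definition bigraph :: "('v \<Rightarrow> 'v \<Rightarrow> bool) \<Rightarrow> 'v set \<Rightarrow> 'v set \<Rightarrow> 'v graph" where
  "bigraph R X Y = (UNIV, {{x, y} | x y. x \<in> X \<and> y \<in> Y \<and> R x y})"

lemma bigraph_edge:
  assumes "X \<inter> Y = {}"
  shows "x \<in> X \<Longrightarrow> {x, v} \<in> edges (induced (bigraph R X Y) W) \<longleftrightarrow> x \<in> W \<and> v \<in> W \<and> v \<in> Y \<and> R x v"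
    and "y \<in> Y \<Longrightarrow> {y, v} \<in> edges (induced (bigraph R X Y) W) \<longleftrightarrow> y \<in> W \<and> v \<in> W \<and> v \<in> X \<and> R v y"
proof -
  have ne: "a \<noteq> b" if "a \<in> X" "b \<in> Y" for a b using that assms by auto
  show "x \<in> X \<Longrightarrow> {x, v} \<in> edges (induced (bigraph R X Y) W) \<longleftrightarrow> x \<in> W \<and> v \<in> W \<and> v \<in> Y \<and> R x v"
    using ne by (auto simp: induced_def bigraph_def doubleton_eq_iff)
  show "y \<in> Y \<Longrightarrow> {y, v} \<in> edges (induced (bigraph R X Y) W) \<longleftrightarrow> y \<in> W \<and> v \<in> W \<and> v \<in> X \<and> R v y"
    using ne by (auto simp: induced_def bigraph_def doubleton_eq_iff)
qed

lemma verts_induced [simp]: "verts (induced G W) = W"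
  by (simp add: induced_def)

lemma zigzag_neighbours:
  assumes "k \<ge> 3" "i < k"
  shows "card {j. j < k \<and> (i = Suc j \<or> j = Suc i \<or> i = j \<and> (i = 0 \<or> Suc i = k))} = 2"
proof -
  consider "i = 0" | "0 < i" "Suc i < k" | "0 < i" "Suc i = k" using assms(2) by linarith
  then show ?thesis
  proof cases
    case 1
    then have "{j. j < k \<and> (i = Suc j \<or> j = Suc i \<or> i = j \<and> (i = 0 \<or> Suc i = k))} = {0, 1}" using assms(1) by auto
    then show ?thesis by simp
  next
    case 2
    then have "{j. j < k \<and> (i = Suc j \<or> j = Suc i \<or> i = j \<and> (i = 0 \<or> Suc i = k))} = {i - 1, Suc i}" by auto
    then show ?thesis by simp
  next
    case 3
    then have "{j. j < k \<and> (i = Suc j \<or> j = Suc i \<or> i = j \<and> (i = 0 \<or> Suc i = k))} = {i - 1, i}" by auto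
    then show ?thesis using 3 by simp
  qed
qed

lemma closed_zigzag_is_cycle:
  assumes disj: "X \<inter> Y = {}" and z: "closed_zigzag R k xs ys"
    and xs: "xs ` {..<k} \<subseteq> X" and ys: "ys ` {..<k} \<subseteq> Y"
  shows "is_cycle (2 * k) (induced (bigraph R X Y) (xs ` {..<k} \<union> ys ` {..<k}))"
proof -
  let ?W = "xs ` {..<k} \<union> ys ` {..<k}"
  let ?C = "induced (bigraph R X Y) ?W"
  have k: "k \<ge> 3" and inj: "inj_on xs {..<k}" "inj_on ys {..<k}"
    and adj: "\<And>i j. i < k \<Longrightarrow> j < k \<Longrightarrow> R (xs i) (ys j) \<longleftrightarrow>
        i = Suc j \<or> j = Suc i \<or> i = j \<and> (i = 0 \<or> Suc i = k)"
    using z by (simp_all add: closed_zigzag_def)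
  have in_X: "xs i \<in> X" "ys i \<in> Y" "xs i \<notin> Y" "ys i \<notin> X" if "i < k" for i
    using xs ys that disj by auto
  note edge = bigraph_edge[OF disj]
  have xy: "{xs i, ys j} \<in> edges ?C \<longleftrightarrow> i = Suc j \<or> j = Suc i \<or> i = j \<and> (i = 0 \<or> Suc i = k)"
    if "i < k" "j < k" for i j
    using edge(1)[OF in_X(1)[OF that(1)]] in_X that adj[OF that] by auto
  have disj_W: "xs ` {..<k} \<inter> ys ` {..<k} = {}" using xs ys disj by blast
  have card: "card ?W = 2 * k"
    using disj_W inj by (simp add: card_Un_disjoint card_image)
  have simple: "simple_graph ?C"
    unfolding simple_graph_def
  proof
    fix e assume "e \<in> edges ?C"
    then obtain x y where "e = {x, y}" "x \<in> X" "y \<in> Y" "e \<subseteq> ?W" by (auto simp: induced_def bigraph_def)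
    moreover from this have "x \<noteq> y" using disj by blast
    ultimately show "e \<subseteq> verts ?C \<and> card e = 2" by simp
  qed
  define r where "r = {(a, b). {a, b} \<in> edges ?C}"
  have sym: "sym (r\<^sup>*)" by (rule sym_rtrancl) (auto simp: r_def sym_def insert_commute)
  have reach: "(xs 0, xs i) \<in> r\<^sup>* \<and> (xs 0, ys i) \<in> r\<^sup>*" if "i < k" for i
    using that
  proof (induction i)
    case 0
    then have "(xs 0, ys 0) \<in> r" using xy[of 0 0] by (simp add: r_def)
    then show ?case by blast
  next
    case (Suc i)
    then have "(ys i, xs (Suc i)) \<in> r" "(xs i, ys (Suc i)) \<in> r"
      using xy[of "Suc i" i] xy[of i "Suc i"] by (simp_all add: r_def insert_commute)
    then show ?case using Suc by (meson Suc_lessD rtrancl.rtrancl_into_rtrancl)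
  qed
  have connected: "connected_graph ?C"
    unfolding connected_graph_def r_def[symmetric] verts_induced
  proof (intro ballI)
    fix u v assume "u \<in> ?W" "v \<in> ?W"
    then have "(xs 0, u) \<in> r\<^sup>*" "(xs 0, v) \<in> r\<^sup>*" using reach by auto
    then show "(u, v) \<in> r\<^sup>*" using sym by (meson rtrancl_trans symD)
  qed
  have degree: "card {v \<in> ?W. {u, v} \<in> edges ?C} = 2" if u: "u \<in> ?W" for u
  proof -
    consider i where "i < k" "u = xs i" | i where "i < k" "u = ys i" using u by auto
    then show ?thesis
    proof cases
      case 1
      have "{v \<in> ?W. {u, v} \<in> edges ?C} = ys ` {j. j < k \<and> (i = Suc j \<or> j = Suc i \<or> i = j \<and> (i = 0 \<or> Suc i = k))}"
        using 1 edge(1)[OF in_X(1)[OF 1(1)]] in_X adj[OF 1(1)] disj by auto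
      then show ?thesis
        using zigzag_neighbours[OF k 1(1)] inj(2) by (simp add: card_image inj_on_def)
    next
      case 2
      have "{v \<in> ?W. {u, v} \<in> edges ?C} = xs ` {j. j < k \<and> (i = Suc j \<or> j = Suc i \<or> i = j \<and> (i = 0 \<or> Suc i = k))}"
        using 2 edge(2)[OF in_X(2)[OF 2(1)]] in_X adj[OF _ 2(1)] disj by auto
      then show ?thesis
        using zigzag_neighbours[OF k 2(1)] inj(1) by (simp add: card_image inj_on_def)
    qed
  qed
  show ?thesis
    unfolding is_cycle_def using k card simple connected degree by simp
qed

text \<open>
  A cycle of length \<open>6\<close> in the bipartite complement means that the opposite pairs \<open>xs 0, ys 2\<close> and
  \<open>xs 1, ys 1\<close> and \<open>xs 2, ys 0\<close> are edges of the graph, with no further edges between them.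
\<close>

lemma long_cycle_separated_or_induced:
  assumes sym: "symp E" and bip: "\<And>u v. E u v \<Longrightarrow> u \<noteq> v \<Longrightarrow> u \<in> X \<longleftrightarrow> v \<notin> X"
    and "long_cycle (\<lambda>x y. \<not> E x y) X (- X)"
  shows "(\<exists>a a' b b' c c'. E a a' \<and> E b b' \<and> E c c' \<and>
      separated E a a' b b' \<and> separated E a a' c c' \<and> separated E b b' c c') \<or>
    (\<exists>l\<ge>8. has_induced_cycle (bigraph (\<lambda>x y. \<not> E x y) X (- X)) l)"
proof -
  obtain k xs ys where z: "closed_zigzag (\<lambda>x y. \<not> E x y) k xs ys"
    and xs: "xs ` {..<k} \<subseteq> X" and ys: "ys ` {..<k} \<subseteq> - X"
    using assms(3) unfolding long_cycle_def by blast
  have k: "k \<ge> 3" using z by (simp add: closed_zigzag_def)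
  show ?thesis
  proof (cases "k = 3")
    case True
    have adj: "E (xs i) (ys j) \<longleftrightarrow> \<not> (i = Suc j \<or> j = Suc i \<or> i = j \<and> (i = 0 \<or> Suc i = 3))"
      if "i < 3" "j < 3" for i j
      using z that unfolding True closed_zigzag_def by blast
    have ne: "\<not> E (xs i) (xs j)" "\<not> E (ys i) (ys j)" if "i < 3" "j < 3" "i \<noteq> j" for i j
    proof -
      have "xs i \<noteq> xs j" "ys i \<noteq> ys j"
        using z that by (auto simp: closed_zigzag_def True inj_on_eq_iff)
      moreover have "xs i \<in> X" "xs j \<in> X" "ys i \<notin> X" "ys j \<notin> X" using xs ys that True by auto
      ultimately show "\<not> E (xs i) (xs j)" "\<not> E (ys i) (ys j)" using bip by blast+
    qed
    have adj': "\<not> E (ys j) (xs i)" if "i < 3" "j < 3" "i = Suc j \<or> j = Suc i \<or> i = j \<and> (i = 0 \<or> Suc i = 3)" for i j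
      using adj[OF that(1,2)] that(3) sympD[OF sym] by blast
    have "E (xs 0) (ys 2)" "E (xs 1) (ys 1)" "E (xs 2) (ys 0)" using adj by simp_all
    moreover have "separated E (xs 0) (ys 2) (xs 1) (ys 1)" "separated E (xs 0) (ys 2) (xs 2) (ys 0)"
      "separated E (xs 1) (ys 1) (xs 2) (ys 0)"
      using adj adj' ne by (simp_all add: separated_def)
    ultimately show ?thesis by blast
  next
    case False
    then have "2 * k \<ge> 8" using k by simp
    moreover have "has_induced_cycle (bigraph (\<lambda>x y. \<not> E x y) X (- X)) (2 * k)"
      unfolding has_induced_cycle_def using closed_zigzag_is_cycle[OF _ z xs ys]
      by (intro exI[of _ "xs ` {..<k} \<union> ys ` {..<k}"]) (auto simp: bigraph_def)
    ultimately show ?thesis by blast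
  qed
qed

text \<open>
  The multidegree is the vertex set of the cycle, and the homological degree is its length minus \<open>4\<close>.
\<close>

lemma induced_cycle_betti:
  fixes E :: "'v::finite \<Rightarrow> 'v \<Rightarrow> bool"
  assumes sym: "symp E" and bip: "\<And>u v. E u v \<Longrightarrow> u \<noteq> v \<Longrightarrow> u \<in> X \<longleftrightarrow> v \<notin> X"
    and "l \<ge> 5" "has_induced_cycle (bigraph (\<lambda>x y. \<not> E x y) X (- X)) l"
  shows "4 \<in> betti_range (monomial_ideal (edge_ideal E) :: ('v, 'k::field) mpol set)"
proof -
  let ?R = "\<lambda>x y. \<not> E x y"
  let ?B = "bigraph ?R X (- X)"
  obtain W where cyc: "is_cycle l (induced ?B W)" using assms(4) by (auto simp: has_induced_cycle_def)
  let ?C = "induced ?B W"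
  have card_W: "card W = l" and conn: "connected_graph ?C"
    and deg: "\<And>u. u \<in> W \<Longrightarrow> card {v \<in> W. {u, v} \<in> edges ?C} = 2"
    using cyc by (simp_all add: is_cycle_def)
  define X' where "X' = X \<inter> W"
  define Y' where "Y' = W - X"
  have XY: "X' \<inter> Y' = {}" "X' \<union> Y' = W" by (auto simp: X'_def Y'_def)
  note edge = bigraph_edge[of X "- X", simplified]
  have degX: "card {y \<in> Y'. ?R x y} = 2" if "x \<in> X'" for x
  proof -
    have "{v \<in> W. {x, v} \<in> edges ?C} = {y \<in> Y'. ?R x y}"
      using edge(1)[of x] that by (auto simp: X'_def Y'_def)
    then show ?thesis using deg[of x] that by (simp add: X'_def)
  qed
  have degY: "card {x \<in> X'. ?R x y} = 2" if "y \<in> Y'" for y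
  proof -
    have "{v \<in> W. {y, v} \<in> edges ?C} = {x \<in> X'. ?R x y}"
      using edge(2)[of y] that by (auto simp: X'_def Y'_def)
    then show ?thesis using deg[of y] that by (simp add: Y'_def)
  qed
  have "Y' \<noteq> {}"
  proof
    assume "Y' = {}"
    then have "X' = {}" using degX by fastforce
    then show False using \<open>Y' = {}\<close> XY(2) card_W assms(3) by auto
  qed
  then obtain y0 where y0: "y0 \<in> Y'" by blast
  (* Two vertices with the same two neighbours would span a square, which would be the whole cycle. *)
  have unique: "{x \<in> X'. ?R x y} \<noteq> {x \<in> X'. ?R x y0}" if y: "y \<in> Y'" "y \<noteq> y0" for y
  proof
    assume eq: "{x \<in> X'. ?R x y} = {x \<in> X'. ?R x y0}"
    define N where "N = {x \<in> X'. ?R x y0}"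
    have "card N = 2" using degY[OF y0] by (simp add: N_def)
    have N_nb: "{z \<in> Y'. ?R x z} = {y0, y}" if "x \<in> N" for x
    proof -
      have "{y0, y} \<subseteq> {z \<in> Y'. ?R x z}" using that eq y y0 by (auto simp: N_def)
      then show ?thesis using degX[of x] that y(2) by (intro card_subset_eq[symmetric]) (auto simp: N_def)
    qed
    have "verts ?C = N \<union> {y0, y}"
    proof (rule connected_graph_closed[OF conn])
      show "y0 \<in> N \<union> {y0, y}" by simp
      show "N \<union> {y0, y} \<subseteq> verts ?C" using y0 y XY by (auto simp: N_def)
      fix a b assume a: "a \<in> N \<union> {y0, y}" and ab: "{a, b} \<in> edges ?C"
      show "b \<in> N \<union> {y0, y}"
      proof (cases "a \<in> N")
        case True
        then have "b \<in> {z \<in> Y'. ?R a z}" using edge(1)[of a] ab by (auto simp: N_def X'_def Y'_def)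
        then show ?thesis using N_nb[OF True] by blast
      next
        case False
        then have "a \<in> Y'" "{x \<in> X'. ?R x a} = N" using a y y0 eq by (auto simp: N_def)
        then show ?thesis using edge(2)[of a] ab by (auto simp: X'_def Y'_def)
      qed
    qed
    then have "W = N \<union> {y0, y}" by simp
    then have "l \<le> card N + card {y0, y}" using card_W card_Un_le by metis
    then show False using \<open>card N = 2\<close> y(2) assms(3) by simp
  qed
  obtain ord where vo: "vertex_order ord" and
    ord: "\<And>u v. (if u \<in> X then 0 else 1 :: nat) < (if v \<in> X then 0 else 1) \<Longrightarrow> ord u < ord v"
    using exists_order_refining[of "\<lambda>v. if v \<in> X then 0 else 1"] by metis
  interpret vertex_order ord by (rule vo)
  have nE: "\<not> E u v" if "u \<in> X \<longleftrightarrow> v \<in> X" "u \<noteq> v" for u v using bip[of u v] that by blast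
  have "\<not> acyclic_at TYPE('k) (upper_koszul (edge_ideal E) (\<lambda>v. of_bool (v \<in> X' \<union> Y'))) (l - 4)"
  proof (rule induced_cycle_not_acyclic[OF sym XY(1) _ _ degX degY y0 unique])
    show "card (X' \<union> Y') = Suc (l - 4) + 3" using card_W assms(3) XY(2) by simp
    show "ord x < ord y" if "x \<in> X'" "y \<in> Y'" for x y using that by (intro ord) (simp add: X'_def Y'_def)
  qed (use nE in \<open>auto simp: X'_def Y'_def\<close>)
  moreover have "sum (\<lambda>v. of_bool (v \<in> X' \<union> Y') :: nat) UNIV = l"
    using card_W XY(2) by (simp flip: sum.inter_filter add: of_bool_def)
  ultimately have "int l - int (l - 4) \<in> betti_range (monomial_ideal (edge_ideal E) :: ('v, 'k) mpol set)"
    unfolding betti_range_iff by blast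
  then show ?thesis using assms(3) by simp
qed

text \<open>
  Each side of the bipartition is a clique of the complement. Of at least five vertices three lie on the
  same side; they form a triangle, which would be the whole cycle.
\<close>

lemma complement_no_long_induced_cycle:
  assumes bip: "bipartition H X Y" and l: "l \<ge> 5"
  shows "\<not> has_induced_cycle (complement_graph H) l"
proof
  assume "has_induced_cycle (complement_graph H) l"
  then obtain W where W: "W \<subseteq> verts H" and cyc: "is_cycle l (induced (complement_graph H) W)"
    by (auto simp: has_induced_cycle_def complement_graph_def)
  let ?C = "induced (complement_graph H) W"
  have card_W: "card W = l" and conn: "connected_graph ?C"
    and deg: "\<And>u. u \<in> W \<Longrightarrow> card {v \<in> W. {u, v} \<in> edges ?C} = 2"
    using cyc by (simp_all add: is_cycle_def)
  have fin: "finite W" using card_W l card.infinite by fastforce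
  have False if clique: "S \<subseteq> W" "\<And>a b. a \<in> S \<Longrightarrow> b \<in> S \<Longrightarrow> a \<noteq> b \<Longrightarrow> {a, b} \<in> edges ?C" "card S \<ge> 3" for S
  proof -
    have nb: "{v \<in> W. {a, v} \<in> edges ?C} = S - {a} \<and> card S = 3" if a: "a \<in> S" for a
    proof -
      let ?N = "{v \<in> W. {a, v} \<in> edges ?C}"
      have sub: "S - {a} \<subseteq> ?N" using clique a by blast
      have two: "card ?N = 2" using deg a clique(1) by blast
      have "finite S" using fin clique(1) by (rule rev_finite_subset)
      then have "card (S - {a}) = card S - 1" using a by simp
      moreover have "card (S - {a}) \<le> card ?N" using sub fin by (intro card_mono) auto
      ultimately have "card S = 3" "card (S - {a}) = card ?N" using two clique(3) by linarith+
      then show ?thesis using card_subset_eq[OF _ sub] fin by simp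
    qed
    have "S \<noteq> {}" using clique(3) by auto
    then obtain a where a: "a \<in> S" by blast
    have "verts ?C = S"
    proof (rule connected_graph_closed[OF conn a])
      show "S \<subseteq> verts ?C" using clique(1) by simp
      fix b c assume b: "b \<in> S" and bc: "{b, c} \<in> edges ?C"
      have "c \<in> W" using bc by (auto simp: induced_def)
      then have "c \<in> {v \<in> W. {b, v} \<in> edges ?C}" using bc by simp
      then show "c \<in> S" using nb[OF b] by blast
    qed
    then show False using nb[OF a] card_W l by simp
  qed
  moreover have "{a, b} \<in> edges ?C" if "a \<in> W" "b \<in> W" "a \<noteq> b" "a \<in> X \<and> b \<in> X \<or> a \<in> Y \<and> b \<in> Y" for a b
  proof -
    have "{a, b} \<notin> edges H"
    proof
      assume "{a, b} \<in> edges H"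
      then obtain x y where "x \<in> X" "y \<in> Y" "{a, b} = {x, y}" using bip by (auto simp: bipartition_def)
      then show False using that(4) bip by (auto simp: bipartition_def doubleton_eq_iff)
    qed
    then show ?thesis using that(1-3) W by (auto simp: induced_def complement_graph_def)
  qed
  moreover have "card (W \<inter> X) \<ge> 3 \<or> card (W \<inter> Y) \<ge> 3"
  proof -
    have "W = (W \<inter> X) \<union> (W \<inter> Y)" using W bip by (auto simp: bipartition_def)
    then have "card W \<le> card (W \<inter> X) + card (W \<inter> Y)" by (metis card_Un_le)
    then show ?thesis using card_W l by linarith
  qed
  ultimately show False by (metis IntD1 IntD2 Int_lower1)
qed

section \<open>Regularity three\<close>

theorem proposition4p2:
  fixes I :: "('v::finite, 'k::field) mpol set"
    and G :: "'v graph"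
  assumes "monomial_ideal_generated_in_degree 2 I"
    and "\<not> squarefree_monomial_ideal I"
    and "G = graph_of I"
    and "bipartite G"
  shows "regularity I = 3 \<longleftrightarrow>
    ((\<exists>e\<in>edges G. \<exists>f\<in>edges G. totally_disjoint G e f) \<or>
       (\<exists>l\<ge>5. has_induced_cycle (complement_graph (sqf G)) l)) \<and>
    \<not> (\<exists>e\<in>edges G. \<exists>f\<in>edges G. \<exists>g\<in>edges G.
         totally_disjoint G e f \<and> totally_disjoint G e g \<and> totally_disjoint G f g) \<and>
    \<not> (\<exists>l\<ge>8. has_induced_cycle (bipartite_complement (sqf G)) l)"
proof -
  define E where "E u v \<longleftrightarrow> Var u * Var v \<in> I" for u v
  have sym: "symp E" by (auto simp: symp_def E_def mult.commute)
  have I: "I = monomial_ideal (edge_ideal E)"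
    using degree_two_ideal[OF assms(1)] unfolding E_def[abs_def] .
  have verts: "verts G = UNIV" by (simp add: assms(3) graph_of_def)
  have edges: "edges G = {{u, v} | u v. E u v}" by (simp add: assms(3) graph_of_def E_def)
  have edge_iff: "{u, v} \<in> edges G \<longleftrightarrow> E u v" for u v
    using sympD[OF sym] by (auto simp: edges doubleton_eq_iff)
  have td: "totally_disjoint G {a, a'} {b, b'} \<longleftrightarrow> separated E a a' b b'" for a a' b b'
    by (auto simp: totally_disjoint_def edge_iff separated_def)
  (* The bipartition from which the bipartite complement is built. *)
  define P where "P = (SOME (X, Y). bipartition (sqf G) X Y)"
  obtain X Y where XY: "P = (X, Y)" by (cases P)
  have "case P of (X, Y) \<Rightarrow> bipartition (sqf G) X Y"
    unfolding P_def by (rule someI_ex) (use assms(4) in \<open>auto simp: bipartite_def\<close>)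
  then have bip_sqf: "bipartition (sqf G) X Y" by (simp add: XY)
  then have Y: "Y = - X" by (auto simp: bipartition_def sqf_def verts)
  have sqf_iff: "{u, v} \<in> edges (sqf G) \<longleftrightarrow> E u v" if "u \<noteq> v" for u v
    using that by (auto simp: sqf_def edge_iff)
  have bip: "u \<in> X \<longleftrightarrow> v \<notin> X" if "E u v" "u \<noteq> v" for u v
  proof -
    have "{u, v} \<in> edges (sqf G)" using that by (simp add: sqf_iff)
    then obtain x y where "x \<in> X" "y \<in> Y" "{u, v} = {x, y}" using bip_sqf by (auto simp: bipartition_def)
    then show ?thesis by (auto simp: Y doubleton_eq_iff)
  qed
  have "x \<in> X \<and> y \<in> - X \<and> {x, y} \<notin> edges (sqf G) \<longleftrightarrow> x \<in> X \<and> y \<in> - X \<and> \<not> E x y" for x y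
    using sqf_iff[of x y] by auto
  then have bc: "bipartite_complement (sqf G) = bigraph (\<lambda>x y. \<not> E x y) X (- X)"
    unfolding bipartite_complement_def P_def[symmetric] XY bigraph_def Let_def
    by (simp add: Y sqf_def verts)
  let ?two = "\<exists>a a' b b'. E a a' \<and> E b b' \<and> separated E a a' b b'"
  let ?three = "\<exists>a a' b b' c c'. E a a' \<and> E b b' \<and> E c c' \<and>
    separated E a a' b b' \<and> separated E a a' c c' \<and> separated E b b' c c'"
  let ?cycle = "\<exists>l\<ge>8. has_induced_cycle (bipartite_complement (sqf G)) l"
  have ex_edge: "(\<exists>e\<in>edges G. Q e) \<longleftrightarrow> (\<exists>u v. E u v \<and> Q {u, v})" for Q
    unfolding edges by blast
  have two: "(\<exists>e\<in>edges G. \<exists>f\<in>edges G. totally_disjoint G e f) \<longleftrightarrow> ?two"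
    unfolding ex_edge td by blast
  have three: "(\<exists>e\<in>edges G. \<exists>f\<in>edges G. \<exists>g\<in>edges G.
      totally_disjoint G e f \<and> totally_disjoint G e g \<and> totally_disjoint G f g) \<longleftrightarrow> ?three"
    unfolding ex_edge td by blast
  obtain ord0 :: "'v \<Rightarrow> nat" where "vertex_order ord0"
    using exists_order_refining[of "\<lambda>_. 0"] by blast
  then interpret vertex_order ord0 .
  let ?S = "betti_range I"
  have reg: "regularity I = Max ?S" by (simp add: regularity_def betti_range_def)
  have fin: "finite ?S" unfolding I by (rule finite_betti_range)
  have "\<exists>a b. E a b"
  proof (rule ccontr)
    assume "\<not> (\<exists>a b. E a b)"
    then have "edge_ideal E = (\<lambda>_. False)" by (simp add: edge_ideal_def fun_eq_iff)
    then have "I = monomial_ideal (\<lambda>_. False)" using I by simp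
    then have "I = ideal_generated (mon ` {})" unfolding ideal_generated_monomials by simp
    then show False using assms(2) unfolding squarefree_monomial_ideal_def by blast
  qed
  then have "2 \<in> ?S"
    unfolding I betti_range_iff by (metis edge_degree_not_acyclic[OF sym] diff_zero of_nat_0 of_nat_numeral)
  then have ne: "?S \<noteq> {}" by blast
  have lower3: "3 \<in> ?S" if edges_ab: "?two"
  proof -
    obtain a a' b b' where ab: "E a a'" "E b b'" "separated E a a' b b'" using edges_ab by blast
    obtain m where "sum m UNIV = 4" "\<not> acyclic_at TYPE('k) (upper_koszul (edge_ideal E) m) 1"
      by (rule two_separated_edges[OF sym ab])
    then show ?thesis unfolding I betti_range_iff by (intro exI[of _ m] exI[of _ 1]) (simp del: of_nat_sum)
  qed
  have lower4: "4 \<in> ?S" if edges_abc: "?three"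
  proof -
    obtain a a' b b' c c' where abc: "E a a'" "E b b'" "E c c'"
      "separated E a a' b b'" "separated E a a' c c'" "separated E b b' c c'" using edges_abc by blast
    define h where "h v = (if v \<in> {a, a'} then 0 else if v \<in> {b, b'} then 1 else 2 :: nat)" for v
    have disj: "{a, a'} \<inter> {b, b'} = {}" "{a, a'} \<inter> {c, c'} = {}" "{b, b'} \<inter> {c, c'} = {}"
      using separated_disjoint[OF sym] abc by blast+
    obtain ord where vo: "vertex_order ord" and ord: "\<And>u v. h u < h v \<Longrightarrow> ord u < ord v"
      using exists_order_refining[of h] by metis
    obtain m where "sum m UNIV = 6" "\<not> vertex_order.acyclic_at ord TYPE('k) (upper_koszul (edge_ideal E) m) 2"
    proof (rule vertex_order.three_separated_edges[OF vo sym abc])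
      show "ord u < ord v" if "u \<in> {a, a'}" "v \<in> {b, b'} \<union> {c, c'}" for u v
        using that disj by (intro ord) (auto simp: h_def)
      show "ord u < ord v" if "u \<in> {b, b'}" "v \<in> {c, c'}" for u v
        using that disj by (intro ord) (auto simp: h_def)
    qed
    then show ?thesis
      unfolding I vertex_order.betti_range_iff[OF vo] by (intro exI[of _ m] exI[of _ 2]) (simp del: of_nat_sum)
  qed
  have lower_cycle: "4 \<in> ?S" if cycle: "?cycle"
  proof -
    obtain l where "l \<ge> 8" and l: "has_induced_cycle (bigraph (\<lambda>x y. \<not> E x y) X (- X)) l"
      using cycle unfolding bc by blast
    then have "l \<ge> 5" by simp
    from induced_cycle_betti[OF sym bip this l] show ?thesis unfolding I .
  qed
  have upper2: "d \<le> 2" if "\<not> ?two" "d \<in> ?S" for d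
    using betti_range_bound[of E 2 d] reg_bound_two[where X = X, OF sym bip] that unfolding I by auto
  have upper3: "d \<le> 3" if "\<not> ?three" "\<not> ?cycle" "d \<in> ?S" for d
  proof -
    have no_long: "\<not> long_cycle (\<lambda>x y. \<not> E x y) X (- X)"
      using long_cycle_separated_or_induced[OF sym bip] that(1,2) unfolding bc by blast
    have "reg_bound TYPE('k) (edge_ideal E) m 3" for m
    proof (rule reg_bound_three[where X = X, OF sym bip _ no_long])
      fix a a' b b' c c'
      assume "E a a'" "E b b'" "E c c'" "separated E a a' b b'" "separated E a a' c c'" "separated E b b' c c'"
      then show False using that(1) by blast
    qed
    then show ?thesis using betti_range_bound[of E 3 d] that(3) unfolding I by auto
  qed
  have "Max ?S = 3 \<longleftrightarrow> ?two \<and> \<not> ?three \<and> \<not> ?cycle"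
  proof
    assume max: "Max ?S = 3"
    then have in3: "3 \<in> ?S" and le3: "\<And>d. d \<in> ?S \<Longrightarrow> d \<le> 3"
      using Max_in[OF fin ne] Max_ge[OF fin] by auto
    have "?two"
    proof (rule ccontr)
      assume "\<not> ?two"
      from upper2[OF this in3] show False by simp
    qed
    moreover have "\<not> ?three"
    proof
      assume "?three"
      from le3[OF lower4[OF this]] show False by simp
    qed
    moreover have "\<not> ?cycle"
    proof
      assume "?cycle"
      from le3[OF lower_cycle[OF this]] show False by simp
    qed
    ultimately show "?two \<and> \<not> ?three \<and> \<not> ?cycle" by blast
  next
    assume "?two \<and> \<not> ?three \<and> \<not> ?cycle"
    then show "Max ?S = 3" using lower3 upper3 fin by (intro Max_eqI) blast+
  qed
  moreover have "\<not> (\<exists>l\<ge>5. has_induced_cycle (complement_graph (sqf G)) l)"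
    using complement_no_long_induced_cycle[OF bip_sqf] by blast
  ultimately show ?thesis unfolding reg two three by blast
qed

end
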